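(* Let $p\ge5$ be a prime, and let $h=h(p)$ be defined by: $h=1$ if $p\equiv 11,23\pmod{24}$; $h=2$ if $p\equiv 5\pmod{24}$; $h=3$ if $p\equiv 7,19\pmod{24}$; $h=4$ if $p\equiv 17\pmod{24}$; $h=6$ if $p\equiv 13\pmod{24}$; $h=12$ if $p\equiv 1\pmod{24}$. Let $\eta_k(p)$ denote the complex vector space spanned by the $\eta$-quotients of level $p$ in $M_k(\Gamma_1(p))$. 1. If $p\equiv3\pmod4$, then, taking the limit over odd $k$ divisible by $h$, $$\lim_{k\to\infty}\frac{\dim\eta_k(p)}{\dim S_k\left(p,\left(\frac{\cdot}{p}\right)\right)}=\frac{2h}{p-1}.$$ 2. If $p\equiv3\pmod4$, then, taking the limit over even $k$ divisible by $h$, $$\lim_{k\to\infty}\frac{\dim\eta_k(p)}{\dim S_k(\Gamma_0(p))}=\frac{2h}{p-1}.$$ 3. If $p\equiv1\pmod4$, then, taking the limit over all $k$ divisible by $h$, $$\lim_{k\to\infty}\frac{\dim\eta_k(p)}{\dim S_k(\Gamma_0(p))+\dim S_k\left(p,\left(\frac{\cdot}{p}\right)\right)}=\frac{h}{p-1}.$$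
   Context: $\eta(z)=q^{1/24}\prod_{n\ge1}(1-q^n)$ with $q=e^{2\pi i z}$, for $z$ in the upper half plane. An $\eta$-quotient of level $p$ ($p$ prime) is a function $\eta(z)^{r_1}\eta(pz)^{r_p}$ with $r_1,r_p\in\mathbb Z$; its weight is $\frac12(r_1+r_p)$. $\Gamma_0(p)$ and $\Gamma_1(p)$ are the groups of matrices in $\mathrm{SL}_2(\mathbb Z)$ congruent modulo $p$ to $\begin{pmatrix}*&*\\0&*\end{pmatrix}$ and $\begin{pmatrix}1&*\\0&1\end{pmatrix}$ respectively. $M_k(\Gamma)$ and $S_k(\Gamma)$ are the spaces of (holomorphic) modular forms and of cusp forms of weight $k$ for $\Gamma$. For a Dirichlet character $\chi$ modulo $p$, $S_k(p,\chi)$ is the space of $f\in S_k(\Gamma_1(p))$ with $(cz+d)^{-k}f\left(\frac{az+b}{cz+d}\right)=\chi(d)f(z)$ for all $\begin{pmatrix}a&b\\c&d\end{pmatrix}\in\Gamma_0(p)$. $\left(\frac{\cdot}{p}\right)$ is the Legendre symbol. *)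

theory Defs
  imports
    "HOL-Complex_Analysis.Complex_Analysis"
    "HOL-Number_Theory.Number_Theory"
    "HOL-Library.Function_Algebras"
begin

text \<open>
  Functions on the upper half plane are represented by total functions on \<^typ>\<open>complex\<close>
  that vanish off the upper half plane. Without this normalisation the values off the upper half
  plane would be arbitrary, and every space of functions below would be infinite-dimensional.
\<close>

abbreviation upper_half_plane :: "complex set" where
  "upper_half_plane \<equiv> {z. Im z > 0}"

abbreviation cfun_scale :: "complex \<Rightarrow> (complex \<Rightarrow> complex) \<Rightarrow> complex \<Rightarrow> complex" where
  "cfun_scale \<equiv> (\<lambda>c f z. c * f z)"

text \<open>
  The addition on \<^typ>\<open>complex \<Rightarrow> complex\<close> is the pointwise one. The function
  \<open>cfun.dim\<close> returns \<open>0\<close> on infinite-dimensional spaces.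
\<close>

global_interpretation cfun: vector_space cfun_scale
  by unfold_locales (auto simp: fun_eq_iff algebra_simps)

definition SL2Z :: "(int^2^2) set" where
  "SL2Z = {A. det A = 1}"

definition Gamma0 :: "nat \<Rightarrow> (int^2^2) set" where
  "Gamma0 N = {A \<in> SL2Z. [A $ 2 $ 1 = 0] (mod int N)}"

definition Gamma1 :: "nat \<Rightarrow> (int^2^2) set" where
  "Gamma1 N = {A \<in> SL2Z. [A $ 1 $ 1 = 1] (mod int N) \<and> [A $ 2 $ 1 = 0] (mod int N) \<and>
                         [A $ 2 $ 2 = 1] (mod int N)}"

definition slash :: "int \<Rightarrow> int^2^2 \<Rightarrow> (complex \<Rightarrow> complex) \<Rightarrow> complex \<Rightarrow> complex" where
  "slash k A f z =
     (if z \<in> upper_half_plane then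
        (of_int (A $ 2 $ 1) * z + of_int (A $ 2 $ 2)) powi (- k) *
        f ((of_int (A $ 1 $ 1) * z + of_int (A $ 1 $ 2)) /
           (of_int (A $ 2 $ 1) * z + of_int (A $ 2 $ 2)))
      else 0)"

text \<open>
  \<open>q_expansion w a g\<close>: on the upper half plane, \<open>g\<close> is given by the convergent Fourier
  series of nonnegative powers of \<open>exp (2 \<pi> i z / w)\<close> with coefficients \<open>a\<close>.
\<close>

definition q_expansion :: "nat \<Rightarrow> (nat \<Rightarrow> complex) \<Rightarrow> (complex \<Rightarrow> complex) \<Rightarrow> bool" where
  "q_expansion w a g \<longleftrightarrow>
     (\<forall>z\<in>upper_half_plane.
        (\<lambda>n. a n * exp (2 * of_real pi * \<i> * z / of_nat w) ^ n) sums g z)"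

definition holomorphic_at_infinity :: "(complex \<Rightarrow> complex) \<Rightarrow> bool" where
  "holomorphic_at_infinity g \<longleftrightarrow> (\<exists>w>0. \<exists>a. q_expansion w a g)"

definition vanishes_at_infinity :: "(complex \<Rightarrow> complex) \<Rightarrow> bool" where
  "vanishes_at_infinity g \<longleftrightarrow> (\<exists>w>0. \<exists>a. q_expansion w a g \<and> a 0 = 0)"

text \<open>
  The behaviour at the cusp \<open>A\<infinity>\<close> is that of \<open>slash k A f\<close> at \<open>\<infinity>\<close>; every cusp of a
  congruence subgroup is of this form for some \<open>A\<close> in \<^term>\<open>SL2Z\<close>.
\<close>

definition modular_forms :: "int \<Rightarrow> (int^2^2) set \<Rightarrow> (complex \<Rightarrow> complex) set" where
  "modular_forms k \<Gamma> =
     {f. f holomorphic_on upper_half_plane \<and> (\<forall>z. z \<notin> upper_half_plane \<longrightarrow> f z = 0) \<and>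
         (\<forall>A\<in>\<Gamma>. slash k A f = f) \<and>
         (\<forall>A\<in>SL2Z. holomorphic_at_infinity (slash k A f))}"

definition cusp_forms :: "int \<Rightarrow> (int^2^2) set \<Rightarrow> (complex \<Rightarrow> complex) set" where
  "cusp_forms k \<Gamma> =
     {f \<in> modular_forms k \<Gamma>. \<forall>A\<in>SL2Z. vanishes_at_infinity (slash k A f)}"

definition cusp_forms_char :: "int \<Rightarrow> nat \<Rightarrow> (int \<Rightarrow> complex) \<Rightarrow> (complex \<Rightarrow> complex) set" where
  "cusp_forms_char k N \<psi> =
     {f \<in> cusp_forms k (Gamma1 N). \<forall>A\<in>Gamma0 N. slash k A f = (\<lambda>z. \<psi> (A $ 2 $ 2) * f z)}"

definition legendre_char :: "nat \<Rightarrow> int \<Rightarrow> complex" where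
  "legendre_char p d = of_int (Legendre d (int p))"

definition dedekind_eta :: "complex \<Rightarrow> complex" where
  "dedekind_eta z =
     exp (2 * of_real pi * \<i> * z / 24) *
     (\<Prod>n. 1 - exp (2 * of_real pi * \<i> * z) ^ Suc n)"

definition eta_quotient :: "nat \<Rightarrow> int \<Rightarrow> int \<Rightarrow> complex \<Rightarrow> complex" where
  "eta_quotient p r\<^sub>1 r\<^sub>p z =
     (if z \<in> upper_half_plane
      then dedekind_eta z powi r\<^sub>1 * dedekind_eta (of_nat p * z) powi r\<^sub>p else 0)"

definition eta_space :: "int \<Rightarrow> nat \<Rightarrow> (complex \<Rightarrow> complex) set" where
  "eta_space k p =
     cfun.span {f \<in> modular_forms k (Gamma1 p). \<exists>r\<^sub>1 r\<^sub>p. f = eta_quotient p r\<^sub>1 r\<^sub>p}"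

text \<open>The last branch is never reached for a prime \<open>p \<ge> 5\<close>.\<close>

definition eta_h :: "nat \<Rightarrow> nat" where
  "eta_h p =
     (if p mod 24 \<in> {11, 23} then 1
      else if p mod 24 = 5 then 2
      else if p mod 24 \<in> {7, 19} then 3
      else if p mod 24 = 17 then 4
      else if p mod 24 = 13 then 6
      else if p mod 24 = 1 then 12
      else undefined)"

text \<open>The limit \<open>k \<rightarrow> \<infinity>\<close> is taken along the \<open>k\<close> satisfying \<open>P\<close>.\<close>

abbreviation at_infinity_along :: "(nat \<Rightarrow> bool) \<Rightarrow> nat filter" where
  "at_infinity_along P \<equiv> inf sequentially (principal {k. P k})"

end

theory Submission
  imports Defs "HOL-Computational_Algebra.Fundamental_Theorem_Algebra" "HOL-Real_Asymp.Real_Asymp"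
begin

text \<open>
  Write \<open>\<Delta> = \<eta>\<^sup>2\<^sup>4\<close> and \<open>E(z) = \<eta>(z)\<^sup>p / \<eta>(p z)\<close>. Klein forms have weight \<open>- 1\<close> and are permuted by
  \<open>SL\<^sub>2(\<int>)\<close> without any multiplier system; for the inversion this is Liouville's theorem applied to a
  quotient of theta products. The fourth power of the product of the three Klein forms at the
  2-torsion points is a constant times \<open>1/\<Delta>\<close>, and the product of the Klein forms at \<open>(0, j/p)\<close>,
  \<open>1 \<le> j \<le> (p - 1)/2\<close>, is a constant times \<open>1/E\<close>. Gauss's lemma then shows that \<open>E\<close> has weight
  \<open>(p - 1)/2\<close> and character \<open>(\<cdot>/p)\<close> on \<open>\<Gamma>\<^sub>0(p)\<close>.

  An \<open>\<eta>\<close>-quotient in \<open>M\<^sub>k(\<Gamma>\<^sub>1(p))\<close> satisfies \<open>r\<^sub>1 + p r\<^sub>p = 24 n\<close> by translation invariance and is then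
  equal to \<open>E\<close> to the power \<open>- r\<^sub>p\<close> times \<open>\<Delta>\<^sup>n\<close>. Its order at \<open>\<infinity>\<close> is \<open>n\<close>, so \<open>dim \<eta>\<^sub>k(p)\<close> is the number of \<open>n\<close> with
  \<open>0 \<le> 12 n \<le> k (p + 1)\<close> and \<open>12 n \<equiv> k\<close> modulo \<open>(p - 1)/2\<close>, which is \<open>k (p + 1) h / (6 (p - 1)) + O(1)\<close>.

  Both spaces of cusp forms have dimension \<open>k (p + 1)/12 + O(1)\<close>. For the upper bound, a cusp form with order
  greater than \<open>k (p + 1)/12\<close> at \<open>\<infinity>\<close>, divided by an \<open>\<eta>\<close>-quotient all of whose zeros lie at \<open>\<infinity>\<close>, has
  \<open>\<Gamma>\<^sub>0(p)\<close>-invariant modulus and tends to \<open>0\<close> at both cusps, so it vanishes by the maximum principle.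
  For the lower bound, products of powers of \<open>E\<close>, \<open>\<Delta>\<close> and the Eisenstein series \<open>E\<^sub>4\<close>, times a fixed
  form of small weight, realise almost all orders up to \<open>k (p + 1)/12\<close> at \<open>\<infinity>\<close>.
\<close>

text \<open>Klein forms keep the multipliers elementary: the system of eta itself involves Dedekind
  sums, whereas a Klein form changes by explicit roots of unity when its characteristic moves by
  integers. These cancel in the fourth power and, because p is prime to 6, in the product over j.

  Origin of the constants: in powers of q, Delta has order 1 at both cusps and E has orders 0 at
  infinity and (p^2 - 1)/(24 p) at 0. So E^(-r) Delta^n has weight k = 12 n - r (p - 1)/2, and
  eliminating r turns holomorphy at 0 into 12 n <= k (p + 1). The number h is gcd(12, (p - 1)/2):
  for h dividing k, the congruence on n is one class modulo (p - 1)/(2 h), so about one admissible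
  order in (p - 1)/(2 h) belongs to an eta-quotient. This is the limit 2 h/(p - 1), halved when two
  spaces of cusp forms are added.

  Parity: -1 lies in Gamma_0(p) and the quadratic character sends it to (-1)^((p - 1)/2). Thus k
  must be even for the trivial character and congruent to (p - 1)/2 modulo 2 for the quadratic one;
  if p is 1 modulo 4, then h is even and both hold.\<close>

subsection \<open>Infinite products and theta functions\<close>

text \<open>The q-Pochhammer symbol (a; q)_infinity.\<close>

definition qpoch :: "complex \<Rightarrow> complex \<Rightarrow> complex" where
  "qpoch a q = (\<Prod>n. 1 - a * q ^ n)"

lemma qpoch_convergent:
  fixes a q :: complex
  assumes "norm q < 1"
  shows "convergent_prod (\<lambda>n. 1 - a * q ^ n)"
proof (rule abs_convergent_prod_imp_convergent_prod)
  have "summable (\<lambda>n. norm a * norm q ^ n)"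
    using assms by (intro summable_mult summable_geometric) auto
  then show "abs_convergent_prod (\<lambda>n. 1 - a * q ^ n)"
    by (simp add: summable_imp_abs_convergent_prod norm_mult norm_power)
qed

lemma qpoch_has_prod: "norm q < 1 \<Longrightarrow> (\<lambda>n. 1 - a * q ^ n) has_prod qpoch a q"
  unfolding qpoch_def by (rule convergent_prod_has_prod[OF qpoch_convergent])

lemma qpoch_LIMSEQ:
  assumes "norm q < 1"
  shows "(\<lambda>n. \<Prod>k<n. 1 - a * q ^ k) \<longlonglongrightarrow> qpoch a q"
  using convergent_prod_LIMSEQ[OF qpoch_convergent[OF assms]] LIMSEQ_lessThan_iff_atMost
  unfolding qpoch_def by blast

text \<open>Uniformity on compact sets of pairs (a, q) gives holomorphy when both arguments depend
  on z, and continuity at (0, 0), which yields the limits at a cusp.\<close>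

lemma qpoch_uniform_limit:
  assumes "compact K" "K \<subseteq> UNIV \<times> ball 0 1"
  shows "uniform_limit K (\<lambda>n x. \<Prod>k<n. 1 - fst x * snd x ^ k) (\<lambda>x. qpoch (fst x) (snd x)) sequentially"
proof -
  have "uniformly_convergent_on K (\<lambda>n x. \<Prod>k<n. 1 - fst x * snd x ^ k)"
  proof (rule uniformly_convergent_on_prod')
    have "compact (fst ` K)" and cs: "compact (snd ` K)"
      using assms(1) by (auto intro!: compact_continuous_image continuous_intros)
    then obtain R where R: "\<And>x. x \<in> K \<Longrightarrow> norm (fst x) \<le> R"
      by (metis bounded_iff compact_imp_bounded image_eqI)
    have "\<exists>r<1. \<forall>x\<in>K. norm (snd x) \<le> r"
    proof (cases "K = {}")
      case False
      then obtain y where "y \<in> snd ` K" "\<forall>z\<in>snd ` K. norm z \<le> norm y"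
        using continuous_attains_sup[OF cs, of norm] by (auto intro!: continuous_intros)
      with assms(2) show ?thesis by (intro exI[of _ "norm y"]) auto
    qed (auto intro: exI[of _ 0])
    then obtain r where r: "r < 1" "\<And>x. x \<in> K \<Longrightarrow> norm (snd x) \<le> r" by auto
    show "uniformly_convergent_on K (\<lambda>N x. \<Sum>n<N. norm (1 - fst x * snd x ^ n - 1))"
    proof (cases "K = {}")
      case False
      then obtain x0 where "x0 \<in> K" by auto
      have rR: "r \<ge> 0" "R \<ge> 0" using r(2)[OF \<open>x0 \<in> K\<close>] R[OF \<open>x0 \<in> K\<close>] norm_ge_zero order_trans by blast+
      show ?thesis
      proof (rule Weierstrass_m_test')
        show "summable (\<lambda>n. R * r ^ n)" using r(1) rR by (intro summable_mult summable_geometric) auto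
        show "norm (norm (1 - fst x * snd x ^ n - 1)) \<le> R * r ^ n" if "x \<in> K" for n x
          using R[OF that] r(2)[OF that] rR by (auto simp: norm_mult norm_power intro!: mult_mono power_mono)
      qed
    qed simp
  qed (use assms in \<open>auto intro!: continuous_intros\<close>)
  then obtain l where l: "uniform_limit K (\<lambda>n x. \<Prod>k<n. 1 - fst x * snd x ^ k) l sequentially"
    unfolding uniformly_convergent_on_def by blast
  have "l x = qpoch (fst x) (snd x)" if "x \<in> K" for x
  proof -
    have "norm (snd x) < 1" using that assms(2) by (cases x) auto
    then show ?thesis
      using LIMSEQ_unique[OF tendsto_uniform_limitI[OF l that] qpoch_LIMSEQ] by simp
  qed
  then show ?thesis using l by (subst (asm) uniform_limit_cong') auto
qed

lemma qpoch_continuous_on: "continuous_on (UNIV \<times> ball 0 1) (\<lambda>x. qpoch (fst x) (snd x))"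
proof (rule continuous_at_imp_continuous_on, rule ballI)
  fix x :: "complex \<times> complex" assume x: "x \<in> UNIV \<times> ball 0 1"
  then obtain e where e: "e > 0" "cball x e \<subseteq> UNIV \<times> ball 0 1"
    using open_contains_cball[of "UNIV \<times> ball (0::complex) 1"] open_Times open_UNIV open_ball by blast
  have "continuous_on (cball x e) (\<lambda>x. qpoch (fst x) (snd x))"
    by (rule uniform_limit_theorem[OF _ qpoch_uniform_limit[OF compact_cball e(2)]])
       (auto intro!: always_eventually continuous_intros)
  then show "isCont (\<lambda>x. qpoch (fst x) (snd x)) x"
    using e(1) by (intro continuous_on_interior[of "cball x e"]) (auto simp: interior_cball)
qed

lemma qpoch_holomorphic [holomorphic_intros]:
  assumes "A holomorphic_on S" "Q holomorphic_on S" "open S" "\<And>z. z \<in> S \<Longrightarrow> norm (Q z) < 1"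
  shows "(\<lambda>z. qpoch (A z) (Q z)) holomorphic_on S"
proof (rule holomorphic_uniform_sequence[OF assms(3)])
  fix n show "(\<lambda>z. \<Prod>k<n. 1 - A z * Q z ^ k) holomorphic_on S"
    using assms by (intro holomorphic_intros) auto
next
  fix z assume "z \<in> S"
  then obtain e where e: "e > 0" "cball z e \<subseteq> S" using assms(3) open_contains_cball by blast
  have "continuous_on (cball z e) (\<lambda>z. (A z, Q z))"
    using e assms by (intro continuous_intros holomorphic_on_imp_continuous_on) (auto intro: holomorphic_on_subset)
  then have "compact ((\<lambda>z. (A z, Q z)) ` cball z e)"
    by (intro compact_continuous_image) auto
  then have "uniform_limit ((\<lambda>z. (A z, Q z)) ` cball z e) (\<lambda>n x. \<Prod>k<n. 1 - fst x * snd x ^ k) (\<lambda>x. qpoch (fst x) (snd x)) sequentially"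
    using e assms(4) by (intro qpoch_uniform_limit) auto
  then have "uniform_limit (cball z e) (\<lambda>n z. \<Prod>k<n. 1 - A z * Q z ^ k) (\<lambda>z. qpoch (A z) (Q z)) sequentially"
    unfolding uniform_limit_iff by auto
  with e show "\<exists>d>0. cball z d \<subseteq> S \<and>
     uniform_limit (cball z d) (\<lambda>n z. \<Prod>k<n. 1 - A z * Q z ^ k) (\<lambda>z. qpoch (A z) (Q z)) sequentially" by blast
qed

lemma qpoch_zero_left [simp]: "qpoch 0 q = 1"
  by (simp add: qpoch_def)

lemma qpoch_tendsto_1:
  assumes "(A \<longlongrightarrow> 0) F" "(Q \<longlongrightarrow> 0) F"
  shows "((\<lambda>z. qpoch (A z) (Q z)) \<longlongrightarrow> 1) F"
proof -
  have "isCont (\<lambda>x. qpoch (fst x) (snd x)) (0, 0)"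
    using qpoch_continuous_on by (rule continuous_on_interior) (auto simp: interior_Times)
  from isCont_tendsto_compose[OF this tendsto_Pair[OF assms]] show ?thesis by simp
qed

lemma qpoch_eq_0_iff:
  assumes "norm q < 1"
  shows "qpoch a q = 0 \<longleftrightarrow> (\<exists>n. a * q ^ n = 1)"
proof -
  have "qpoch a q = 0 \<longleftrightarrow> (\<exists>n. 1 - a * q ^ n = 0)"
    using has_prod_eq_0_iff[OF qpoch_has_prod[OF assms, of a]] by auto
  then show ?thesis by (metis eq_iff_diff_eq_0)
qed

lemma qpoch_step:
  assumes "norm q < 1"
  shows "qpoch a q = (1 - a) * qpoch (a * q) q"
proof -
  have "(\<lambda>n. \<Prod>k<Suc n. 1 - a * q ^ k) \<longlonglongrightarrow> qpoch a q"
    using qpoch_LIMSEQ[OF assms, of a] by (rule LIMSEQ_Suc)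
  moreover have "(\<Prod>k<Suc n. 1 - a * q ^ k) = (1 - a) * (\<Prod>k<n. 1 - a * q * q ^ k)" for n
    by (subst prod.lessThan_Suc_shift) (simp add: mult_ac)
  moreover have "(\<lambda>n. (1 - a) * (\<Prod>k<n. 1 - a * q * q ^ k)) \<longlonglongrightarrow> (1 - a) * qpoch (a * q) q"
    by (intro tendsto_intros qpoch_LIMSEQ assms)
  ultimately show ?thesis using LIMSEQ_unique by auto
qed

lemma qpoch_even_odd:
  assumes "norm q < 1"
  shows "qpoch a (q\<^sup>2) * qpoch (a * q) (q\<^sup>2) = qpoch a q"
proof -
  have q2: "norm (q\<^sup>2) < 1" using assms by (simp add: norm_power power_less_one_iff)
  have "(\<Prod>k<n. 1 - a * (q\<^sup>2) ^ k) * (\<Prod>k<n. 1 - a * q * (q\<^sup>2) ^ k) = (\<Prod>k<2*n. 1 - a * q ^ k)" for n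
    by (induction n) (simp_all add: algebra_simps flip: power_mult)
  moreover have "(\<lambda>n. (\<Prod>k<n. 1 - a * (q\<^sup>2) ^ k) * (\<Prod>k<n. 1 - a * q * (q\<^sup>2) ^ k)) \<longlonglongrightarrow>
      qpoch a (q\<^sup>2) * qpoch (a * q) (q\<^sup>2)"
    by (intro tendsto_intros qpoch_LIMSEQ q2)
  moreover have "(\<lambda>n. \<Prod>k<2*n. 1 - a * q ^ k) \<longlonglongrightarrow> qpoch a q"
    using LIMSEQ_subseq_LIMSEQ[OF qpoch_LIMSEQ[OF assms, of a], of "\<lambda>n. 2 * n"]
    by (auto simp: strict_mono_def o_def)
  ultimately show ?thesis using LIMSEQ_unique by auto
qed

text \<open>The \<open>\<zeta> i\<close> stand for the N-th roots of unity; the last hypothesis, the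
  factorisation of 1 - b^N, is applied to every factor b = a q^k of the infinite product.\<close>

lemma qpoch_prod_rotate:
  assumes "norm q < 1" "finite I" "N > 0" "\<And>b. (\<Prod>i\<in>I. 1 - \<zeta> i * b) = 1 - b ^ N"
  shows "(\<Prod>i\<in>I. qpoch (\<zeta> i * a) q) = qpoch (a ^ N) (q ^ N)"
proof -
  have qN: "norm (q ^ N) < 1" using assms(1,3) by (simp add: norm_power power_less_one_iff)
  have "(\<lambda>n. \<Prod>i\<in>I. \<Prod>k<n. 1 - \<zeta> i * a * q ^ k) \<longlonglongrightarrow> (\<Prod>i\<in>I. qpoch (\<zeta> i * a) q)"
    by (intro tendsto_prod qpoch_LIMSEQ assms)
  moreover have "(\<Prod>i\<in>I. \<Prod>k<n. 1 - \<zeta> i * a * q ^ k) = (\<Prod>k<n. 1 - a ^ N * (q ^ N) ^ k)" for n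
  proof -
    have "(\<Prod>i\<in>I. \<Prod>k<n. 1 - \<zeta> i * a * q ^ k) = (\<Prod>k<n. \<Prod>i\<in>I. 1 - \<zeta> i * (a * q ^ k))"
      by (subst prod.swap) (simp add: mult_ac)
    then show ?thesis by (simp add: assms(4) power_mult_distrib flip: power_mult) (simp add: mult.commute)
  qed
  ultimately show ?thesis using qpoch_LIMSEQ[OF qN, of "a ^ N"] LIMSEQ_unique by auto
qed

section \<open>The variable q and theta functions in product form\<close>

definition nome :: "complex \<Rightarrow> complex" where
  "nome z = exp (2 * of_real pi * \<i> * z)"

lemma nome_add: "nome (z + w) = nome z * nome w"
  by (simp add: nome_def exp_add ring_distribs)

lemma nome_minus: "nome (- z) = inverse (nome z)"
  by (simp add: nome_def exp_minus)

lemma nome_diff: "nome (z - w) = nome z / nome w"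
  by (simp add: nome_def exp_diff ring_distribs)

lemma nome_nonzero [simp]: "nome z \<noteq> 0"
  by (simp add: nome_def)

lemma nome_0 [simp]: "nome 0 = 1"
  by (simp add: nome_def)

lemma norm_nome: "norm (nome z) = exp (- 2 * pi * Im z)"
  by (simp add: nome_def norm_exp_eq_Re)

lemma norm_nome_less_1 [simp]: "norm (nome z) < 1 \<longleftrightarrow> Im z > 0"
  by (simp add: norm_nome zero_less_mult_iff)

lemma nome_eq_1_iff: "nome z = 1 \<longleftrightarrow> z \<in> \<int>"
proof -
  have "nome z = 1 \<longleftrightarrow> Im z = 0 \<and> (\<exists>n::int. 2 * pi * Re z = of_int (2 * n) * pi)"
    by (simp add: nome_def exp_eq_1)
  also have "\<dots> \<longleftrightarrow> Im z = 0 \<and> (\<exists>n::int. Re z = of_int n)"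
    by (intro arg_cong2[of _ _ _ _ "(\<and>)"] refl ex_cong1) auto
  also have "\<dots> \<longleftrightarrow> (\<exists>n::int. z = of_int n)"
    by (auto simp: complex_eq_iff)
  finally show ?thesis by (auto simp: Ints_def)
qed

lemma nome_of_int [simp]: "nome (of_int n) = 1"
  by (simp add: nome_eq_1_iff)

lemma nome_of_nat [simp]: "nome (of_nat n) = 1"
  by (simp add: nome_eq_1_iff)

lemma nome_1 [simp]: "nome 1 = 1"
  using nome_of_int[of 1] by (simp del: nome_of_int)

lemma nome_power: "nome z ^ n = nome (of_nat n * z)"
  by (simp add: nome_def mult_ac flip: exp_of_nat_mult)

lemma nome_holomorphic [holomorphic_intros]:
  "f holomorphic_on S \<Longrightarrow> (\<lambda>z. nome (f z)) holomorphic_on S"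
  unfolding nome_def by (intro holomorphic_intros)

text \<open>Euler's product over 1 - q^n with n >= 1, that is, eta without its factor
  q^(1/24).\<close>

definition euler_prod :: "complex \<Rightarrow> complex" where
  "euler_prod t = qpoch (nome t) (nome t)"

lemma euler_prod_nonzero:
  assumes "Im t > 0" shows "euler_prod t \<noteq> 0"
proof -
  have "nome t * nome t ^ n \<noteq> 1" for n
  proof
    assume "nome t * nome t ^ n = 1"
    then have "norm (nome t) ^ Suc n = 1" by (metis norm_one norm_power power_Suc)
    moreover have "norm (nome t) ^ Suc n < 1" using assms by (subst power_less_one_iff) auto
    ultimately show False by simp
  qed
  then show ?thesis using assms by (simp add: euler_prod_def qpoch_eq_0_iff)
qed

text \<open>By Jacobi's triple product this is the odd theta function up to factors without zeros,
  written so that zeros and quasi-periods can be read off.\<close>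

definition theta :: "complex \<Rightarrow> complex \<Rightarrow> complex" where
  "theta u t = qpoch (nome u) (nome t) * qpoch (nome (t - u)) (nome t)"

lemma theta_holomorphic: "Im t > 0 \<Longrightarrow> (\<lambda>u. theta u t) holomorphic_on UNIV"
  unfolding theta_def by (intro holomorphic_intros) auto

lemma theta_add_1: "theta (u + 1) t = theta u t"
  by (simp add: theta_def nome_add nome_diff)

lemma theta_add_tau:
  assumes "Im t > 0" shows "theta (u + t) t = - nome (- u) * theta u t"
proof -
  have "qpoch (nome u) (nome t) = (1 - nome u) * qpoch (nome (u + t)) (nome t)"
    using qpoch_step[of "nome t" "nome u"] assms by (simp add: nome_add)
  moreover have "qpoch (nome (- u)) (nome t) = (1 - nome (- u)) * qpoch (nome (t - u)) (nome t)"
    using qpoch_step[of "nome t" "nome (- u)"] assms by (simp add: nome_diff nome_minus field_simps)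
  moreover have "1 - nome (- u) = - nome (- u) * (1 - nome u)"
    by (simp add: nome_minus field_simps)
  moreover have "theta (u + t) t = qpoch (nome (u + t)) (nome t) * qpoch (nome (- u)) (nome t)"
    by (simp add: theta_def)
  ultimately show ?thesis
    by (simp add: theta_def mult_ac)
qed

lemma theta_0 [simp]: "Im t > 0 \<Longrightarrow> theta 0 t = 0"
  using qpoch_step[of "nome t" 1] by (simp add: theta_def)

lemma shift_int_multiple:
  fixes f :: "complex \<Rightarrow> 'a"
  assumes "\<And>z. f (z + c) = f z"
  shows "f (z + of_int n * c) = f z"
proof (induction n rule: int_induct[where k = 0])
  case (step1 i)
  then show ?case using assms[of "z + of_int i * c"] by (simp add: algebra_simps)
next
  case (step2 i)
  then show ?case using assms[of "z + of_int (i - 1) * c"] by (simp add: algebra_simps)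
qed auto

lemma theta_eq_0_iff:
  assumes t: "Im t > 0"
  shows "theta u t = 0 \<longleftrightarrow> (\<exists>m n::int. u = of_int m + of_int n * t)"
proof
  assume "theta u t = 0"
  then consider n where "nome u * nome t ^ n = 1" | n where "nome (t - u) * nome t ^ n = 1"
    using t by (auto simp: theta_def qpoch_eq_0_iff)
  then show "\<exists>m n::int. u = of_int m + of_int n * t"
  proof cases
    case 1
    then have "nome (u + of_nat n * t) = 1" by (simp add: nome_add nome_power)
    then obtain m where "u + of_nat n * t = of_int m" by (auto simp: nome_eq_1_iff Ints_def)
    then have "u = of_int m + of_int (- int n) * t" by (simp add: algebra_simps)
    then show ?thesis by blast
  next
    case 2
    then have "nome (t - u + of_nat n * t) = 1" by (simp add: nome_add nome_power)
    then obtain m where "t - u + of_nat n * t = of_int m" by (auto simp: nome_eq_1_iff Ints_def)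
    then have "u = of_int (- m) + of_int (int n + 1) * t" by (simp add: algebra_simps)
    then show ?thesis by blast
  qed
next
  assume "\<exists>m n::int. u = of_int m + of_int n * t"
  then obtain m n :: int where u: "u = of_int m + of_int n * t" by blast
  have "(theta (z + t) t = 0) = (theta z t = 0)" for z
    using theta_add_tau[OF t, of z] by simp
  from shift_int_multiple[of "\<lambda>z. theta z t = 0", OF this] 
    shift_int_multiple[of "\<lambda>z. theta z t" 1, OF theta_add_1, of 0 m]
  show "theta u t = 0" using u t by simp
qed

text \<open>Every value is already taken on a compact period parallelogram, so Liouville's theorem
  applies.\<close>

lemma doubly_periodic_entire_constant:
  assumes F: "F holomorphic_on UNIV" and t: "Im t > 0"
    and per: "\<And>z. F (z + 1) = F z" "\<And>z. F (z + t) = F z"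
  shows "F z = F 0"
proof -
  let ?K = "(\<lambda>(a, b). complex_of_real a + complex_of_real b * t) ` ({0..1} \<times> {0..1})"
  have K: "compact ?K"
    by (intro compact_continuous_image compact_Times) (auto simp: case_prod_unfold intro!: continuous_intros)
  have "continuous_on ?K F"
    using F by (intro holomorphic_on_imp_continuous_on) (auto intro: holomorphic_on_subset)
  then have "bounded (F ` ?K)"
    using K compact_continuous_image compact_imp_bounded by blast
  moreover have "F u \<in> F ` ?K" for u
  proof -
    define b where "b = Im u / Im t"
    define a where "a = Re u - b * Re t"
    have u: "u = of_real a + of_real b * t"
      using t by (simp add: complex_eq_iff a_def b_def)
    have "F (of_real (frac a) + of_real (frac b) * t) =
        F ((of_real (frac a) + of_real (frac b) * t + of_int \<lfloor>a\<rfloor> * 1) + of_int \<lfloor>b\<rfloor> * t)"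
      using per by (simp only: shift_int_multiple)
    also have "(of_real (frac a) + of_real (frac b) * t + of_int \<lfloor>a\<rfloor> * 1) + of_int \<lfloor>b\<rfloor> * t = u"
      by (simp add: u frac_def algebra_simps)
    finally have "F u = F (of_real (frac a) + of_real (frac b) * t)" by simp
    moreover have "frac a \<in> {0..1}" "frac b \<in> {0..1}"
      using frac_lt_1[of a] frac_lt_1[of b] by auto
    ultimately show ?thesis
      by (intro image_eqI[OF _ image_eqI[of _ _ "(frac a, frac b)"]]) auto
  qed
  ultimately have "bounded (range F)"
    by (meson bounded_subset image_subsetI)
  then obtain c where "\<And>z. F z = c" using Liouville_theorem[OF F] unfolding constant_on_def by blast
  then show ?thesis by simp
qed

text \<open>The quotient of the derivatives at 0; it produces the factor \<open>t\<close> in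
  \<open>theta_inversion\<close>.\<close>

lemma nome_quotient_tendsto:
  assumes "t \<noteq> 0"
  shows "((\<lambda>u. (1 - nome (u / t)) / (1 - nome u)) \<longlongrightarrow> 1 / t) (at 0)"
proof -
  define f where "f c u = (nome (u / c) - 1) / u" for c u
  have lim: "(f c \<longlongrightarrow> 2 * of_real pi * \<i> / c) (at 0)" if "c \<noteq> 0" for c
  proof -
    have "((\<lambda>u. nome (u / c)) has_field_derivative 2 * of_real pi * \<i> / c) (at 0)"
      unfolding nome_def using that by (auto intro!: derivative_eq_intros)
    moreover have "f c = (\<lambda>h. (nome (h / c) - 1) / h)" by (simp add: f_def fun_eq_iff)
    ultimately show ?thesis by (simp add: DERIV_def)
  qed
  have "((\<lambda>u. f t u / f 1 u) \<longlongrightarrow> (2 * of_real pi * \<i> / t) / (2 * of_real pi * \<i> / 1)) (at 0)"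
    using assms by (intro tendsto_divide lim) auto
  moreover have "eventually (\<lambda>u. f t u / f 1 u = (1 - nome (u / t)) / (1 - nome u)) (at 0)"
  proof -
    have "(x - 1) / (y - 1) = (1 - x) / (1 - y)" for x y :: complex
      by (metis minus_diff_eq minus_divide_left minus_divide_right minus_minus)
    then show ?thesis
      by (auto simp: eventually_at_filter f_def intro!: always_eventually)
  qed
  ultimately show ?thesis
    by (subst (asm) tendsto_cong) auto
qed

text \<open>The exponential is chosen so that, together with it, the left theta function has the
  same multipliers as \<open>theta u t\<close> under u -> u + 1 and u -> u + t. Both sides vanish on
  the lattice, so their quotient extends to a doubly periodic entire function; it is constant, and
  its value is read off at u = 0.\<close>

lemma theta_inversion:
  assumes t: "Im t > 0"
  shows "theta (u / t) (- 1 / t) * exp (of_real pi * \<i> * (u - u / t - u\<^sup>2 / t)) * t * (euler_prod t)\<^sup>2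
         = (euler_prod (- 1 / t))\<^sup>2 * theta u t"
proof -
  define t' where "t' = - 1 / t"
  have t0: "t \<noteq> 0" using t by auto
  have t': "Im t' > 0" using t by (simp add: t'_def Im_divide sum_power2_gt_zero_iff)
  define Q where "Q u = theta (u / t) t' * exp (of_real pi * \<i> * (u - u / t - u\<^sup>2 / t))" for u
  define L where "L = {of_int m + of_int n * t | m n :: int. True}"
  \<comment> \<open>The limit of \<open>Q u / theta u t\<close> at 0, taken as the value of
    \<open>F\<close> at all lattice points, as periodicity demands.\<close>
  define c where "c = (euler_prod t')\<^sup>2 / (euler_prod t)\<^sup>2 / t"
  define F where "F u = (if u \<in> L then c else Q u / theta u t)" for u
  have L_iff: "u \<in> L \<longleftrightarrow> theta u t = 0" for u
    using theta_eq_0_iff[OF t] by (auto simp: L_def)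
  have L_1: "u + 1 \<in> L \<longleftrightarrow> u \<in> L" and L_t: "u + t \<in> L \<longleftrightarrow> u \<in> L" for u
    using theta_add_1[of u t] theta_add_tau[OF t, of u] by (simp_all add: L_iff)
  have Q_t: "Q (u + t) = - nome (- u) * Q u" for u
  proof -
    have "theta ((u + t) / t) t' = theta (u / t) t'"
      using theta_add_1[of "u / t" t'] t0 by (simp add: add_divide_distrib)
    moreover have "of_real pi * \<i> * (u + t - (u + t) / t - (u + t)\<^sup>2 / t) =
        of_real pi * \<i> * (u - u / t - u\<^sup>2 / t) + (2 * of_real pi * \<i> * (- u)) - \<i> * of_real pi"
      using t0 by (simp add: field_simps power2_eq_square)
    ultimately show ?thesis
      by (simp add: Q_def nome_def exp_add exp_diff exp_minus divide_inverse)
  qed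
  have Q_1: "Q (u + 1) = Q u" for u
  proof -
    have u: "u / t = (u + 1) / t + t'" by (simp add: t'_def add_divide_distrib)
    have "theta (u / t) t' = - nome (- ((u + 1) / t)) * theta ((u + 1) / t) t'"
      using theta_add_tau[OF t', of "(u + 1) / t"] u by simp
    then have "theta ((u + 1) / t) t' = - nome ((u + 1) / t) * theta (u / t) t'"
      by (simp add: nome_minus)
    moreover have "2 * of_real pi * \<i> * ((u + 1) / t) + of_real pi * \<i> * (u + 1 - (u + 1) / t - (u + 1)\<^sup>2 / t) =
        of_real pi * \<i> * (u - u / t - u\<^sup>2 / t) + \<i> * of_real pi"
      using t0 by (simp add: field_simps power2_eq_square)
    then have "nome ((u + 1) / t) * exp (of_real pi * \<i> * (u + 1 - (u + 1) / t - (u + 1)\<^sup>2 / t)) =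
        - exp (of_real pi * \<i> * (u - u / t - u\<^sup>2 / t))"
      unfolding nome_def exp_add[symmetric] by (simp add: exp_add)
    ultimately show ?thesis
      unfolding Q_def by (simp add: mult_ac)
  qed
  have Q_L: "Q u = 0" if "u \<in> L" for u
  proof -
    obtain m n :: int where "u = of_int m + of_int n * t" using \<open>u \<in> L\<close> unfolding L_def by blast
    then have "u / t = of_int n + of_int (- m) * t'" using t0 by (simp add: t'_def field_simps)
    then have "theta (u / t) t' = 0" using theta_eq_0_iff[OF t'] by blast
    then show ?thesis by (simp add: Q_def)
  qed
  have F_1: "F (z + 1) = F z" and F_t: "F (z + t) = F z" for z
    by (simp_all add: F_def L_1 L_t Q_1 Q_t theta_add_1 theta_add_tau[OF t])
  have Qhol: "Q holomorphic_on UNIV"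
    unfolding Q_def theta_def using t' t0 by (intro holomorphic_intros) auto
  have openL: "open (- L)"
  proof -
    have "continuous_on UNIV (\<lambda>u. theta u t)"
      by (intro holomorphic_on_imp_continuous_on theta_holomorphic t)
    then have "closed {u. theta u t = 0}" by (intro closed_Collect_eq) auto
    then show ?thesis by (simp add: L_iff[symmetric] open_Compl)
  qed
  have offL: "F holomorphic_on - L"
  proof (rule holomorphic_transform)
    show "(\<lambda>u. Q u / theta u t) holomorphic_on - L"
      using Qhol theta_holomorphic[OF t] by (intro holomorphic_intros) (auto simp: L_iff intro: holomorphic_on_subset)
  qed (simp add: F_def)
  \<comment> \<open>\<open>theta u t\<close> with the factor \<open>1 - nome u\<close> removed; the
    quotient of the removed factors is left to \<open>nome_quotient_tendsto\<close>.\<close>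
  define th1 where "th1 u t = qpoch (nome (u + t)) (nome t) * qpoch (nome (t - u)) (nome t)" for u t
  have th1: "theta u t = (1 - nome u) * th1 u t" if "Im t > 0" for u t
    using qpoch_step[of "nome t" "nome u"] that by (simp add: theta_def th1_def nome_add)
  have th1hol: "(\<lambda>u. th1 (f u) t) holomorphic_on UNIV" if "Im t > 0" "f holomorphic_on UNIV" for t f
    unfolding th1_def using that by (intro holomorphic_intros) auto
  have th1_0: "th1 0 t = (euler_prod t)\<^sup>2" for t
    by (simp add: th1_def euler_prod_def power2_eq_square)
  have lim: "(F \<longlongrightarrow> c) (at 0)"
  proof -
    define G where "G u = th1 (u / t) t' * exp (of_real pi * \<i> * (u - u / t - u\<^sup>2 / t)) / th1 u t" for u
    have hd: "(\<lambda>u. u / t) holomorphic_on UNIV" using t0 by (intro holomorphic_intros) auto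
    have "isCont (\<lambda>u. th1 u t) 0" "isCont (\<lambda>u. th1 (u / t) t') 0"
      using th1hol[OF t, of "\<lambda>u. u"] th1hol[OF t' hd]
      by (auto intro!: continuous_on_interior[of UNIV] holomorphic_on_imp_continuous_on holomorphic_intros)
    then have "isCont G 0"
      unfolding G_def using t0 euler_prod_nonzero[OF t] by (intro continuous_intros) (auto simp: th1_0)
    moreover have "G 0 = (euler_prod t')\<^sup>2 / (euler_prod t)\<^sup>2" by (simp add: G_def th1_0)
    ultimately have "(G \<longlongrightarrow> (euler_prod t')\<^sup>2 / (euler_prod t)\<^sup>2) (at 0)" by (simp add: isCont_def)
    from tendsto_mult[OF this nome_quotient_tendsto[OF t0]]
    have *: "((\<lambda>u. G u * ((1 - nome (u / t)) / (1 - nome u))) \<longlongrightarrow> c) (at 0)"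
      by (simp add: c_def)
    \<comment> \<open>On the lattice \<open>F\<close> equals \<open>c\<close>, so the comparison
      with the limit holds at every point.\<close>
    have "F u = c \<or> F u = G u * ((1 - nome (u / t)) / (1 - nome u))" for u
      by (simp add: F_def G_def Q_def th1[OF t] th1[OF t'] mult_ac)
    then have "norm (F u - c) \<le> norm (G u * ((1 - nome (u / t)) / (1 - nome u)) - c)" for u
      by (metis diff_self norm_ge_zero norm_zero order_refl)
    with * show ?thesis
      by (subst LIM_zero_iff[symmetric], intro Lim_null_comparison[OF _ tendsto_norm_zero[OF LIM_zero[OF *]]])
         (auto intro!: always_eventually)
  qed
  have zeroL: "0 \<in> L" using t by (simp add: L_iff)
  obtain e where e: "e > 0" "F holomorphic_on ball 0 e"
  proof -
    have "(\<lambda>u. theta u t) holomorphic_on UNIV" using theta_holomorphic[OF t] .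
    \<comment> \<open>A point where theta does not vanish, so that its zeros are isolated.\<close>
    moreover have "theta (1/2) t \<noteq> 0"
    proof
      assume "theta (1/2) t = 0"
      then obtain m n :: int where mn: "1/2 = of_int m + of_int n * t" using theta_eq_0_iff[OF t] by blast
      from arg_cong[OF this, of Im] have "n = 0" using t by simp
      with mn have "of_int (2 * m) = (1 :: complex)" by (simp add: field_simps)
      then have "2 * m = 1" by (metis of_int_eq_1_iff)
      then show False by presburger
    qed
    ultimately obtain r where r: "0 < r" "\<And>z. z \<in> ball 0 r - {0} \<Longrightarrow> theta z t \<noteq> 0"
      using isolated_zeros[of "\<lambda>u. theta u t" UNIV 0 "1/2"] t
      by (metis DiffE UNIV_I connected_UNIV insertCI open_UNIV theta_0)
    have "F holomorphic_on ball 0 r"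
    proof (rule no_isolated_singularity[where K = "{0}"])
      show h: "F holomorphic_on ball 0 r - {0}"
        using r(2) by (intro holomorphic_on_subset[OF offL]) (auto simp: L_iff)
      have "isCont F 0" using lim zeroL by (simp add: isCont_def F_def)
      moreover have "isCont F z" if "z \<in> ball 0 r - {0}" for z
        using holomorphic_on_imp_continuous_on[OF h] that
        by (metis continuous_on_eq_continuous_at open_ball open_delete)
      ultimately show "continuous_on (ball 0 r) F"
        by (intro continuous_at_imp_continuous_on ballI) (metis Diff_iff singletonD)
    qed auto
    with r that show thesis by blast
  qed
  have Fhol: "F holomorphic_on UNIV"
  proof -
    have "\<exists>S. open S \<and> z \<in> S \<and> F holomorphic_on S" for z
    proof (cases "z \<in> L")
      case False
      then show ?thesis using openL offL by auto
    next
      case True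
      then obtain m n :: int where z: "z = of_int m + of_int n * t" by (auto simp: L_def)
      \<comment> \<open>Near any lattice point \<open>F\<close> is a translate of \<open>F\<close>
        near 0, where the singularity has just been removed.\<close>
      have per: "F w = F (w - z)" for w
        using shift_int_multiple[of F t "w - z + of_int m" n, OF F_t] shift_int_multiple[of F 1 "w - z" m, OF F_1]
        by (simp add: z)
      have "(F \<circ> (\<lambda>w. w - z)) holomorphic_on ball z e"
        by (intro holomorphic_on_compose_gen[OF _ e(2)] holomorphic_intros) (auto simp: dist_norm norm_minus_commute)
      then have "F holomorphic_on ball z e"
        by (rule holomorphic_transform) (unfold o_def, rule per[symmetric])
      then show ?thesis using e(1) by (intro exI[of _ "ball z e"]) auto
    qed
    then have "F analytic_on UNIV"
      by (subst analytic_on_analytic_at) (simp add: analytic_at)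
    then show ?thesis by (rule analytic_imp_holomorphic)
  qed
  have "F u = c" using doubly_periodic_entire_constant[OF Fhol t F_1 F_t, of u] zeroL by (simp add: F_def)
  then have "Q u = c * theta u t"
    using Q_L[of u] by (cases "u \<in> L") (auto simp: F_def L_iff field_simps)
  then show ?thesis
    using t0 euler_prod_nonzero[OF t] by (simp add: Q_def c_def t'_def field_simps)
qed

subsection \<open>Klein forms\<close>

abbreviation aff :: "int \<Rightarrow> int \<Rightarrow> complex \<Rightarrow> complex" where
  "aff a b z \<equiv> of_int a * z + of_int b"

abbreviation mob :: "int \<Rightarrow> int \<Rightarrow> int \<Rightarrow> int \<Rightarrow> complex \<Rightarrow> complex" where
  "mob a b c d z \<equiv> aff a b z / aff c d z"

lemma Im_mob:
  fixes a b c d :: int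
  assumes "a * d - b * c = 1"
  shows "Im (mob a b c d t) = Im t / (norm (aff c d t))\<^sup>2"
proof -
  have "real_of_int (a * d - b * c) = 1" using assms by simp
  then have 1: "real_of_int a * of_int d - of_int b * of_int c = 1" by simp
  have "Im t * (real_of_int c * Re t + of_int d) * of_int a - (of_int a * Re t + of_int b) * (of_int c * Im t)
    = Im t * (real_of_int a * of_int d - of_int b * of_int c)"
    by (simp add: algebra_simps)
  also have "\<dots> = Im t" unfolding 1 by simp
  finally show ?thesis
    unfolding Im_divide cmod_power2 by (simp add: algebra_simps)
qed

lemma aff_nonzero:
  fixes a b c d :: int
  assumes "a * d - b * c = 1" "Im t > 0"
  shows "aff c d t \<noteq> 0"
proof
  assume *: "aff c d t = 0"
  from arg_cong[OF *, of Im] assms(2) have "c = 0" by simp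
  with * have "d = 0" by simp
  with \<open>c = 0\<close> assms(1) show False by simp
qed

lemma Im_mob_pos:
  fixes a b c d :: int
  assumes "a * d - b * c = 1" "Im t > 0"
  shows "Im (mob a b c d t) > 0"
  using aff_nonzero[OF assms] assms by (simp add: Im_mob)

text \<open>Generation of SL2(Z) by S and T, proved by the Euclidean algorithm on the first column.
  Multiplication is from the left, which suits transformation laws: a law known for the image of t
  is carried on to the image under one more S or T.\<close>

lemma SL2_induct [consumes 1, case_names one S T T_inverse]:
  fixes a b c d :: int
  assumes "a * d - b * c = 1"
    and one: "P 1 0 0 1"
    and S: "\<And>a b c d. a * d - b * c = 1 \<Longrightarrow> P a b c d \<Longrightarrow> P (- c) (- d) a b"
    and T: "\<And>a b c d. a * d - b * c = 1 \<Longrightarrow> P a b c d \<Longrightarrow> P (a + c) (b + d) c d"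
    and T': "\<And>a b c d. a * d - b * c = 1 \<Longrightarrow> P a b c d \<Longrightarrow> P (a - c) (b - d) c d"
  shows "P a b c d"
proof -
  have Tn: "P (a + n * c) (b + n * d) c d" if "a * d - b * c = 1" "P a b c d" for a b c d n
  proof (induction n rule: int_induct[where k = 0])
    case (step1 n)
    then show ?case using T[of "a + n * c" d "b + n * d" c] that(1) by (simp add: algebra_simps)
  next
    case (step2 n)
    then show ?case using T'[of "a + n * c" d "b + n * d" c] that(1) by (simp add: algebra_simps)
  qed (use that in auto)
  have SS: "P (- a) (- b) (- c) (- d)" if "a * d - b * c = 1" "P a b c d" for a b c d
    using S[OF that] S[of "- c" b "- d" a] that(1) by (simp add: algebra_simps)
  show ?thesis using assms(1)
  proof (induction "nat \<bar>c\<bar>" arbitrary: a b c d rule: less_induct)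
    case less
    show ?case
    proof (cases "c = 0")
      case True
      then have "a * d = 1" using less.prems by simp
      then consider "a = 1" "d = 1" | "a = -1" "d = -1" using zmult_eq_1_iff by auto
      then show ?thesis
      proof cases
        case 1
        then show ?thesis using Tn[OF _ one, of b] True by simp
      next
        case 2
        then show ?thesis using SS[OF _ Tn[OF _ one, of "- b"]] True by simp
      qed
    next
      case False
      define r where "r = a mod c"
      define b' where "b' = b - (a div c) * d"
      have a: "a = r + (a div c) * c" by (simp add: r_def)
      have b: "b = b' + (a div c) * d" by (simp add: b'_def)
      have det: "r * d - b' * c = 1"
        using less.prems by (subst (asm) a, subst (asm) b) (simp add: algebra_simps)
      have "nat \<bar>r\<bar> < nat \<bar>c\<bar>" using False abs_mod_less[of c a] by (simp add: r_def)
      moreover have "(- c) * b' - (- d) * r = 1" using det by (simp add: algebra_simps)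
      \<comment> \<open>This is S times the matrix (r, b'; c, d), with a smaller lower left entry;
        S^(-1) = S^3 then leads back.\<close>
      ultimately have "P (- c) (- d) r b'" by (rule less.hyps)
      from S[OF _ SS[OF _ this]] have "P r b' c d" using det by (simp add: algebra_simps)
      from Tn[OF det this, of "a div c"] show ?thesis using a b by simp
    qed
  qed
qed

lemma mob_S:
  fixes a b c d :: int
  assumes "a * d - b * c = 1" "Im t > 0"
  shows "mob (- c) (- d) a b t = - 1 / mob a b c d t" "mob a b c d t * aff c d t = aff a b t"
proof -
  have "aff (- c) (- d) t = - aff c d t" by simp
  then show "mob (- c) (- d) a b t = - 1 / mob a b c d t" by (simp only: divide_divide_eq_right) simp
  show "mob a b c d t * aff c d t = aff a b t" using aff_nonzero[OF assms] by (rule nonzero_eq_divide_eq[THEN iffD1, OF _ refl])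
qed

lemma mob_T:
  fixes a b c d :: int
  assumes "a * d - b * c = 1" "Im t > 0"
  shows "mob (a + c) (b + d) c d t = mob a b c d t + 1" "mob (a - c) (b - d) c d t = mob a b c d t - 1"
  using aff_nonzero[OF assms] by (simp_all add: field_simps)

text \<open>Up to a constant factor this is the classical Klein form with characteristic \<open>(x, y)\<close>.\<close>

definition klein :: "real \<Rightarrow> real \<Rightarrow> complex \<Rightarrow> complex" where
  "klein x y t = nome ((of_real x - 1) * (of_real x * t + of_real y) / 2) *
     theta (of_real x * t + of_real y) t / (euler_prod t)\<^sup>2"

lemma klein_eq:
  "of_real x * t + of_real y = u \<Longrightarrow> klein x y t = nome ((of_real x - 1) * u / 2) * theta u t / (euler_prod t)\<^sup>2"
  by (simp add: klein_def)

lemma nome_half: "nome (1 / 2) = - 1"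
  by (simp add: nome_def)

lemma nome_plus_1: "nome (t + 1) = nome t"
  by (simp add: nome_add)

lemma euler_prod_plus_1: "euler_prod (t + 1) = euler_prod t"
  by (simp add: euler_prod_def nome_plus_1)

lemma theta_modulus_plus_1: "theta u (t + 1) = theta u t"
  by (simp add: theta_def nome_plus_1 nome_diff)

lemma klein_T: "klein x y (t + 1) = klein x (x + y) t"
proof -
  have "of_real x * (t + 1) + of_real y = of_real x * t + of_real (x + y)" by (simp add: algebra_simps)
  then show ?thesis unfolding klein_def by (simp only: theta_modulus_plus_1 euler_prod_plus_1)
qed

lemma nome_minus_half: "nome (- z / 2) = inverse (exp (of_real pi * \<i> * z))"
  by (simp add: nome_def exp_minus[symmetric] mult.assoc)

text \<open>The exponential prefactor of \<open>klein\<close> is made to absorb the quadratic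
  exponent in \<open>theta_inversion\<close>, so that no multiplier remains.\<close>

lemma klein_S:
  assumes "Im t > 0"
  shows "klein x y (- 1 / t) = klein y (- x) t / t"
proof -
  define u where "u = of_real y * t - of_real x"
  have t0: "t \<noteq> 0" using assms by auto
  have t': "Im (- 1 / t) > 0" using assms by (simp add: Im_divide sum_power2_gt_zero_iff)
  have ut: "u / t = of_real x * (- 1 / t) + of_real y" using t0 by (simp add: u_def field_simps)
  have "theta (u / t) (- 1 / t) = (euler_prod (- 1 / t))\<^sup>2 * theta u t / (t * (euler_prod t)\<^sup>2)
      * nome (- (u - u / t - u\<^sup>2 / t) / 2)"
    using theta_inversion[OF assms, of u] t0 euler_prod_nonzero[OF assms]
    unfolding nome_minus_half by (simp add: divide_simps) (simp add: mult_ac)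
  then have "klein x y (- 1 / t) = nome ((of_real x - 1) * (u / t) / 2) * nome (- (u - u / t - u\<^sup>2 / t) / 2)
      * theta u t / (t * (euler_prod t)\<^sup>2)"
    using euler_prod_nonzero[OF t'] unfolding klein_def ut[symmetric] by (simp add: field_simps)
  also have "nome ((of_real x - 1) * (u / t) / 2) * nome (- (u - u / t - u\<^sup>2 / t) / 2) = nome ((of_real y - 1) * u / 2)"
  proof -
    have "(of_real x - 1) * (u / t) / 2 + - (u - u / t - u\<^sup>2 / t) / 2 = (of_real y - 1) * u / 2"
      using t0 by (simp add: u_def field_simps power2_eq_square)
    then show ?thesis by (simp only: nome_add[symmetric])
  qed
  finally show ?thesis by (simp add: klein_def u_def)
qed

text \<open>The characteristic is a row vector on which the matrix acts from the right. The
  induction is over all characteristics at once, since S and T move them.\<close>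

lemma klein_SL2:
  fixes a b c d :: int
  assumes "a * d - b * c = 1" "Im t > 0"
  shows "klein x y (mob a b c d t) =
    klein (x * of_int a + y * of_int c) (x * of_int b + y * of_int d) t / aff c d t"
  using assms(1)
proof (induction arbitrary: x y rule: SL2_induct)
  case (S a b c d)
  have "klein x y (mob (- c) (- d) a b t) = klein y (- x) (mob a b c d t) / mob a b c d t"
    unfolding mob_S(1)[OF S(1) assms(2)] by (rule klein_S[OF Im_mob_pos[OF S(1) assms(2)]])
  also have "\<dots> = klein (y * of_int a + - x * of_int c) (y * of_int b + - x * of_int d) t / (mob a b c d t * aff c d t)"
    unfolding S.IH by simp
  finally show ?case unfolding mob_S(2)[OF S(1) assms(2)] by (simp add: add.commute)
next
  case (T a b c d)
  have "x * of_int a + (x + y) * of_int c = x * of_int (a + c) + y * of_int c"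
    "x * of_int b + (x + y) * of_int d = x * of_int (b + d) + y * of_int d" by (simp_all add: algebra_simps)
  then show ?case using T.IH[of x "x + y"] by (simp only: mob_T[OF T(1) assms(2)] klein_T)
next
  case (T_inverse a b c d)
  have "x * of_int a + (y - x) * of_int c = x * of_int (a - c) + y * of_int c"
    "x * of_int b + (y - x) * of_int d = x * of_int (b - d) + y * of_int d" by (simp_all add: algebra_simps)
  then show ?case using T_inverse.IH[of x "y - x"] klein_T[of x "y - x" "mob a b c d t - 1"]
    unfolding mob_T[OF T_inverse(1) assms(2)] by simp
qed simp

lemma klein_minus:
  assumes "Im t > 0"
  shows "klein (- x) (- y) t = - klein x y t"
proof -
  define u where "u = of_real x * t + of_real y"
  have "theta (- u) t = - nome (- u) * theta u t"
    using theta_add_tau[OF assms, of u] by (simp add: theta_def mult_ac add.commute)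
  moreover have "nome ((of_real (- x) - 1) * (- u) / 2) * nome (- u) = nome ((of_real x - 1) * u / 2)"
    unfolding nome_add[symmetric] by (intro arg_cong[of _ _ nome]) (simp add: field_simps)
  moreover have "klein (- x) (- y) t = nome ((of_real (- x) - 1) * (- u) / 2) * theta (- u) t / (euler_prod t)\<^sup>2"
    by (rule klein_eq) (simp add: u_def)
  ultimately show ?thesis
    by (simp add: klein_eq[OF u_def[symmetric]] mult.assoc[symmetric])
qed

lemma klein_add_1_right: "klein x (y + 1) t = - nome (of_real x / 2) * klein x y t"
proof -
  define u where "u = of_real x * t + of_real y"
  have "nome ((of_real x - 1) * (u + 1) / 2) = - nome (of_real x / 2) * nome ((of_real x - 1) * u / 2)"
  proof -
    have "(of_real x - 1) * (u + 1) / 2 + 1 / 2 = of_real x / 2 + (of_real x - 1) * u / 2"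
      by (simp add: field_simps)
    then have "nome ((of_real x - 1) * (u + 1) / 2) * nome (1 / 2) = nome (of_real x / 2) * nome ((of_real x - 1) * u / 2)"
      by (simp only: nome_add[symmetric])
    then show ?thesis by (simp add: nome_half minus_equation_iff[of _ "_ * _"])
  qed
  moreover have "of_real x * t + of_real (y + 1) = u + 1" by (simp add: u_def)
  ultimately show ?thesis
    unfolding klein_def by (simp only: theta_add_1 flip: u_def) simp
qed

lemma klein_add_1_left:
  assumes "Im t > 0"
  shows "klein (x + 1) y t = - nome (- of_real y / 2) * klein x y t"
proof -
  define u where "u = of_real x * t + of_real y"
  have "nome (of_real x * (u + t) / 2) * nome (- u) = nome (- of_real y / 2) * nome ((of_real x - 1) * u / 2)"
    unfolding nome_add[symmetric] by (intro arg_cong[of _ _ nome]) (simp add: field_simps u_def)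
  moreover have "of_real (x + 1) * t + of_real y = u + t" by (simp add: u_def algebra_simps)
  ultimately show ?thesis
    using theta_add_tau[OF assms, of u]
    by (simp add: klein_eq[OF u_def[symmetric]] klein_eq[of "x + 1" t y "u + t"])
qed

subsection \<open>The discriminant and the eta ratio\<close>

definition Delta :: "complex \<Rightarrow> complex" where
  "Delta t = nome t * euler_prod t ^ 24"

lemma Delta_nonzero: "Im t > 0 \<Longrightarrow> Delta t \<noteq> 0"
  by (simp add: Delta_def euler_prod_nonzero)

text \<open>At the half periods theta is a square of an infinite product, once with a factor 2, and
  the three products multiply to 1 by Euler's identity: the product of (1 + q^n) (1 - q^(2n - 1)) is
  1. What remains are a constant, a power of q and a power of \<open>euler_prod t\<close>.\<close>

lemma half_klein_product:
  assumes t: "Im t > 0"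
  shows "(klein 0 (1/2) t * klein (1/2) 0 t * klein (1/2) (1/2) t) ^ 4 = - 16 / Delta t"
proof -
  define s where "s = nome (t / 2)"
  define w where "w = euler_prod t"
  have s2: "s\<^sup>2 = nome t" by (simp add: s_def nome_power)
  have ns: "norm s < 1" "norm (nome t) < 1" using t by (simp_all add: s_def)
  have neg: "nome (z + 1 / 2) = - nome z" "nome (z - 1/2) = - nome z" for z
    by (simp_all add: nome_add nome_diff nome_half)
  have "theta (1/2) t = qpoch (- 1) (nome t) * qpoch (- nome t) (nome t)"
    by (simp add: theta_def nome_half neg)
  also have "\<dots> = 2 * (qpoch (- nome t) (nome t))\<^sup>2"
    using qpoch_step[OF ns(2), of "- 1"] by (simp add: power2_eq_square)
  finally have th1: "theta (1/2) t = 2 * (qpoch (- nome t) (nome t))\<^sup>2" .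
  have th2: "theta (t/2) t = (qpoch s (nome t))\<^sup>2"
  proof -
    have "t - t / 2 = t / 2" by simp
    then show ?thesis by (simp add: theta_def s_def power2_eq_square)
  qed
  have th3: "theta (t/2 + 1/2) t = (qpoch (- s) (nome t))\<^sup>2"
  proof -
    have "t - (t / 2 + 1 / 2) = t / 2 - 1 / 2" by (simp add: field_simps)
    then show ?thesis by (simp add: theta_def neg s_def power2_eq_square)
  qed
  have one: "qpoch (- nome t) (nome t) * (qpoch s (nome t) * qpoch (- s) (nome t)) = 1"
  proof -
    have rot: "qpoch a q * qpoch (- a) q = qpoch (a\<^sup>2) (q\<^sup>2)" if "norm q < 1" for a q
      using qpoch_prod_rotate[OF that, of "{0, 1::nat}" 2 "\<lambda>i. if i = 0 then 1 else - 1" a]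
      by (simp add: power2_eq_square algebra_simps)
    have "w * (qpoch (- nome t) (nome t) * qpoch (nome t) ((nome t)\<^sup>2)) =
      qpoch ((nome t)\<^sup>2) ((nome t)\<^sup>2) * qpoch (nome t) ((nome t)\<^sup>2)"
      using rot[OF ns(2), of "nome t"] by (simp add: w_def euler_prod_def)
    also have "\<dots> = w"
      using qpoch_even_odd[OF ns(2), of "nome t"] by (simp add: w_def euler_prod_def mult.commute power2_eq_square)
    finally show ?thesis using euler_prod_nonzero[OF t] rot[OF ns(2), of s] by (simp add: s2 w_def)
  qed
  have "klein 0 (1/2) t * klein (1/2) 0 t * klein (1/2) (1/2) t =
     nome (- 1 / 4) * nome (- t / 8) * nome (- ((t / 2 + 1 / 2) / 4)) * (theta (1/2) t * theta (t/2) t * theta (t/2 + 1/2) t) / w ^ 6"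
    by (simp add: klein_def w_def flip: power_mult power_add)
  also have "theta (1/2) t * theta (t/2) t * theta (t/2 + 1/2) t = 2"
    using arg_cong[OF one, of "\<lambda>x. 2 * x\<^sup>2"] by (simp add: th1 th2 th3 power_mult_distrib mult_ac)
  also have "nome (- 1 / 4) * nome (- t / 8) * nome (- ((t / 2 + 1 / 2) / 4)) = nome (- t / 4 - 3 / 8)"
    unfolding nome_add[symmetric] by (intro arg_cong[of _ _ nome]) (simp add: field_simps)
  finally have *: "klein 0 (1/2) t * klein (1/2) 0 t * klein (1/2) (1/2) t = nome (- t / 4 - 3 / 8) * 2 / w ^ 6" .
  \<comment> \<open>Four times the exponent is - t - 3/2, written as - t + 1/2 - 2: the half gives
    the sign, the integer gives 1.\<close>
  have n4: "nome (- t / 4 - 3 / 8) ^ 4 = nome (- t + 1 / 2 - of_nat 2)"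
    unfolding nome_power by (intro arg_cong[of _ _ nome]) simp
  have "(nome (- t / 4 - 3 / 8) * 2 / w ^ 6) ^ 4 = nome (- t + 1 / 2 - of_nat 2) * 16 / w ^ 24"
    unfolding power_divide power_mult_distrib n4 by (simp flip: power_mult)
  also have "nome (- t + 1 / 2 - of_nat 2) = - inverse (nome t)"
    by (simp only: nome_diff neg nome_minus nome_of_nat) simp
  finally show ?thesis unfolding * by (simp add: Delta_def w_def field_simps)
qed

lemma nome_quarter_power_4: "nome (1 / 4) ^ 4 = 1"
  by (simp add: nome_power)

lemma Delta_plus_1: "Delta (t + 1) = Delta t"
  by (simp add: Delta_def euler_prod_plus_1 nome_plus_1)

text \<open>S permutes the three Klein forms at half periods up to fourth roots of unity, which the
  fourth power removes; three forms of weight -1 to the fourth power account for t^12.\<close>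

lemma Delta_S:
  assumes t: "Im t > 0"
  shows "Delta (- 1 / t) = t ^ 12 * Delta t"
proof -
  have t0: "t \<noteq> 0" using t by auto
  have t': "Im (- 1 / t) > 0" using t by (simp add: Im_divide sum_power2_gt_zero_iff)
  define K where "K t = (klein 0 (1/2) t * klein (1/2) 0 t * klein (1/2) (1/2) t) ^ 4" for t
  have "klein (1/2) (1/2) t = - nome (1/4) * klein (1/2) (- 1/2) t"
    using klein_add_1_right[of "1/2" "-1/2" t] by simp
  then have "(klein (1/2) (1/2) t) ^ 4 = (klein (1/2) (- 1/2) t) ^ 4"
    by (simp add: power_mult_distrib nome_quarter_power_4)
  moreover have "klein 0 (- 1/2) t = - klein 0 (1/2) t" using klein_minus[OF t, of 0 "1/2"] by simp
  ultimately have "K (- 1 / t) = K t / t ^ 12"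
    unfolding K_def by (simp only: klein_S[OF t] power_mult_distrib power_divide)
       (simp add: field_simps t0 flip: power_add)
  then have "- 16 / Delta (- 1 / t) = - 16 / Delta t / t ^ 12"
    by (simp only: K_def half_klein_product[OF t] half_klein_product[OF t'])
  then show ?thesis
    using Delta_nonzero[OF t] Delta_nonzero[OF t'] t0 by (simp add: field_simps)
qed

lemma Delta_SL2:
  fixes a b c d :: int
  assumes "a * d - b * c = 1" "Im t > 0"
  shows "Delta (mob a b c d t) = aff c d t ^ 12 * Delta t"
  using assms(1)
proof (induction rule: SL2_induct)
  case (S a b c d)
  have "Delta (mob (- c) (- d) a b t) = mob a b c d t ^ 12 * Delta (mob a b c d t)"
    unfolding mob_S(1)[OF S(1) assms(2)] by (rule Delta_S[OF Im_mob_pos[OF S(1) assms(2)]])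
  then show ?case unfolding S.IH mult.assoc[symmetric] power_mult_distrib[symmetric] mob_S(2)[OF S(1) assms(2)] .
next
  case (T a b c d)
  then show ?case by (simp only: mob_T[OF T(1) assms(2)] Delta_plus_1)
next
  case (T_inverse a b c d)
  then show ?case using Delta_plus_1[of "mob a b c d t - 1"] by (simp only: mob_T[OF T_inverse(1) assms(2)]) simp
qed simp

lemma prod_one_minus_roots_of_unity:
  assumes "n > 0"
  shows "(\<Prod>j<n. 1 - nome (of_nat j / of_nat n) * b) = 1 - b ^ n"
proof -
  define p where "p = (Polynomial.monom 1 n - 1 :: complex poly)"
  have p': "p = Polynomial.monom 1 n + (- 1)" by (simp add: p_def)
  have deg: "Polynomial.degree p = n"
    unfolding p' using assms by (subst degree_add_eq_left) (simp_all add: degree_monom_eq)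
  have lead: "lead_coeff p = 1" unfolding deg using assms by (simp add: p_def)
  have "rsquarefree p"
  proof (subst rsquarefree_roots, intro allI notI)
    fix a assume a: "poly p a = 0 \<and> poly (pderiv p) a = 0"
    then have "a ^ n = 1" "of_nat n * a ^ (n - 1) = 0"
      by (simp_all add: p_def poly_monom pderiv_diff pderiv_monom)
    then show False using assms by (auto simp: power_0_left split: if_splits)
  qed
  then have "(\<Prod>z|poly p z = 0. [:- z, 1:]) = p"
    using complex_poly_decompose_rsquarefree[of p] lead by simp
  moreover have "{z. poly p z = 0} = {z. z ^ n = 1}" by (auto simp: p_def poly_monom)
  ultimately have "(\<Prod>z\<in>{z. z ^ n = 1}. [:- z, 1:]) = p" by simp
  from arg_cong[OF this, of poly]
  have *: "(\<Prod>z\<in>{z. z ^ n = 1}. x - z) = x ^ n - 1" for x :: complex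
    by (simp add: fun_eq_iff poly_prod p_def poly_monom)
  have bij: "bij_betw (\<lambda>j. nome (of_nat j / of_nat n)) {..<n} {z. z ^ n = 1}"
  proof -
    have "cis (2 * pi * real j / real n) = nome (of_nat j / of_nat n)" for j
      by (simp add: nome_def cis_conv_exp mult_ac)
    then show ?thesis using Complex.bij_betw_roots_unity[OF assms] by simp
  qed
  have **: "(\<Prod>j<n. x - nome (of_nat j / of_nat n)) = x ^ n - 1" for x :: complex
    using prod.reindex_bij_betw[OF bij, of "\<lambda>z. x - z"] * by simp
  show ?thesis
  proof (cases "b = 0")
    case False
    have "(\<Prod>j<n. 1 - nome (of_nat j / of_nat n) * b) = (\<Prod>j<n. b * (inverse b - nome (of_nat j / of_nat n)))"
      using False by (intro prod.cong) (auto simp: algebra_simps)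
    also have "\<dots> = b ^ n * (inverse b ^ n - 1)"
      by (simp add: prod.distrib **)
    also have "\<dots> = 1 - b ^ n" using False by (simp add: algebra_simps flip: power_mult_distrib)
    finally show ?thesis .
  qed (use assms in \<open>simp add: power_0_left\<close>)
qed

text \<open>This is E: the factors q^(p/24) of eta(z)^p and of eta(p z) cancel, so no fractional
  power of q occurs.\<close>

definition eta_ratio :: "nat \<Rightarrow> complex \<Rightarrow> complex" where
  "eta_ratio p t = euler_prod t ^ p / euler_prod (of_nat p * t)"

lemma eta_ratio_nonzero:
  assumes "p > 0" "Im t > 0" shows "eta_ratio p t \<noteq> 0"
proof -
  have "Im (of_nat p * t) > 0" using assms by simp
  then show ?thesis using assms by (simp add: eta_ratio_def euler_prod_nonzero)
qed

lemma prod_pair_reflect: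
  fixes f :: "nat \<Rightarrow> 'a::comm_monoid_mult"
  shows "(\<Prod>j=1..m. f j * f (2 * m + 1 - j)) = (\<Prod>j=1..2*m. f j)"
proof -
  have "(\<Prod>j=1..m. f (2 * m + 1 - j)) = (\<Prod>j=m+1..2*m. f j)"
    by (rule prod.reindex_bij_witness[of _ "\<lambda>j. 2 * m + 1 - j" "\<lambda>j. 2 * m + 1 - j"]) auto
  moreover have "(\<Prod>j=1..2*m. f j) = (\<Prod>j=1..m. f j) * (\<Prod>j=m+1..2*m. f j)"
    by (subst prod.union_disjoint[symmetric]) (auto intro!: prod.cong)
  ultimately show ?thesis by (simp add: prod.distrib)
qed

text \<open>Theta at j/p contains the factors for the roots of unity with exponents j and - j, so j
  = 1, ..., m covers all nontrivial p-th roots of unity, and rotation turns the product into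
  \<open>euler_prod (p t) / euler_prod t\<close>. The leading factors 1 - z j form the constant,
  which is nonzero since p does not divide j.\<close>

lemma klein_product_eta_ratio:
  assumes p: "p = 2 * m + 1"
  obtains C where "C \<noteq> 0" "\<And>t. Im t > 0 \<Longrightarrow> (\<Prod>j=1..m. klein 0 (real j / real p) t) = C / eta_ratio p t"
proof
  define z where "z j = nome (of_nat j / of_nat p)" for j
  define C where "C = (\<Prod>j=1..m. nome (- of_nat j / (2 * of_nat p)) * (1 - z j))"
  have z1: "z j \<noteq> 1" if "j \<in> {1..2*m}" for j
  proof
    assume "z j = 1"
    then obtain k :: int where "of_nat j / of_nat p = (of_int k :: complex)" by (auto simp: z_def nome_eq_1_iff Ints_def)
    then have "of_nat j = (of_int (k * int p) :: complex)" using p by (simp add: divide_eq_eq del: of_nat_Suc of_nat_add of_nat_mult)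
    then have "(of_int (int j) :: complex) = of_int (k * int p)" by simp
    then have "int j = k * int p" by (simp only: of_int_eq_iff)
    then have "int p dvd int j" by simp
    then have "p dvd j" by simp
    then show False using that p by (auto dest: dvd_imp_le)
  qed
  show "C \<noteq> 0" using z1 by (auto simp: C_def)
  fix t assume t: "Im t > 0"
  have q: "norm (nome t) < 1" using t by simp
  have tp: "Im (of_nat p * t) > 0" using t p by simp
  have "klein 0 (real j / real p) t = nome (- of_nat j / (2 * of_nat p)) * (1 - z j) *
     (qpoch (z j * nome t) (nome t) * qpoch (z (2 * m + 1 - j) * nome t) (nome t)) / (euler_prod t)\<^sup>2"
    if "j \<in> {1..m}" for j
  proof -
    have "of_nat (2 * m + 1 - j) / of_nat p = (1 - of_nat j / of_nat p :: complex)"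
    proof -
      have "2 * m + 1 - j = p - j" "j \<le> p" "p \<noteq> 0" using that p by auto
      then show ?thesis by (simp add: of_nat_diff diff_divide_distrib)
    qed
    then have "z (2 * m + 1 - j) = nome (- (of_nat j / of_nat p))"
      by (simp add: z_def nome_diff nome_minus inverse_eq_divide)
    then have z': "nome (t - of_nat j / of_nat p) = z (2 * m + 1 - j) * nome t"
      by (simp add: nome_diff nome_minus divide_inverse mult.commute)
    have "klein 0 (real j / real p) t = nome (- of_nat j / (2 * of_nat p)) * theta (of_nat j / of_nat p) t / (euler_prod t)\<^sup>2"
      by (simp add: klein_def mult.commute)
    moreover have "theta (of_nat j / of_nat p) t = qpoch (z j) (nome t) * qpoch (z (2 * m + 1 - j) * nome t) (nome t)"
      unfolding theta_def z' z_def ..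
    ultimately show ?thesis
      unfolding qpoch_step[OF q, of "z j"] by (simp only: mult.assoc)
  qed
  then have "(\<Prod>j=1..m. klein 0 (real j / real p) t) =
      C * (\<Prod>j=1..m. qpoch (z j * nome t) (nome t) * qpoch (z (2 * m + 1 - j) * nome t) (nome t)) / (euler_prod t) ^ (2 * m)"
    by (simp add: C_def prod.distrib prod_dividef power_mult)
  also have "(\<Prod>j=1..m. qpoch (z j * nome t) (nome t) * qpoch (z (2 * m + 1 - j) * nome t) (nome t)) =
     (\<Prod>j=1..2*m. qpoch (z j * nome t) (nome t))" by (rule prod_pair_reflect)
  also have "\<dots> = euler_prod (of_nat p * t) / euler_prod t"
  proof -
    have "(\<Prod>j<p. qpoch (z j * nome t) (nome t)) = euler_prod (of_nat p * t)"
    proof -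
      have p0: "p > 0" using p by simp
      show ?thesis
        unfolding z_def euler_prod_def nome_power[symmetric]
        by (rule qpoch_prod_rotate[OF q _ p0 prod_one_minus_roots_of_unity[OF p0]]) simp
    qed
    moreover have "{..<p} = insert 0 {1..2*m}" using p by auto
    ultimately show ?thesis using euler_prod_nonzero[OF t]
      by (simp add: z_def euler_prod_def nonzero_eq_divide_eq mult.commute)
  qed
  finally show "(\<Prod>j=1..m. klein 0 (real j / real p) t) = C / eta_ratio p t"
    by (simp add: eta_ratio_def p)
qed

section \<open>The transformation of E under Gamma_0(p)\<close>

lemma quasi_periodic_int:
  fixes F :: "real \<Rightarrow> complex"
  assumes "\<And>x. F (x + 1) = nome s * F x"
  shows "F (x + of_int n) = nome (of_int n * s) * F x"
proof (induction n rule: int_induct[where k = 0])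
  case (step1 n)
  then show ?case using assms[of "x + of_int n"] by (simp add: add.assoc ring_distribs nome_add)
next
  case (step2 n)
  then show ?case using assms[of "x + of_int (n - 1)"]
    by (simp add: algebra_simps nome_diff nonzero_eq_divide_eq)
qed auto

lemma klein_add_int_left:
  assumes t: "Im t > 0"
  shows "klein (x + of_int n) y t = nome (of_int n * ((1 - of_real y) / 2)) * klein x y t"
proof (rule quasi_periodic_int[where F = "\<lambda>x. klein x y t"])
  fix x
  have "nome ((1 - of_real y) / 2) = nome (1 / 2 + - of_real y / 2)"
    by (intro arg_cong[of _ _ nome]) (simp add: field_simps)
  also have "\<dots> = - nome (- of_real y / 2)" unfolding nome_add nome_half by simp
  finally show "klein (x + 1) y t = nome ((1 - of_real y) / 2) * klein x y t"
    by (simp only: klein_add_1_left[OF t])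
qed

lemma klein_0_add_int: "klein 0 (y + of_int n) t = nome (of_int n * (1 / 2)) * klein 0 y t"
  by (rule quasi_periodic_int[where F = "\<lambda>y. klein 0 y t"]) (simp add: klein_add_1_right nome_half)

text \<open>Gauss's lemma by way of absolutely least residues. The bijection \<open>r\<close>, the
  signs \<open>s\<close> and the quotients \<open>n\<close> are kept because all of them enter the
  transformation of the Klein forms.\<close>

lemma gauss_lemma_signed_residues:
  fixes p m :: nat and d :: int
  assumes p: "prime p" "p = 2 * m + 1" "m > 0" and d: "\<not> int p dvd d"
  obtains r :: "nat \<Rightarrow> nat" and s n :: "nat \<Rightarrow> int"
  where "bij_betw r {1..m} {1..m}" "\<And>j. s j = 1 \<or> s j = - 1"
    "\<And>j. j \<in> {1..m} \<Longrightarrow> int j * d = s j * int (r j) + int p * n j"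
    "Legendre d (int p) = (\<Prod>j=1..m. s j)"
proof -
  define e where "e j = (int j * d) mod int p" for j :: nat
  define s where "s j = (if e j \<le> int m then 1 else - 1 :: int)" for j
  define r where "r j = nat (if e j \<le> int m then e j else int p - e j)" for j
  define n where "n j = (int j * d) div int p + (if e j \<le> int m then 0 else 1)" for j
  have pp: "prime (int p)" using p(1) by simp
  have ndvd: "\<not> int p dvd int j" if "j \<in> {1..m}" for j
  proof
    assume "int p dvd int j"
    then have "p dvd j" by (simp only: int_dvd_int_iff)
    then have "p \<le> j" using that by (intro dvd_imp_le) auto
    then show False using that p(2) by simp
  qed
  have e: "0 < e j \<and> e j < int p" if "j \<in> {1..m}" for j
  proof -
    have "\<not> int p dvd int j * d" using d pp ndvd[OF that] by (simp add: prime_dvd_mult_iff)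
    then have "e j \<noteq> 0" by (simp add: e_def dvd_eq_mod_eq_0)
    moreover have "0 \<le> e j" "e j < int p" using p by (simp_all add: e_def)
    ultimately show ?thesis by simp
  qed
  have r: "r j \<in> {1..m}" if "j \<in> {1..m}" for j
    using e[OF that] p(2) by (auto simp: r_def)
  have eq: "int j * d = s j * int (r j) + int p * n j" if "j \<in> {1..m}" for j
  proof -
    have "int j * d = int p * ((int j * d) div int p) + e j" by (simp add: e_def)
    then show ?thesis using e[OF that] by (auto simp: s_def r_def n_def algebra_simps)
  qed
  have inj: "inj_on r {1..m}"
  proof (rule inj_onI)
    fix i j assume ij: "i \<in> {1..m}" "j \<in> {1..m}" "r i = r j"
    have "int p dvd (int i - s i * s j * int j) * d"
    proof -
      have "s i = 1 \<or> s i = - 1" "s j = 1 \<or> s j = - 1" by (auto simp: s_def)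
      then have "(int i - s i * s j * int j) * d = int p * (n i - s i * s j * n j)"
        using eq[OF ij(1)] eq[OF ij(2)] ij(3) by (auto simp: algebra_simps)
      then show ?thesis by simp
    qed
    then have "int p dvd int i - s i * s j * int j" using d pp by (simp add: prime_dvd_mult_iff)
    moreover have "s i * s j = 1 \<or> s i * s j = - 1" by (simp add: s_def)
    \<comment> \<open>So i is j or - j modulo p, and the latter is impossible as 0 < i + j <
      p.\<close>
    ultimately consider "int p dvd int i - int j" | "int p dvd int i + int j" by auto
    then show "i = j"
    proof cases
      case 1
      have "\<bar>int i - int j\<bar> < int p" using ij p(2) by auto
      with 1 show ?thesis
        using dvd_imp_le_int[of "int i - int j" "int p"] by (cases "int i - int j = 0") auto
    next
      case 2
      then have "int p \<le> int i + int j" using ij by (intro zdvd_imp_le) auto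
      then show ?thesis using ij p(2) by auto
    qed
  qed
  have "r ` {1..m} = {1..m}" using r inj by (intro endo_inj_surj) auto
  with inj have bij: "bij_betw r {1..m} {1..m}" by (simp add: bij_betw_def)
  have "[(\<Prod>j=1..m. int j * d) = (\<Prod>j=1..m. s j * int (r j))] (mod int p)"
    by (intro cong_prod) (simp add: eq cong_def)
  also have "(\<Prod>j=1..m. s j * int (r j)) = (\<Prod>j=1..m. s j) * (\<Prod>j=1..m. int j)"
    using prod.reindex_bij_betw[OF bij, of int] by (simp add: prod.distrib)
  also have "(\<Prod>j=1..m. int j * d) = d ^ m * (\<Prod>j=1..m. int j)"
    by (simp add: prod.distrib)
  finally have "[d ^ m = (\<Prod>j=1..m. s j)] (mod int p)"
  proof (rule cong_mult_rcancel[THEN iffD1, rotated])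
    have "\<not> int p dvd (\<Prod>j=1..m. int j)" using pp ndvd by (subst prime_dvd_prod_iff) auto
    then show "coprime (\<Prod>j=1..m. int j) (int p)"
      using pp by (simp add: prime_imp_coprime coprime_commute)
  qed
  moreover have "[Legendre d (int p) = d ^ ((p - 1) div 2)] (mod int p)"
    using p by (intro euler_criterion) auto
  ultimately have "[Legendre d (int p) = (\<Prod>j=1..m. s j)] (mod int p)"
    using p(2) by (auto intro: cong_trans)
  then have dvd: "int p dvd Legendre d (int p) - (\<Prod>j=1..m. s j)" by (simp add: cong_iff_dvd_diff)
  \<comment> \<open>Both sides have modulus at most 1, so their difference is too small for a
    nonzero multiple of p and the congruence is an equality.\<close>
  have "\<bar>\<Prod>j=1..m. s j\<bar> = 1" unfolding abs_prod by (intro prod.neutral) (simp add: s_def)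
  moreover have "\<bar>Legendre d (int p)\<bar> \<le> 1" by (simp add: Legendre_def)
  ultimately have "\<bar>Legendre d (int p) - (\<Prod>j=1..m. s j)\<bar> \<le> 2" by linarith
  then have "\<bar>Legendre d (int p) - (\<Prod>j=1..m. s j)\<bar> < int p" using p by linarith
  with dvd have "Legendre d (int p) = (\<Prod>j=1..m. s j)"
    using dvd_imp_le_int[of "Legendre d (int p) - (\<Prod>j=1..m. s j)" "int p"] by force
  from that[OF bij _ eq this] show thesis by (simp add: s_def)
qed

text \<open>A matrix in Gamma_0(p) takes the characteristic (0, j/p) to (j c', j d/p), which integer
  shifts and a sign bring back to (0, r/p) with r = \<open>r j\<close>. The signs multiply to the
  Legendre symbol by Gauss's lemma; the roots of unity from the shifts multiply to 1.\<close>

lemma eta_ratio_Gamma0: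
  fixes a b c d :: int
  assumes p: "prime p" "p = 2 * m + 1" "p \<ge> 5" and det: "a * d - b * c = 1" and c: "int p dvd c" and t: "Im t > 0"
  shows "eta_ratio p (mob a b c d t) =
    of_int (Legendre d (int p)) * aff c d t ^ m * eta_ratio p t"
proof -
  let ?g = "mob a b c d t"
  obtain c' where c': "c = int p * c'" using c by blast
  have d: "\<not> int p dvd d"
  proof
    assume "int p dvd d"
    then have "int p dvd a * d - b * c" using c by simp
    then show False using det p by simp
  qed
  obtain r s n where bij: "bij_betw r {1..m} {1..m}" and s: "\<And>j. s j = 1 \<or> s j = - 1"
    and eq: "\<And>j. j \<in> {1..m} \<Longrightarrow> int j * d = s j * int (r j) + int p * n j"
    and leg: "Legendre d (int p) = (\<Prod>j=1..m. s j)"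
    using gauss_lemma_signed_residues[OF p(1,2) _ d] p(2,3) by auto
  obtain C where C: "C \<noteq> 0" "\<And>t. Im t > 0 \<Longrightarrow> (\<Prod>j=1..m. klein 0 (real j / real p) t) = C / eta_ratio p t"
    using klein_product_eta_ratio[OF p(2)] by blast
  \<comment> \<open>The root of unity caused by shifting the first entry by \<open>j c'\<close> and
    the second by \<open>n j\<close>.\<close>
  define k where "k j = nome ((of_int (int j * c' + n j) - of_nat j ^ 2 * of_int (c' * d) / of_nat p) / 2)" for j
  have factor: "klein 0 (real j / real p) ?g = k j * of_int (s j) * klein 0 (real (r j) / real p) t / aff c d t"
    if j: "j \<in> {1..m}" for j
  proof -
    have p0: "real p \<noteq> 0" using p by simp
    have "klein 0 (real j / real p) ?g = klein (0 + of_int (int j * c')) (real j * of_int d / real p) t / aff c d t"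
      using klein_SL2[OF det t, of 0 "real j / real p"] p0 by (simp add: c')
    also have "klein (0 + of_int (int j * c')) (real j * of_int d / real p) t =
      nome (of_int (int j * c') * ((1 - of_real (real j * of_int d / real p)) / 2)) * klein 0 (real j * of_int d / real p) t"
      by (rule klein_add_int_left[OF t])
    also have "real j * of_int d / real p = of_int (s j) * (real (r j) / real p) + of_int (n j)"
    proof -
      have "real j * of_int d = of_int (s j) * real (r j) + real p * of_int (n j)"
        using arg_cong[OF eq[OF j], of real_of_int] by simp
      then show ?thesis using p0 by (simp add: field_simps)
    qed
    also have "klein 0 (of_int (s j) * (real (r j) / real p) + of_int (n j)) t =
        nome (of_int (n j) * (1 / 2)) * (of_int (s j) * klein 0 (real (r j) / real p) t)"
      unfolding klein_0_add_int using s[of j] klein_minus[OF t, of 0 "real (r j) / real p"] by auto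
    \<comment> \<open>Restores j d/p in the first factor, where the earlier rewriting had replaced
      it as well.\<close>
    also have "of_int (s j) * (real (r j) / real p) + of_int (n j) = real j * of_int d / real p"
    proof -
      have "real j * of_int d = of_int (s j) * real (r j) + real p * of_int (n j)"
        using arg_cong[OF eq[OF j], of real_of_int] by simp
      then show ?thesis using p0 by (simp add: field_simps)
    qed
    also have "nome (of_int (int j * c') * ((1 - of_real (real j * of_int d / real p)) / 2)) *
       (nome (of_int (n j) * (1 / 2)) * (of_int (s j) * klein 0 (real (r j) / real p) t)) =
       nome (of_int (int j * c') * ((1 - of_real (real j * of_int d / real p)) / 2) + of_int (n j) * (1 / 2)) *
        of_int (s j) * klein 0 (real (r j) / real p) t"
      by (simp add: nome_add)
    also have "nome (of_int (int j * c') * ((1 - of_real (real j * of_int d / real p)) / 2) + of_int (n j) * (1 / 2)) = k j"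
      unfolding k_def using p0 by (intro arg_cong[of _ _ nome]) (simp add: field_simps power2_eq_square)
    finally show ?thesis .
  qed
  have "C / eta_ratio p ?g = (\<Prod>j=1..m. k j * of_int (s j) * klein 0 (real (r j) / real p) t / aff c d t)"
    using C(2)[OF Im_mob_pos[OF det t]] by (simp add: factor)
  also have "\<dots> = (\<Prod>j=1..m. k j) * of_int (Legendre d (int p)) * (\<Prod>j=1..m. klein 0 (real (r j) / real p) t) / aff c d t ^ m"
    by (simp add: prod.distrib prod_dividef leg)
  also have "(\<Prod>j=1..m. klein 0 (real (r j) / real p) t) = C / eta_ratio p t"
    using prod.reindex_bij_betw[OF bij, of "\<lambda>j. klein 0 (real j / real p) t"] C(2)[OF t] by simp
  also have "(\<Prod>j=1..m. k j) = 1"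
  proof -
    \<comment> \<open>Here p being prime to 3 enters: m is not 1 modulo 3. With 6 dividing m (m +
      1), the sums of j and j^2 are 3 N and p N, which removes the denominator p from the total
      exponent.\<close>
    have "3 dvd m * (m + 1)"
    proof -
      have "\<not> 3 dvd p" using p(1,3) unfolding prime_nat_iff by fastforce
      then have "3 dvd m \<or> 3 dvd m + 1" using p(2) by presburger
      then show ?thesis using dvd_mult dvd_mult2 by blast
    qed
    moreover have "2 dvd m * (m + 1)" by simp
    ultimately have "6 dvd m * (m + 1)" by presburger
    then obtain N where N: "m * (m + 1) = 6 * N" by blast
    have S1: "(\<Sum>j=1..m. j) = 3 * N"
    proof -
      have "2 * (\<Sum>j=1..m. j) = m * (m + 1)" by (induction m) auto
      with N show ?thesis by simp
    qed
    have S2: "(\<Sum>j=1..m. j\<^sup>2) = p * N"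
    proof -
      have "6 * (\<Sum>j=1..m. j\<^sup>2) = m * (m + 1) * (2 * m + 1)"
        by (induction m) (auto simp: power2_eq_square algebra_simps)
      then have "6 * (\<Sum>j=1..m. j\<^sup>2) = 6 * N * (2 * m + 1)" unfolding N .
      then show ?thesis unfolding p(2) by (simp add: algebra_simps)
    qed
    define K where "K = int (3 * N) * c' - int N * (c' * d) + (\<Sum>j=1..m. n j)"
    have "(\<Prod>j=1..m. k j) = nome (\<Sum>j=1..m. (of_int (int j * c' + n j) - of_nat j ^ 2 * of_int (c' * d) / of_nat p) / 2)"
      unfolding k_def by (simp add: nome_def exp_sum sum_distrib_left)
    also have "(\<Sum>j=1..m. (of_int (int j * c' + n j) - of_nat j ^ 2 * of_int (c' * d) / of_nat p) / 2) = of_int K / (2 :: complex)"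
    proof -
      have "(\<Sum>j=1..m. (of_int (int j * c' + n j) - of_nat j ^ 2 * of_int (c' * d) / of_nat p) / 2) =
        (of_nat (\<Sum>j=1..m. j) * of_int c' + of_int (\<Sum>j=1..m. n j) - of_nat (\<Sum>j=1..m. j\<^sup>2) * of_int (c' * d) / of_nat p) / (2 :: complex)"
        by (simp add: sum_divide_distrib[symmetric] sum.distrib sum_subtractf sum_distrib_right)
      also have "\<dots> = of_int K / 2" unfolding S1 S2 K_def using p(3) by simp
      finally show ?thesis .
    qed
    \<comment> \<open>Modulo 2 the sum of the n j is N (d - 1), so K is N (c' + 1) (d + 1); and c'
      and d are not both even since the determinant is 1.\<close>
    also have "even K"
    proof -
      have "d * (\<Sum>j=1..m. int j) = (\<Sum>j=1..m. s j * int (r j)) + int p * (\<Sum>j=1..m. n j)"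
        using sum.cong[OF refl eq, of "{1..m}"] by (simp add: sum.distrib sum_distrib_left mult.commute)
      moreover have "even ((\<Sum>j=1..m. s j * int (r j)) - (\<Sum>j=1..m. int (r j)))"
      proof -
        have "even (s j * int (r j) - int (r j))" for j using s[of j] by auto
        then have "even (\<Sum>j=1..m. s j * int (r j) - int (r j))" by (intro dvd_sum) auto
        then show ?thesis by (simp only: sum_subtractf)
      qed
      moreover have "(\<Sum>j=1..m. int (r j)) = (\<Sum>j=1..m. int j)"
        using sum.reindex_bij_betw[OF bij, of int] .
      moreover have "(\<Sum>j=1..m. int j) = 3 * int N" using arg_cong[OF S1, of int] by simp
      ultimately have "even (\<Sum>j=1..m. n j) \<longleftrightarrow> even (int N * (d - 1))"
      proof -
        assume *: "d * (\<Sum>j=1..m. int j) = (\<Sum>j=1..m. s j * int (r j)) + int p * (\<Sum>j=1..m. n j)"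
          "even ((\<Sum>j=1..m. s j * int (r j)) - (\<Sum>j=1..m. int (r j)))"
          "(\<Sum>j=1..m. int (r j)) = (\<Sum>j=1..m. int j)" "(\<Sum>j=1..m. int j) = 3 * int N"
        have "odd (int p)" using p(2) by simp
        moreover have "d * (3 * int N) - 3 * int N =
            ((\<Sum>j=1..m. s j * int (r j)) - (\<Sum>j=1..m. int (r j))) + int p * (\<Sum>j=1..m. n j)"
          using * by simp
        ultimately have "even (\<Sum>j=1..m. n j) \<longleftrightarrow> even (d * (3 * int N) - 3 * int N)"
          using *(2) by (simp only: even_add even_mult_iff) simp
        then show ?thesis by auto
      qed
      moreover have "odd c' \<or> odd d"
      proof (rule ccontr)
        assume "\<not> ?thesis"
        then have "even (a * d - b * c)" by (simp add: c')
        then show False using det by simp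
      qed
      ultimately show ?thesis unfolding K_def by auto
    qed
    then have "nome (of_int K / 2) = 1" by (auto simp: elim!: evenE)
    finally show ?thesis by simp
  qed
  finally have *: "C / eta_ratio p ?g = of_int (Legendre d (int p)) * (C / eta_ratio p t) / aff c d t ^ m"
    by simp
  have l2: "of_int (Legendre d (int p)) * of_int (Legendre d (int p)) = (1 :: complex)"
  proof -
    have "Legendre d (int p) = 1 \<or> Legendre d (int p) = - 1"
      using d by (auto simp: Legendre_def cong_0_iff)
    then show ?thesis by auto
  qed
  have nz: "eta_ratio p ?g \<noteq> 0" "eta_ratio p t \<noteq> 0" "aff c d t \<noteq> 0"
    using eta_ratio_nonzero p t Im_mob_pos[OF det t] aff_nonzero[OF det t] by auto
  have "C * (eta_ratio p t * aff c d t ^ m) = C * (of_int (Legendre d (int p)) * eta_ratio p ?g)"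
    using * nz by (simp add: divide_simps mult_ac)
  then have "eta_ratio p t * aff c d t ^ m = of_int (Legendre d (int p)) * eta_ratio p ?g"
    using C(1) by simp
  then have "of_int (Legendre d (int p)) * (eta_ratio p t * aff c d t ^ m) =
     (of_int (Legendre d (int p)) * of_int (Legendre d (int p))) * eta_ratio p ?g"
    by (simp only: mult.assoc)
  then show ?thesis unfolding l2 by (simp add: mult_ac)
qed

subsection \<open>Behaviour at infinity\<close>

text \<open>The cusp i infinity: its neighbourhoods contain half planes Im z > Y, so limits are
  uniform in Re z.\<close>

definition at_inf :: "complex filter" where
  "at_inf = filtercomap Im at_top"

lemma eventually_at_inf: "eventually P at_inf \<longleftrightarrow> (\<exists>Y. \<forall>z. Im z > Y \<longrightarrow> P z)"
  by (simp add: at_inf_def eventually_filtercomap_at_top_dense)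

lemma eventually_at_inf_gt: "eventually (\<lambda>z. Im z > Y) at_inf"
  by (auto simp: eventually_at_inf)

lemma at_inf_neq_bot [simp]: "at_inf \<noteq> bot"
proof -
  have "\<exists>z. Im z > Y" for Y by (rule exI[of _ "Complex 0 (Y + 1)"]) simp
  then show ?thesis by (auto simp: eventually_at_inf simp flip: eventually_False)
qed

lemma filterlim_Im_at_inf: "filterlim Im at_top at_inf"
  by (simp add: at_inf_def filterlim_filtercomap)

lemma nome_tendsto_0:
  assumes "r > 0"
  shows "((\<lambda>z. nome (of_real r * z)) \<longlongrightarrow> 0) at_inf"
proof (rule tendsto_norm_zero_cancel)
  have "((\<lambda>x. exp (- (2 * pi * r) * x)) \<longlongrightarrow> 0) at_top"
    using assms by (intro filterlim_compose[OF exp_at_bot] filterlim_tendsto_neg_mult_at_bot[OF tendsto_const])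
      (auto simp: filterlim_ident)
  from filterlim_compose[OF this filterlim_Im_at_inf]
  show "((\<lambda>z. norm (nome (of_real r * z))) \<longlongrightarrow> 0) at_inf" by (simp add: norm_nome mult_ac)
qed

text \<open>\<open>lead f m c\<close>: the expansion of \<open>f\<close> at \<open>i\<infinity>\<close> is \<open>c q\<^sup>m\<close> plus smaller terms; here \<open>c = 0\<close> is
  allowed, so that this then only bounds the order of vanishing from below.\<close>

definition lead :: "(complex \<Rightarrow> complex) \<Rightarrow> real \<Rightarrow> complex \<Rightarrow> bool" where
  "lead f m c \<longleftrightarrow> ((\<lambda>z. f z * nome (- of_real m * z)) \<longlongrightarrow> c) at_inf"

lemma lead_0_iff: "lead f 0 c \<longleftrightarrow> (f \<longlongrightarrow> c) at_inf"
  by (simp add: lead_def)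

lemma lead_const: "lead (\<lambda>_. c) 0 c"
  by (simp add: lead_0_iff)

lemma lead_mult: "lead f m c \<Longrightarrow> lead g n d \<Longrightarrow> lead (\<lambda>z. f z * g z) (m + n) (c * d)"
  unfolding lead_def by (drule (1) tendsto_mult) (simp add: ring_distribs nome_add mult_ac nome_diff nome_minus divide_inverse)

lemma lead_cmult: "lead f m c \<Longrightarrow> lead (\<lambda>z. a * f z) m (a * c)"
  using lead_mult[OF lead_const] by simp

lemma lead_power: "lead f m c \<Longrightarrow> lead (\<lambda>z. f z ^ n) (real n * m) (c ^ n)"
proof (induction n)
  case (Suc n)
  from lead_mult[OF Suc.prems Suc.IH[OF Suc.prems]] show ?case by (simp add: algebra_simps)
qed (simp add: lead_const)

lemma lead_inverse:
  assumes "lead f m c" "c \<noteq> 0"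
  shows "lead (\<lambda>z. inverse (f z)) (- m) (inverse c)"
  using tendsto_inverse[OF assms(1)[unfolded lead_def] assms(2)]
  by (simp add: lead_def nome_minus)

lemma lead_power_int:
  assumes "lead f m c" "c \<noteq> 0"
  shows "lead (\<lambda>z. f z powi n) (of_int n * m) (c powi n)"
proof (cases "n \<ge> 0")
  case True
  then show ?thesis using lead_power[OF assms(1), of "nat n"] by (simp add: power_int_def)
next
  case False
  then show ?thesis
    using lead_power[OF lead_inverse[OF assms], of "nat (- n)"] by (simp add: power_int_def)
qed

lemma lead_divide:
  assumes "lead f m c" "lead g n d" "d \<noteq> 0"
  shows "lead (\<lambda>z. f z / g z) (m - n) (c / d)"
  using lead_mult[OF assms(1) lead_inverse[OF assms(2,3)]] by (simp add: divide_inverse)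

lemma lead_prod:
  assumes "finite I" "\<And>i. i \<in> I \<Longrightarrow> lead (f i) (m i) (c i)"
  shows "lead (\<lambda>z. \<Prod>i\<in>I. f i z) (\<Sum>i\<in>I. m i) (\<Prod>i\<in>I. c i)"
  using assms by (induction I rule: finite_induct) (auto intro!: lead_mult lead_const)

lemma lead_nome: "lead (\<lambda>z. nome (of_real r * z)) r 1"
proof -
  have "nome (of_real r * z) * nome (- of_real r * z) = 1" for z
    by (simp add: nome_minus)
  then show ?thesis by (simp add: lead_def)
qed

lemma lead_cong:
  assumes "\<And>z. Im z > 0 \<Longrightarrow> f z = g z"
  shows "lead f m c \<longleftrightarrow> lead g m c"
  unfolding lead_def using eventually_at_inf_gt[of 0]
  by (intro tendsto_cong) (auto elim!: eventually_mono simp: assms)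

lemma lead_shift:
  assumes "lead f m c"
  shows "lead (\<lambda>z. f (z + of_real x)) m (c * nome (of_real (m * x)))"
proof -
  have "filterlim (\<lambda>z. z + of_real x) at_inf at_inf"
    unfolding at_inf_def filterlim_filtercomap_iff by (simp add: o_def filterlim_filtercomap)
  from filterlim_compose[OF assms[unfolded lead_def] this]
  have "((\<lambda>z. f (z + of_real x) * nome (- of_real m * (z + of_real x))) \<longlongrightarrow> c) at_inf" .
  from tendsto_mult[OF this tendsto_const[of "nome (of_real (m * x))"]]
  show ?thesis unfolding lead_def
  proof (rule tendsto_cong[THEN iffD1, rotated], intro always_eventually allI)
    fix z
    have "nome (- of_real m * (z + of_real x)) * nome (of_real (m * x)) = nome (- of_real m * z)"
      unfolding nome_add[symmetric] by (intro arg_cong[of _ _ nome]) (simp add: algebra_simps)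
    then show "f (z + of_real x) * nome (- of_real m * (z + of_real x)) * nome (of_real (m * x)) =
        f (z + of_real x) * nome (- of_real m * z)" by (simp add: mult.assoc)
  qed
qed

lemma lead_decrease:
  assumes "lead f m c" "n < m" shows "lead f n 0"
proof -
  have "((\<lambda>z. f z * nome (- of_real m * z) * nome (of_real (m - n) * z)) \<longlongrightarrow> c * 0) at_inf"
    using assms nome_tendsto_0[of "m - n"] unfolding lead_def by (intro tendsto_mult) auto
  moreover have "f z * nome (- of_real m * z) * nome (of_real (m - n) * z) = f z * nome (- of_real n * z)" for z
    unfolding mult.assoc nome_add[symmetric] by (simp add: algebra_simps)
  ultimately show ?thesis by (simp only: lead_def mult_zero_right)
qed

lemma lead_unique: "lead f m c \<Longrightarrow> lead f m d \<Longrightarrow> c = d"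
  unfolding lead_def by (rule tendsto_unique[OF at_inf_neq_bot])

lemma lead_le:
  assumes "lead f m c" "c \<noteq> 0" "lead f n d" shows "n \<le> m"
  using lead_decrease[OF assms(3), of m] lead_unique[OF assms(1)] assms(2) by force

lemma lead_tendsto_0: "lead f m c \<Longrightarrow> m > 0 \<Longrightarrow> (f \<longlongrightarrow> 0) at_inf"
  using lead_decrease[of f m c 0] by (simp add: lead_0_iff)

lemma lead_tendsto:
  assumes "lead f m c" "m \<ge> 0"
  obtains l where "(f \<longlongrightarrow> l) at_inf" "m > 0 \<Longrightarrow> l = 0"
proof (cases "m > 0")
  case True
  then show ?thesis using that[of 0] lead_tendsto_0[OF assms(1)] by simp
next
  case False
  then have "m = 0" using assms(2) by simp
  then show ?thesis using that[of c] assms(1) by (simp add: lead_0_iff)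
qed

text \<open>Among the terms with nonzero coefficient, the one of smallest order would dominate at
  infinity.\<close>

lemma lead_sum_zero:
  fixes f :: "'i \<Rightarrow> complex \<Rightarrow> complex"
  assumes "finite I" "inj_on m I" "\<And>i. i \<in> I \<Longrightarrow> lead (f i) (m i) (c i)" "\<And>i. i \<in> I \<Longrightarrow> c i \<noteq> 0"
    and "\<And>z. (\<Sum>i\<in>I. a i * f i z) = 0"
  shows "\<forall>i\<in>I. a i = 0"
proof (rule ccontr)
  assume *: "\<not> (\<forall>i\<in>I. a i = 0)"
  define J where "J = {i \<in> I. a i \<noteq> 0}"
  have J: "finite J" "J \<noteq> {}" using assms(1) * by (auto simp: J_def)
  then obtain i where i: "i \<in> J" "\<And>j. j \<in> J \<Longrightarrow> m i \<le> m j"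
    using arg_min_if_finite[of J m] by (metis not_le)
  have "lead (\<lambda>z. a j * f j z) (m i) (if j = i then a i * c i else 0)" if "j \<in> J" for j
  proof (cases "j = i")
    case True
    then show ?thesis using i assms(3) by (auto simp: J_def intro!: lead_cmult)
  next
    case False
    have "m i \<noteq> m j" using False i(1) that assms(2) by (auto simp: J_def inj_on_def)
    then have "m i < m j" using i(2)[OF that] by simp
    then show ?thesis using lead_decrease[OF lead_cmult[OF assms(3)]] that False by (simp add: J_def)
  qed
  then have "((\<lambda>z. \<Sum>j\<in>J. a j * f j z * nome (- of_real (m i) * z)) \<longlongrightarrow> (\<Sum>j\<in>J. if j = i then a i * c i else 0)) at_inf"
    unfolding lead_def by (intro tendsto_sum)
  moreover have "(\<Sum>j\<in>J. a j * f j z) = 0" for z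
    using assms(5)[of z] assms(1) by (subst (asm) sum.mono_neutral_right[of I J]) (auto simp: J_def)
  then have "(\<Sum>j\<in>J. a j * f j z * nome (- of_real (m i) * z)) = 0" for z
    by (simp flip: sum_distrib_right)
  ultimately have "((\<lambda>z. 0) \<longlongrightarrow> a i * c i) at_inf"
    using J(1) i(1) by simp
  then have "a i * c i = 0" by (simp add: tendsto_const_iff)
  then show False using i(1) assms(4) by (auto simp: J_def)
qed

text \<open>Cauchy's estimate on unit discs, which lie in the region where \<open>g\<close> is close
  to \<open>c\<close> once Im z is large.\<close>

lemma deriv_tendsto_0:
  assumes g: "g holomorphic_on upper_half_plane" and lim: "(g \<longlongrightarrow> c) at_inf"
  shows "(deriv g \<longlongrightarrow> 0) at_inf"
proof (rule tendstoI)
  fix e :: real assume "e > 0"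
  then have "eventually (\<lambda>z. dist (g z) c < e / 2) at_inf" using lim by (intro tendstoD) auto
  then obtain Y where Y: "\<And>z. Im z > Y \<Longrightarrow> dist (g z) c < e / 2" by (auto simp: eventually_at_inf)
  have "dist (deriv g z) 0 < e" if "Im z > Y + 1" "Im z > 1" for z
  proof -
    have Im: "Im x > Y \<and> Im x > 0" if "x \<in> cball z 1" for x
    proof -
      have "\<bar>Im z - Im x\<bar> \<le> norm (z - x)" by (metis abs_Im_le_cmod minus_complex.simps(2))
      then have "\<bar>Im z - Im x\<bar> \<le> 1" using that by (simp add: dist_norm)
      then show ?thesis using \<open>Im z > Y + 1\<close> \<open>Im z > 1\<close> by (auto simp: abs_le_iff)
    qed
    have sub: "cball z 1 \<subseteq> upper_half_plane" using Im by force
    have h: "(\<lambda>x. g x - c) holomorphic_on cball z 1"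
      using holomorphic_on_subset[OF g sub] by (intro holomorphic_intros)
    have "norm ((deriv ^^ 1) (\<lambda>x. g x - c) z) \<le> fact 1 * (e / 2) / 1 ^ 1"
    proof (rule Cauchy_inequality)
      show "(\<lambda>x. g x - c) holomorphic_on ball z 1" using h by (rule holomorphic_on_subset) auto
      show "continuous_on (cball z 1) (\<lambda>x. g x - c)" using h by (rule holomorphic_on_imp_continuous_on)
      show "norm (g x - c) \<le> e / 2" if "norm (z - x) = 1" for x
        using Y[of x] Im[of x] that by (simp add: dist_norm)
    qed auto
    moreover have "deriv (\<lambda>x. g x - c) z = deriv g z"
    proof -
      have "open upper_half_plane" by (intro open_Collect_less continuous_intros)
      moreover have "z \<in> upper_half_plane" using that by simp
      ultimately have "g field_differentiable at z" using g holomorphic_on_imp_differentiable_at by blast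
      then show ?thesis by (simp add: deriv_diff)
    qed
    ultimately show ?thesis using \<open>e > 0\<close> by simp
  qed
  then show "eventually (\<lambda>z. dist (deriv g z) 0 < e) at_inf"
    unfolding eventually_at_inf by (intro exI[of _ "max (Y + 1) 1"]) simp
qed

section \<open>Fourier expansions and limits at infinity\<close>

lemma open_upper_half_plane [simp]: "open upper_half_plane"
  by (intro open_Collect_less continuous_intros)

lemma connected_upper_half_plane: "connected upper_half_plane"
  by (simp add: convex_connected convex_halfspace_Im_gt)

lemma q_expansion_nome: "q_expansion w a g \<longleftrightarrow> (\<forall>z\<in>upper_half_plane. (\<lambda>n. a n * nome (z / of_nat w) ^ n) sums g z)"
  by (simp add: q_expansion_def nome_def)

text \<open>Every nonzero X in the unit disc is \<open>nome (z / w)\<close> for some z in the upper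
  half plane, so the coefficients define a power series converging on the whole disc, and its sum is
  continuous at 0.\<close>

lemma q_expansion_tendsto:
  assumes w: "w > 0" and q: "q_expansion w a g"
  shows "(g \<longlongrightarrow> a 0) at_inf"
proof -
  define h where "h X = (\<Sum>n. a n * X ^ n)" for X
  have gh: "g z = h (nome (z / of_nat w))" if "Im z > 0" for z
    using q that by (auto simp: q_expansion_nome h_def sums_iff)
  have sums: "(\<lambda>n. a n * (X - 0) ^ n) sums h X" if "X \<in> ball 0 1" for X
  proof (cases "X = 0")
    case True
    then show ?thesis by (simp add: h_def powser_sums_zero summable_sums powser_zero)
  next
    case False
    define z where "z = of_nat w * Ln X / (2 * of_real pi * \<i>)"
    have "nome (z / of_nat w) = X" using False w by (simp add: z_def nome_def)
    moreover have "Im z > 0"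
    proof -
      have "real w * ln (norm X) < 0" using that False w by (intro mult_pos_neg) auto
      moreover have "Im z = - (real w * ln (norm X) / (2 * pi))"
        using False by (simp add: z_def Im_divide power2_eq_square)
      ultimately show ?thesis by (simp add: divide_neg_pos)
    qed
    ultimately show ?thesis using q gh[of z] by (force simp: q_expansion_nome)
  qed
  have "h holomorphic_on ball 0 1" using power_series_holomorphic[OF sums] .
  then have "isCont h 0" by (intro continuous_on_interior[OF holomorphic_on_imp_continuous_on]) auto
  moreover have "((\<lambda>z. nome (z / of_nat w)) \<longlongrightarrow> 0) at_inf"
    using nome_tendsto_0[of "1 / real w"] w by (simp add: divide_inverse mult.commute)
  ultimately have "((\<lambda>z. h (nome (z / of_nat w))) \<longlongrightarrow> h 0) at_inf"
    by (rule isCont_tendsto_compose)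
  moreover have "h 0 = a 0" by (simp add: h_def powser_zero)
  moreover have "eventually (\<lambda>z. h (nome (z / of_nat w)) = g z) at_inf"
    using eventually_at_inf_gt[of 0] by eventually_elim (simp add: gh)
  ultimately show ?thesis using tendsto_cong by force
qed

text \<open>Periodicity makes g a function of X = \<open>nome (z / w)\<close>, whichever logarithm
  is chosen; the limit at i infinity removes the singularity at X = 0, and the Taylor series there
  is the expansion.\<close>

lemma q_expansion_exists:
  assumes w: "w > 0" and g: "g holomorphic_on upper_half_plane" and per: "\<And>z. g (z + of_nat w) = g z"
    and lim: "(g \<longlongrightarrow> c) at_inf"
  obtains a where "q_expansion w a g" "a 0 = c"
proof -
  define v where "v = of_nat w / (2 * of_real pi * \<i>)"
  define G where "G X = g (v * Ln X)" for X
  have Im_v: "Im (v * Ln X) = - (real w * ln (norm X) / (2 * pi))" if "X \<noteq> 0" for X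
    using that by (simp add: v_def Im_divide power2_eq_square)
  have Gg: "g (v * L) = G X" if "exp L = X" for L X
  proof -
    have "X \<noteq> 0" using that by auto
    then have "exp L = exp (Ln X)" using that by simp
    then obtain n :: int where "L = Ln X + of_int (2 * n) * of_real pi * \<i>" by (auto simp: exp_eq)
    then have "v * L = v * Ln X + of_int n * of_nat w"
      by (simp add: v_def field_simps)
    then show ?thesis using shift_int_multiple[of g "of_nat w" "v * Ln X" n, OF per] by (simp add: G_def)
  qed
  have gG: "g z = G (nome (z / of_nat w))" for z
  proof -
    have "v * (2 * of_real pi * \<i> * (z / of_nat w)) = z" using w by (simp add: v_def)
    then show ?thesis using Gg[of "2 * of_real pi * \<i> * (z / of_nat w)", OF refl] by (simp add: nome_def)
  qed
  have hol: "G holomorphic_on ball 0 1 - {0}"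
  proof -
    have "G field_differentiable at X0" if X0: "X0 \<in> ball 0 1 - {0}" for X0
    proof -
      have X0': "X0 \<noteq> 0" "norm X0 < 1" using X0 by auto
      \<comment> \<open>A branch of the logarithm that is holomorphic near \<open>X0\<close> even if
        \<open>X0\<close> lies on the cut of \<open>Ln\<close>.\<close>
      have 1: "((\<lambda>X. v * (Ln (X / X0) + Ln X0)) has_field_derivative v * (1 / X0)) (at X0)"
        using X0' by (auto intro!: derivative_eq_intros)
      have "real w * ln (norm X0) < 0" using X0' w by (intro mult_pos_neg) auto
      then have "Im (v * Ln X0) > 0"
        unfolding Im_v[OF X0'(1)] by (simp add: divide_neg_pos)
      then have "g field_differentiable at (v * Ln X0)"
        using g holomorphic_on_imp_differentiable_at[OF g] by simp
      then obtain g' where "(g has_field_derivative g') (at (v * Ln X0))"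
        by (auto simp: field_differentiable_def)
      then have "(g has_field_derivative g') (at (v * (Ln (X0 / X0) + Ln X0)))" using X0' by simp
      from DERIV_chain2[OF this 1]
      have "((\<lambda>X. g (v * (Ln (X / X0) + Ln X0))) has_field_derivative g' * (v * (1 / X0))) (at X0)" .
      moreover have "eventually (\<lambda>X. g (v * (Ln (X / X0) + Ln X0)) = G X) (nhds X0)"
      proof -
        have "eventually (\<lambda>X. X \<in> - {0}) (nhds X0)" using X0' by (intro eventually_nhds_in_open) auto
        then show ?thesis
          by eventually_elim (rule Gg, use X0' in \<open>simp add: exp_add\<close>)
      qed
      ultimately have "(G has_field_derivative g' * (v * (1 / X0))) (at X0)"
        by (subst (asm) DERIV_cong_ev[OF refl _ refl]) auto
      then show ?thesis by (auto simp: field_differentiable_def)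
    qed
    then show ?thesis by (auto simp: holomorphic_on_def intro: field_differentiable_at_within)
  qed
  have "filterlim (\<lambda>X. v * Ln X) at_inf (at 0)"
  proof -
    have "filterlim (\<lambda>X :: complex. norm X) (at_right 0) (at 0)"
      unfolding filterlim_at by (auto intro!: tendsto_norm_zero tendsto_ident_at simp: eventually_at_filter)
    then have 1: "filterlim (\<lambda>X :: complex. ln (norm X)) at_bot (at 0)"
      by (rule filterlim_compose[OF ln_at_0])
    then have "filterlim (\<lambda>X :: complex. - ln (norm X)) at_top (at 0)"
      by (simp add: filterlim_uminus_at_bot)
    then have fl: "filterlim (\<lambda>X :: complex. (real w / (2 * pi)) * - ln (norm X)) at_top (at 0)"
      using w by (intro filterlim_tendsto_pos_mult_at_top[OF tendsto_const]) auto
    have ev: "eventually (\<lambda>X. (real w / (2 * pi)) * - ln (norm X) = Im (v * Ln X)) (at 0)"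
      unfolding eventually_at_filter by (intro always_eventually allI impI) (subst Im_v, simp_all)
    from fl have "filterlim (\<lambda>X. Im (v * Ln X)) at_top (at 0)"
      by (rule filterlim_cong[OF refl refl ev, THEN iffD1])
    then show ?thesis by (simp add: at_inf_def filterlim_filtercomap_iff o_def)
  qed
  from filterlim_compose[OF lim this] have limG: "G \<midarrow>0\<rightarrow> c" by (simp add: G_def[abs_def])
  define H where "H X = (if X = 0 then c else G X)" for X
  have "H holomorphic_on ball 0 1"
    unfolding H_def by (rule removable_singularity[OF hol _ limG]) auto
  from holomorphic_power_series[OF this]
  have H: "(\<lambda>n. (deriv ^^ n) H 0 / fact n * X ^ n) sums H X" if "norm X < 1" for X
    using that by simp
  have "q_expansion w (\<lambda>n. (deriv ^^ n) H 0 / fact n) g"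
    unfolding q_expansion_nome
  proof
    fix z assume "z \<in> upper_half_plane"
    then have "norm (nome (z / of_nat w)) < 1" using w by (simp add: Im_divide_of_nat)
    from H[OF this] show "(\<lambda>n. (deriv ^^ n) H 0 / fact n * nome (z / of_nat w) ^ n) sums g z"
      by (simp add: H_def gG)
  qed
  moreover have "(deriv ^^ 0) H 0 / fact 0 = c" by (simp add: H_def)
  ultimately show thesis using that by blast
qed

text \<open>Orders of 1-periodic functions are integers: once the coefficient of q^n vanishes, the
  next possible order is n + 1.\<close>

lemma lead_step:
  assumes f: "f holomorphic_on upper_half_plane" and per: "\<And>z. f (z + 1) = f z" and "lead f (real n) 0"
  obtains c where "lead f (real (Suc n)) c"
proof -
  define g where "g z = f z * nome (- of_nat n * z)" for z
  have "g (z + of_nat 1) = g z" for z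
  proof -
    have "nome (- of_nat n * (z + 1)) = nome (- of_nat n * z) * nome (of_int (- int n))"
      unfolding nome_add[symmetric] by (intro arg_cong[of _ _ nome]) (simp add: algebra_simps)
    then show ?thesis unfolding nome_of_int by (simp add: g_def per)
  qed
  moreover have "g holomorphic_on upper_half_plane"
    unfolding g_def by (intro holomorphic_intros f)
  moreover have "(g \<longlongrightarrow> 0) at_inf" using assms(3) by (simp add: lead_def g_def[abs_def])
  ultimately obtain a where a: "q_expansion 1 a g" "a 0 = 0"
    using q_expansion_exists[of 1 g 0] by auto
  have "q_expansion 1 (\<lambda>n. a (Suc n)) (\<lambda>z. g z * nome (- z))"
    unfolding q_expansion_nome
  proof
    fix z assume "z \<in> upper_half_plane"
    with a(1) have "(\<lambda>n. a n * nome z ^ n) sums g z" by (simp add: q_expansion_nome)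
    then have "(\<lambda>n. a (Suc n) * nome z ^ Suc n) sums g z" using a(2) sums_Suc_iff[of "\<lambda>n. a n * nome z ^ n" "g z"] by simp
    from sums_mult[OF this, of "nome (- z)"]
    have "(\<lambda>n. nome (- z) * (a (Suc n) * nome z ^ Suc n)) sums (nome (- z) * g z)" .
    then show "(\<lambda>n. a (Suc n) * nome (z / of_nat 1) ^ n) sums (g z * nome (- z))"
    proof -
      have "nome (- z) * (a (Suc n) * nome z ^ Suc n) = a (Suc n) * nome z ^ n" for n
        by (simp add: nome_minus field_simps)
      then show ?thesis
        using \<open>(\<lambda>n. nome (- z) * (a (Suc n) * nome z ^ Suc n)) sums (nome (- z) * g z)\<close>
        by (simp only: mult.commute[of "g z"] of_nat_1 div_by_1)
    qed
  qed
  from q_expansion_tendsto[OF _ this] have "((\<lambda>z. g z * nome (- z)) \<longlongrightarrow> a 1) at_inf" by simp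
  moreover have "g z * nome (- z) = f z * nome (- of_real (real (Suc n)) * z)" for z
    unfolding g_def mult.assoc nome_add[symmetric] by (simp add: algebra_simps)
  ultimately show thesis using that by (simp add: lead_def)
qed

subsection \<open>Forms on congruence subgroups\<close>

definition mat2 :: "int \<Rightarrow> int \<Rightarrow> int \<Rightarrow> int \<Rightarrow> int^2^2" where
  "mat2 a b c d = vector [vector [a, b], vector [c, d]]"

abbreviation matS :: "int^2^2" where
  "matS \<equiv> mat2 0 (- 1) 1 0"

lemma mat2_nth [simp]: "mat2 a b c d $ 1 $ 1 = a" "mat2 a b c d $ 1 $ 2 = b"
  "mat2 a b c d $ 2 $ 1 = c" "mat2 a b c d $ 2 $ 2 = d"
  by (simp_all add: mat2_def)

lemma mat2_eqI: "A $ 1 $ 1 = a \<Longrightarrow> A $ 1 $ 2 = b \<Longrightarrow> A $ 2 $ 1 = c \<Longrightarrow> A $ 2 $ 2 = d \<Longrightarrow> A = mat2 a b c d"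
  by (simp add: vec_eq_iff forall_2)

lemma mat2_mult: "mat2 a b c d ** mat2 a' b' c' d' = mat2 (a * a' + b * c') (a * b' + b * d') (c * a' + d * c') (c * b' + d * d')"
  by (intro mat2_eqI) (simp_all add: matrix_matrix_mult_def sum_2)

lemma SL2Z_iff: "A \<in> SL2Z \<longleftrightarrow> A $ 1 $ 1 * A $ 2 $ 2 - A $ 1 $ 2 * A $ 2 $ 1 = 1"
  by (simp add: SL2Z_def det_2)

lemma SL2Z_E:
  assumes "A \<in> SL2Z"
  obtains a b c d where "A = mat2 a b c d" "a * d - b * c = 1"
  using assms that[OF mat2_eqI[OF refl refl refl refl]] by (simp add: SL2Z_iff)

lemma slash_mat2:
  "Im z > 0 \<Longrightarrow> slash k (mat2 a b c d) f z = aff c d z powi (- k) * f (mob a b c d z)"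
  by (simp add: slash_def)

lemma slash_off: "Im z \<le> 0 \<Longrightarrow> slash k A f z = 0"
  by (simp add: slash_def)

lemma slash_slash:
  assumes "A \<in> SL2Z" "B \<in> SL2Z"
  shows "slash k B (slash k A f) = slash k (A ** B) f"
proof
  fix z
  obtain a b c d where A: "A = mat2 a b c d" "a * d - b * c = 1" using SL2Z_E[OF assms(1)] .
  obtain a' b' c' d' where B: "B = mat2 a' b' c' d'" "a' * d' - b' * c' = 1" using SL2Z_E[OF assms(2)] .
  show "slash k B (slash k A f) z = slash k (A ** B) f z"
  proof (cases "Im z > 0")
    case True
    define j where "j = of_int c' * z + of_int d'"
    define w where "w = (of_int a' * z + of_int b') / j"
    have j: "j \<noteq> 0" and w: "Im w > 0"
      unfolding j_def w_def using aff_nonzero[OF B(2) True] Im_mob_pos[OF B(2) True] by auto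
    have wj: "of_int a' * z + of_int b' = w * j" using j by (simp add: w_def)
    have 1: "j * aff c d w = aff (c * a' + d * c') (c * b' + d * d') z"
    proof -
      have "aff (c * a' + d * c') (c * b' + d * d') z = of_int c * (of_int a' * z + of_int b') + of_int d * j"
        by (simp add: j_def algebra_simps)
      then show ?thesis unfolding wj by (simp add: algebra_simps)
    qed
    have 2: "j * aff a b w = aff (a * a' + b * c') (a * b' + b * d') z"
    proof -
      have "aff (a * a' + b * c') (a * b' + b * d') z = of_int a * (of_int a' * z + of_int b') + of_int b * j"
        by (simp add: j_def algebra_simps)
      then show ?thesis unfolding wj by (simp add: algebra_simps)
    qed
    have "slash k B (slash k A f) z = j powi (- k) * (aff c d w powi (- k) * f (mob a b c d w))"
      using True w by (simp add: A(1) B(1) slash_mat2 j_def w_def)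
    also have "\<dots> = (j * aff c d w) powi (- k) * f ((j * aff a b w) / (j * aff c d w))"
      using j by (simp add: power_int_mult_distrib)
    also have "\<dots> = slash k (A ** B) f z"
      unfolding 1 2 using True by (simp add: A(1) B(1) mat2_mult slash_mat2)
    finally show ?thesis .
  qed (simp add: slash_off)
qed

lemma Gamma0_subset: "Gamma0 N \<subseteq> SL2Z" and Gamma1_subset: "Gamma1 N \<subseteq> Gamma0 N"
  by (auto simp: Gamma0_def Gamma1_def)

lemma slash_holomorphic:
  assumes "f holomorphic_on upper_half_plane" "A \<in> SL2Z"
  shows "slash k A f holomorphic_on upper_half_plane"
proof -
  obtain a b c d where A: "A = mat2 a b c d" "a * d - b * c = 1" using SL2Z_E[OF assms(2)] .
  have "(f \<circ> (\<lambda>z. mob a b c d z)) holomorphic_on upper_half_plane"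
    using Im_mob_pos[OF A(2)] aff_nonzero[OF A(2)]
    by (intro holomorphic_on_compose_gen[OF _ assms(1)] holomorphic_intros) auto
  then have "(\<lambda>z. (aff c d z) powi (- k) * f (mob a b c d z)) holomorphic_on upper_half_plane"
    using aff_nonzero[OF A(2)] by (intro holomorphic_intros) (auto simp: o_def)
  then show ?thesis
    by (rule holomorphic_transform) (simp add: A(1) slash_mat2)
qed

text \<open>The cosets of Gamma_0(p) are represented by 1 and the S T^j, which is why infinity and 0
  are the only cusps.\<close>

lemma Gamma0_coset:
  assumes "prime p" "A \<in> SL2Z"
  obtains "A \<in> Gamma0 p" | B j where "B \<in> Gamma0 p" "A = B ** mat2 0 (- 1) 1 j"
proof (cases "A \<in> Gamma0 p")
  case False
  obtain a b c d where A: "A = mat2 a b c d" "a * d - b * c = 1" using SL2Z_E[OF assms(2)] .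
  have "\<not> int p dvd c" using False A assms(2) by (simp add: Gamma0_def cong_0_iff)
  moreover have "prime (int p)" using assms(1) by simp
  ultimately have "coprime c (int p)" using prime_imp_coprime coprime_commute by blast
  then obtain x where x: "[c * x = 1] (mod int p)" using cong_solve_coprime_int by blast
  \<comment> \<open>The quotient d/c modulo p, so that p divides the lower left entry c j -
    d.\<close>
  define j where "j = d * x"
  have "[c * j - d = 0] (mod int p)"
    using cong_diff[OF cong_mult[OF cong_refl[of d] x] cong_refl[of d]] by (simp add: j_def mult_ac)
  then have "mat2 (a * j - b) a (c * j - d) c \<in> Gamma0 p"
    using A(2) by (simp add: Gamma0_def SL2Z_iff algebra_simps)
  moreover have "A = mat2 (a * j - b) a (c * j - d) c ** mat2 0 (- 1) 1 j"
    unfolding A mat2_mult by simp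
  ultimately show thesis using that by blast
qed (use that in blast)

lemma SL2Z_mat2 [simp]: "mat2 a b c d \<in> SL2Z \<longleftrightarrow> a * d - b * c = 1"
  by (simp add: SL2Z_iff)

lemma slash_const_mult: "slash k A (\<lambda>z. x * f z) = (\<lambda>z. x * slash k A f z)"
  by (auto simp: slash_def)

lemma slash_S_shift:
  "slash k (mat2 0 (- 1) 1 j) f z = slash k (matS) f (z + of_int j)"
  by (simp add: slash_def)

lemma slash_tendsto:
  assumes p: "prime p" and A: "A \<in> SL2Z"
    and tr: "\<And>B. B \<in> Gamma0 p \<Longrightarrow> slash k B f = (\<lambda>z. \<psi> (B $ 2 $ 2) * f z)"
    and lim: "(f \<longlongrightarrow> l) at_inf" "(slash k (matS) f \<longlongrightarrow> l') at_inf"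
  obtains l'' where "(slash k A f \<longlongrightarrow> l'') at_inf" "l = 0 \<Longrightarrow> l' = 0 \<Longrightarrow> l'' = 0"
  using p A
proof (cases rule: Gamma0_coset)
  case 1
  have "(slash k A f \<longlongrightarrow> \<psi> (A $ 2 $ 2) * l) at_inf"
    unfolding tr[OF 1] by (intro tendsto_intros lim)
  then show thesis using that by simp
next
  case (2 B j)
  have "B \<in> SL2Z" using 2 Gamma0_subset by auto
  have "slash k A f = (\<lambda>z. \<psi> (B $ 2 $ 2) * slash k (matS) f (z + of_int j))"
    using slash_slash[OF \<open>B \<in> SL2Z\<close>, of "mat2 0 (-1) 1 j" k f]
    by (simp add: 2(2) tr[OF 2(1)] slash_const_mult slash_S_shift[of k j, abs_def])
  moreover have "lead (slash k (matS) f) 0 l'" using lim(2) by (simp add: lead_0_iff)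
  from lead_shift[OF this, of "of_int j"]
  have "((\<lambda>z. slash k (matS) f (z + of_int j)) \<longlongrightarrow> l') at_inf"
    by (simp add: lead_0_iff)
  ultimately have "(slash k A f \<longlongrightarrow> \<psi> (B $ 2 $ 2) * l') at_inf"
    by (simp add: tendsto_mult_left)
  then show thesis using that by simp
qed

text \<open>For every A in SL2(Z) the function \<open>slash k A f\<close> has period p and, by the
  coset decomposition, a limit at i infinity; together these give a Fourier expansion.\<close>

lemma modular_forms_criterion:
  fixes G :: "(int^2^2) set"
  assumes p: "prime p" and hol: "f holomorphic_on upper_half_plane" and off: "\<And>z. Im z \<le> 0 \<Longrightarrow> f z = 0"
    and tr: "\<And>B. B \<in> Gamma0 p \<Longrightarrow> slash k B f = (\<lambda>z. \<psi> (B $ 2 $ 2) * f z)"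
    and inv: "\<And>A. A \<in> G \<Longrightarrow> slash k A f = f" and G: "Gamma1 p \<subseteq> G"
    and lim: "(f \<longlongrightarrow> l) at_inf" "(slash k (matS) f \<longlongrightarrow> l') at_inf"
  shows "f \<in> modular_forms k G" and "l = 0 \<Longrightarrow> l' = 0 \<Longrightarrow> f \<in> cusp_forms k G"
proof -
  have p0: "p > 0" using p by (simp add: prime_gt_0_nat)
  have main: "\<exists>a l''. q_expansion p a (slash k A f) \<and> a 0 = l'' \<and> (l = 0 \<longrightarrow> l' = 0 \<longrightarrow> l'' = 0)" if A: "A \<in> SL2Z" for A
  proof -
    obtain l'' where l'': "(slash k A f \<longlongrightarrow> l'') at_inf" "l = 0 \<Longrightarrow> l' = 0 \<Longrightarrow> l'' = 0"
      using slash_tendsto[OF p A tr lim] by blast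
    obtain a b c d where M: "A = mat2 a b c d" "a * d - b * c = 1" using SL2Z_E[OF A] .
    \<comment> \<open>This is A T^p A^(-1), an element of Gamma_1(p); it makes
      \<open>slash k A f\<close> periodic with period p.\<close>
    define B where "B = mat2 (1 - a * c * int p) (a * a * int p) (- c * c * int p) (1 + a * c * int p)"
    have "(1 - a * c * int p) * (1 + a * c * int p) - a * a * int p * (- c * c * int p) = 1"
      by (simp add: algebra_simps)
    then have B: "B \<in> Gamma1 p"
      by (simp add: B_def Gamma1_def cong_iff_dvd_diff)
    then have BS: "B \<in> SL2Z" using Gamma1_subset Gamma0_subset by blast
    have BA: "B ** A = A ** mat2 1 (int p) 0 1"
    proof -
      have "a * (a * d - b * c) = a" "c * (a * d - b * c) = c" using M(2) by simp_all
      then have "a * (a * d) = a + a * (b * c)" "c * (a * d) = c + c * (b * c)" by (simp_all add: algebra_simps)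
      then have "a * a * d = a + a * b * c" "c * a * d = c + c * b * c" by (simp_all add: algebra_simps)
      then have "a * a * d * int p = (a + a * b * c) * int p" "c * a * d * int p = (c + c * b * c) * int p" by simp_all
      then show ?thesis unfolding B_def M mat2_mult by (simp add: algebra_simps)
    qed
    have "slash k A f (z + of_nat p) = slash k A f z" for z
    proof (cases "Im z > 0")
      case True
      have "slash k (mat2 1 (int p) 0 1) (slash k A f) = slash k (A ** mat2 1 (int p) 0 1) f"
        by (rule slash_slash[OF A]) simp
      also have "\<dots> = slash k A (slash k B f)" unfolding BA[symmetric] by (rule slash_slash[OF BS A, symmetric])
      also have "slash k B f = f" using B G inv by blast
      finally have "slash k (mat2 1 (int p) 0 1) (slash k A f) z = slash k A f z" by simp
      then show ?thesis using True by (simp add: slash_mat2)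
    qed (simp add: slash_off)
    from q_expansion_exists[OF p0 slash_holomorphic[OF hol A] this l''(1)] l''(2) show ?thesis by metis
  qed
  show mf: "f \<in> modular_forms k G"
  proof -
    have "holomorphic_at_infinity (slash k A f)" if "A \<in> SL2Z" for A
      using main[OF that] p0 unfolding holomorphic_at_infinity_def by blast
    then show ?thesis using hol off inv by (simp add: modular_forms_def not_less)
  qed
  show "f \<in> cusp_forms k G" if "l = 0" "l' = 0"
    unfolding cusp_forms_def vanishes_at_infinity_def using mf main p0 that by blast
qed

section \<open>Forms with known orders at the two cusps\<close>

definition weight_on :: "nat \<Rightarrow> int \<Rightarrow> (int \<Rightarrow> complex) \<Rightarrow> (complex \<Rightarrow> complex) \<Rightarrow> bool" where
  "weight_on N k \<psi> f \<longleftrightarrow> (\<forall>a b c d z. a * d - b * c = 1 \<longrightarrow> int N dvd c \<longrightarrow> Im z > 0 \<longrightarrow>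
     f (mob a b c d z) = \<psi> d * aff c d z powi k * f z)"

definition at_zero :: "int \<Rightarrow> (complex \<Rightarrow> complex) \<Rightarrow> complex \<Rightarrow> complex" where
  "at_zero k f z = z powi (- k) * f (- 1 / z)"

text \<open>\<open>form p k \<psi> f m n\<close>: \<open>f\<close> has weight \<open>k\<close> and character \<open>\<psi>\<close> for \<open>\<Gamma>\<^sub>0(p)\<close>, and orders exactly \<open>m\<close>
  and \<open>n\<close> (the latter in units of \<open>q\<close>, so possibly in \<open>\<int>/p\<close>) at the cusps \<open>\<infinity>\<close> and \<open>0\<close>.\<close>

definition form :: "nat \<Rightarrow> int \<Rightarrow> (int \<Rightarrow> complex) \<Rightarrow> (complex \<Rightarrow> complex) \<Rightarrow> real \<Rightarrow> real \<Rightarrow> bool" where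
  "form p k \<psi> f m n \<longleftrightarrow> f holomorphic_on upper_half_plane \<and> weight_on p k \<psi> f \<and>
     (\<exists>c. c \<noteq> 0 \<and> lead f m c) \<and> (\<exists>c. c \<noteq> 0 \<and> lead (at_zero k f) n c)"

lemma at_zero_mult: "Im z > 0 \<Longrightarrow> at_zero (k + l) (\<lambda>z. f z * g z) z = at_zero k f z * at_zero l g z"
  using power_int_add[of z "- k" "- l"] by (cases "z = 0") (auto simp: at_zero_def mult_ac)

lemma at_zero_power_int: "at_zero (n * k) (\<lambda>z. f z powi n) z = at_zero k f z powi n"
  by (simp add: at_zero_def power_int_mult_distrib flip: power_int_mult) (simp add: mult.commute)

lemma form_mult:
  assumes "form p k \<psi> f m n" "form p l \<phi> g m' n'"
  shows "form p (k + l) (\<lambda>d. \<psi> d * \<phi> d) (\<lambda>z. f z * g z) (m + m') (n + n')"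
proof -
  have f: "f holomorphic_on upper_half_plane" "weight_on p k \<psi> f"
    and g: "g holomorphic_on upper_half_plane" "weight_on p l \<phi> g" using assms by (auto simp: form_def)
  have "weight_on p (k + l) (\<lambda>d. \<psi> d * \<phi> d) (\<lambda>z. f z * g z)"
    unfolding weight_on_def
  proof (intro allI impI)
    fix a b c d :: int and z
    assume *: "a * d - b * c = 1" "int p dvd c" "Im z > 0"
    show "f (mob a b c d z) * g (mob a b c d z)
      = \<psi> d * \<phi> d * aff c d z powi (k + l) * (f z * g z)"
      using f(2) g(2) * aff_nonzero[OF *(1,3)] by (simp add: weight_on_def power_int_add)
  qed
  moreover obtain c d c' d' where cd: "c \<noteq> 0" "c' \<noteq> 0" "lead f m c" "lead (at_zero k f) n c'"
     "d \<noteq> 0" "d' \<noteq> 0" "lead g m' d" "lead (at_zero l g) n' d'"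
    using assms by (auto simp: form_def)
  moreover have "lead (at_zero (k + l) (\<lambda>z. f z * g z)) (n + n') (c' * d')"
  proof -
    have "lead (at_zero (k + l) (\<lambda>z. f z * g z)) (n + n') (c' * d') =
        lead (\<lambda>z. at_zero k f z * at_zero l g z) (n + n') (c' * d')"
      by (rule lead_cong) (rule at_zero_mult)
    then show ?thesis using lead_mult[OF cd(4,8)] by simp
  qed
  ultimately show ?thesis
    unfolding form_def using f g lead_mult[OF cd(3,7)]
    by (intro conjI holomorphic_intros exI[of _ "c * d"] exI[of _ "c' * d'"]) simp_all
qed

lemma form_power_int:
  assumes "form p k \<psi> f m n" "\<And>z. Im z > 0 \<Longrightarrow> f z \<noteq> 0"
  shows "form p (i * k) (\<lambda>d. \<psi> d powi i) (\<lambda>z. f z powi i) (of_int i * m) (of_int i * n)"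
proof -
  have "weight_on p (i * k) (\<lambda>d. \<psi> d powi i) (\<lambda>z. f z powi i)"
    using assms unfolding form_def weight_on_def
    by (simp add: power_int_mult_distrib flip: power_int_mult) (simp add: mult.commute)
  moreover obtain c c' where "c \<noteq> 0" "c' \<noteq> 0" "lead f m c" "lead (at_zero k f) n c'"
    using assms by (auto simp: form_def)
  then have "c powi i \<noteq> 0" "c' powi i \<noteq> 0" "lead (\<lambda>z. f z powi i) (of_int i * m) (c powi i)"
    "lead (at_zero (i * k) (\<lambda>z. f z powi i)) (of_int i * n) (c' powi i)"
    using lead_power_int[of "at_zero k f" n c' i] lead_power_int[of f m c i]
    by (simp_all add: at_zero_power_int[abs_def])
  moreover have "f holomorphic_on upper_half_plane" using assms(1) by (simp add: form_def)
  ultimately show ?thesis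
    unfolding form_def using assms(2) by (intro conjI holomorphic_on_power_int exI[of _ "c powi i"] exI[of _ "c' powi i"]) simp_all
qed

lemma form_one: "form p 0 (\<lambda>_. 1) (\<lambda>_. 1) 0 0"
  by (auto simp: form_def weight_on_def at_zero_def[abs_def] lead_const intro!: exI[of _ 1])

lemma form_power:
  assumes "form p k \<psi> f m n"
  shows "form p (int i * k) (\<lambda>d. \<psi> d ^ i) (\<lambda>z. f z ^ i) (real i * m) (real i * n)"
proof (induction i)
  case (Suc i)
  from form_mult[OF assms Suc.IH] show ?case by (simp add: algebra_simps)
qed (simp add: form_one)

lemma weight_on_coprime:
  fixes a b c d :: int
  assumes "a * d - b * c = 1" "int p dvd c" "p > 1"
  shows "\<not> int p dvd d"
proof
  assume "int p dvd d"
  then have "int p dvd a * d - b * c" using assms(2) by simp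
  then show False using assms by simp
qed

text \<open>If p divides c, the determinant makes d prime to p, so only the values of the character
  there enter.\<close>

lemma form_cong_character:
  assumes "form p k \<psi> f m n" "p > 1" "\<And>d. \<not> int p dvd d \<Longrightarrow> \<psi> d = \<phi> d"
  shows "form p k \<phi> f m n"
  using assms weight_on_coprime[OF _ _ assms(2)] unfolding form_def weight_on_def by (metis (no_types, lifting))

text \<open>Products and powers are formed from functions that are not cut off; the normalisation
  off the upper half plane is imposed at the end.\<close>

definition restrict_hp :: "(complex \<Rightarrow> complex) \<Rightarrow> complex \<Rightarrow> complex" where
  "restrict_hp f z = (if Im z > 0 then f z else 0)"

lemma form_slash:
  assumes "form p k \<psi> f m n" "B \<in> Gamma0 p"
  shows "slash k B (restrict_hp f) = (\<lambda>z. \<psi> (B $ 2 $ 2) * restrict_hp f z)"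
proof
  fix z
  have "B \<in> SL2Z" using assms(2) Gamma0_subset by auto
  then obtain a b c d where B: "B = mat2 a b c d" "a * d - b * c = 1" using SL2Z_E by blast
  show "slash k B (restrict_hp f) z = \<psi> (B $ 2 $ 2) * restrict_hp f z"
  proof (cases "Im z > 0")
    case True
    have "int p dvd c" using assms(2) B by (simp add: Gamma0_def cong_0_iff)
    then have "f (mob a b c d z) = \<psi> d * aff c d z powi k * f z"
      using assms(1) B(2) True by (auto simp: form_def weight_on_def)
    then show ?thesis
      using True Im_mob_pos[OF B(2) True] aff_nonzero[OF B(2) True]
      by (simp add: B(1) slash_mat2 restrict_hp_def power_int_minus)
  qed (simp add: slash_off restrict_hp_def)
qed

lemma form_modular:
  fixes G :: "(int^2^2) set"
  assumes p: "prime p" and f: "form p k \<psi> f m n" and mn: "m \<ge> 0" "n \<ge> 0"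
    and G: "Gamma1 p \<subseteq> G" "G \<subseteq> Gamma0 p" "\<And>A. A \<in> G \<Longrightarrow> \<psi> (A $ 2 $ 2) = 1"
  shows "restrict_hp f \<in> modular_forms k G" and "m > 0 \<Longrightarrow> n > 0 \<Longrightarrow> restrict_hp f \<in> cusp_forms k G"
proof -
  obtain c c' where c: "lead f m c" "lead (at_zero k f) n c'" using f by (auto simp: form_def)
  have "lead (restrict_hp f) m c \<longleftrightarrow> lead f m c"
    by (rule lead_cong) (simp add: restrict_hp_def)
  moreover have "lead (slash k (matS) (restrict_hp f)) n c' \<longleftrightarrow> lead (at_zero k f) n c'"
    by (rule lead_cong) (simp add: restrict_hp_def slash_mat2 at_zero_def Im_divide sum_power2_gt_zero_iff)
  ultimately have c': "lead (restrict_hp f) m c" "lead (slash k (matS) (restrict_hp f)) n c'" using c by auto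
  obtain l l' where l: "(restrict_hp f \<longlongrightarrow> l) at_inf" "m > 0 \<Longrightarrow> l = 0"
      "(slash k (matS) (restrict_hp f) \<longlongrightarrow> l') at_inf" "n > 0 \<Longrightarrow> l' = 0"
    using lead_tendsto[OF c'(1) mn(1)] lead_tendsto[OF c'(2) mn(2)] by metis
  have hol: "restrict_hp f holomorphic_on upper_half_plane"
    using f unfolding form_def by (auto simp: restrict_hp_def elim!: holomorphic_transform)
  have inv: "slash k A (restrict_hp f) = restrict_hp f" if "A \<in> G" for A
    using form_slash[OF f, of A] that G by (auto simp: fun_eq_iff)
  note * = modular_forms_criterion[where \<psi> = \<psi>, OF p hol _ form_slash[OF f] inv G(1) l(1,3)]
  show "restrict_hp f \<in> modular_forms k G" by (rule *(1)) (auto simp: restrict_hp_def)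
  show "restrict_hp f \<in> cusp_forms k G" if "m > 0" "n > 0"
    by (rule *(2)) (use l that in \<open>auto simp: restrict_hp_def\<close>)
qed

section \<open>Delta and E as forms\<close>

lemma euler_prod_holomorphic [holomorphic_intros]:
  assumes "f holomorphic_on S" "open S" "\<And>z. z \<in> S \<Longrightarrow> Im (f z) > 0"
  shows "(\<lambda>z. euler_prod (f z)) holomorphic_on S"
  unfolding euler_prod_def by (intro holomorphic_intros assms) (use assms in auto)

lemma lead_euler_prod:
  assumes "r > 0" shows "lead (\<lambda>z. euler_prod (of_real r * z)) 0 1"
  unfolding lead_0_iff euler_prod_def by (intro qpoch_tendsto_1 nome_tendsto_0 assms)

lemma lead_Delta: "lead Delta 1 1"
proof -
  have "lead (\<lambda>t. nome (of_real 1 * t) * euler_prod (of_real 1 * t) ^ 24) (1 + real 24 * 0) (1 * 1 ^ 24)"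
    by (intro lead_mult lead_nome lead_power lead_euler_prod) simp
  then show ?thesis by (simp add: Delta_def[abs_def])
qed

lemma form_Delta: "form p 12 (\<lambda>_. 1) Delta 1 1"
  unfolding form_def
proof (intro conjI)
  show "Delta holomorphic_on upper_half_plane"
    unfolding Delta_def[abs_def] by (intro holomorphic_intros) auto
  show "weight_on p 12 (\<lambda>_. 1) Delta"
    unfolding weight_on_def by (simp add: Delta_SL2)
  show "\<exists>c. c \<noteq> 0 \<and> lead Delta 1 c" using lead_Delta by (intro exI[of _ 1]) simp
  have "at_zero 12 Delta z = Delta z" if "Im z > 0" for z
    using Delta_S[OF that] that by (cases "z = 0") (auto simp: at_zero_def power_int_minus field_simps)
  then have "lead (at_zero 12 Delta) 1 1" using lead_Delta lead_cong[of "at_zero 12 Delta" Delta] by blast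
  then show "\<exists>c. c \<noteq> 0 \<and> lead (at_zero 12 Delta) 1 c" by (intro exI[of _ 1]) simp
qed

text \<open>Only the exponential prefactor contributes to the order: the infinite products tend to 1
  because x and 1 - x are both positive. Up to the constant 1/12 the order is half the second
  Bernoulli polynomial.\<close>

lemma lead_klein:
  assumes x: "0 < x" "x < 1"
  shows "lead (\<lambda>t. klein x 0 t) (x * (x - 1) / 2) 1"
proof -
  have "lead (\<lambda>t. nome (of_real (x * (x - 1) / 2) * t) * (qpoch (nome (of_real x * t)) (nome (of_real 1 * t))
      * qpoch (nome (of_real (1 - x) * t)) (nome (of_real 1 * t))) / (euler_prod (of_real 1 * t)) ^ 2)
     (x * (x - 1) / 2 + (0 + 0) - real 2 * 0) (1 * (1 * 1) / 1 ^ 2)"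
    using x by (intro lead_divide lead_mult lead_nome lead_power lead_euler_prod) 
       (auto simp: lead_0_iff intro!: qpoch_tendsto_1 nome_tendsto_0 nome_tendsto_0[of 1, simplified] nome_tendsto_0[of "1 - x", simplified])
  moreover have "klein x 0 t = nome (of_real (x * (x - 1) / 2) * t) * (qpoch (nome (of_real x * t)) (nome (of_real 1 * t))
      * qpoch (nome (of_real (1 - x) * t)) (nome (of_real 1 * t))) / (euler_prod (of_real 1 * t)) ^ 2" for t
    by (simp add: klein_def theta_def algebra_simps)
  ultimately show ?thesis by simp
qed

lemma sum_klein_orders:
  assumes "p = 2 * m + 1"
  shows "(\<Sum>j=1..m. (real j / real p) * (real j / real p - 1) / 2) = - ((real p)\<^sup>2 - 1) / (24 * real p)"
proof -
  have 1: "(\<Sum>j=1..m. real j) = real m * (real m + 1) / 2"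
    by (induction m) (auto simp: field_simps)
  have 2: "(\<Sum>j=1..m. (real j)\<^sup>2) = real m * (real m + 1) * (2 * real m + 1) / 6"
    by (induction m) (auto simp: field_simps power2_eq_square)
  have "(\<Sum>j=1..m. (real j / real p) * (real j / real p - 1) / 2) =
      (\<Sum>j=1..m. (real j)\<^sup>2 / (2 * (real p)\<^sup>2) - real j / (2 * real p))"
  proof (intro sum.cong refl)
    fix j
    have "real p \<noteq> 0" using assms by simp
    then show "real j / real p * (real j / real p - 1) / 2 = (real j)\<^sup>2 / (2 * (real p)\<^sup>2) - real j / (2 * real p)"
      by (simp add: field_simps power2_eq_square)
  qed
  also have "\<dots> = (\<Sum>j=1..m. (real j)\<^sup>2) / (2 * (real p)\<^sup>2) - (\<Sum>j=1..m. real j) / (2 * real p)"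
    by (simp add: sum_subtractf sum_divide_distrib)
  also have "\<dots> = real m * (real m + 1) * real p / 6 / (2 * (real p)\<^sup>2) - real m * (real m + 1) / 2 / (2 * real p)"
    unfolding 1 2 using assms by simp
  also have "\<dots> = - (4 * (real m * (real m + 1))) / (24 * real p)"
    using assms by (simp add: power2_eq_square divide_simps) (simp add: algebra_simps)
  also have "4 * (real m * (real m + 1)) = (real p)\<^sup>2 - 1" using assms by (simp add: power2_eq_square algebra_simps)
  finally show ?thesis .
qed

text \<open>S takes the characteristics (0, j/p) of the Klein product to (j/p, 0), and minus the sum
  of their orders is the order of E at 0. In the local parameter q^(1/p) it equals (p^2 -
  1)/24.\<close>

lemma form_eta_ratio:
  assumes p: "prime p" "p \<ge> 5" "p = 2 * m + 1"
  shows "form p (int m) (legendre_char p) (eta_ratio p) 0 (((real p)\<^sup>2 - 1) / (24 * real p))"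
  unfolding form_def
proof (intro conjI)
  have tp: "Im (of_nat p * t) > 0" if "Im t > 0" for t using that p by simp
  show "eta_ratio p holomorphic_on upper_half_plane"
    unfolding eta_ratio_def[abs_def] using tp euler_prod_nonzero p by (intro holomorphic_intros) auto
  show "weight_on p (int m) (legendre_char p) (eta_ratio p)"
    unfolding weight_on_def legendre_char_def using eta_ratio_Gamma0[OF p(1,3,2)] by simp
  have "lead (\<lambda>t. euler_prod (of_real 1 * t) ^ p / euler_prod (of_real (real p) * t)) (real p * 0 - 0) (1 ^ p / 1)"
    using p by (intro lead_divide lead_power lead_euler_prod) auto
  then have "lead (eta_ratio p) 0 1" by (simp add: eta_ratio_def[abs_def])
  then show "\<exists>c. c \<noteq> 0 \<and> lead (eta_ratio p) 0 c" by (intro exI[of _ 1]) simp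
  obtain C where C: "C \<noteq> 0" "\<And>t. Im t > 0 \<Longrightarrow> (\<Prod>j=1..m. klein 0 (real j / real p) t) = C / eta_ratio p t"
    using klein_product_eta_ratio[OF p(3)] by blast
  have "lead (\<lambda>t. \<Prod>j=1..m. klein (real j / real p) 0 t) (\<Sum>j=1..m. (real j / real p) * (real j / real p - 1) / 2) (\<Prod>j=1..m. 1)"
    using p by (intro lead_prod lead_klein) auto
  from lead_divide[OF lead_const[of C] this]
  have "lead (\<lambda>t. C / (\<Prod>j=1..m. klein (real j / real p) 0 t)) (0 - (\<Sum>j=1..m. (real j / real p) * (real j / real p - 1) / 2)) C"
    by simp
  moreover have "0 - (\<Sum>j=1..m. (real j / real p) * (real j / real p - 1) / 2) = ((real p)\<^sup>2 - 1) / (24 * real p)"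
    unfolding sum_klein_orders[OF p(3)] by (simp add: minus_divide_left)
  ultimately have l: "lead (\<lambda>t. C / (\<Prod>j=1..m. klein (real j / real p) 0 t)) (((real p)\<^sup>2 - 1) / (24 * real p)) C"
    by (simp only:)
  have "at_zero (int m) (eta_ratio p) t = C / (\<Prod>j=1..m. klein (real j / real p) 0 t)" if t: "Im t > 0" for t
  proof -
    have t0: "t \<noteq> 0" using t by auto
    have t': "Im (- 1 / t) > 0" using t by (simp add: Im_divide sum_power2_gt_zero_iff)
    define P where "P = (\<Prod>j=1..m. klein (real j / real p) 0 t)"
    define e where "e = eta_ratio p (- 1 / t)"
    have eq: "P / t ^ m = C / e" unfolding P_def e_def
      using C(2)[OF t'] klein_S[OF t, of 0] by (simp add: prod_dividef)
    have e: "e \<noteq> 0" unfolding e_def using eta_ratio_nonzero[OF _ t'] p by simp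
    have "P \<noteq> 0" using eq e C(1) by auto
    then have "e / t ^ m = C / P" using eq e t0 by (simp add: divide_simps mult_ac)
    moreover have "at_zero (int m) (eta_ratio p) t = e / t ^ m"
      by (simp add: at_zero_def e_def power_int_minus divide_inverse)
    ultimately show ?thesis by (simp add: P_def)
  qed
  then have "lead (at_zero (int m) (eta_ratio p)) (((real p)\<^sup>2 - 1) / (24 * real p)) C"
    using l lead_cong[of "at_zero (int m) (eta_ratio p)" "\<lambda>t. C / (\<Prod>j=1..m. klein (real j / real p) 0 t)"] by blast
  then show "\<exists>c. c \<noteq> 0 \<and> lead (at_zero (int m) (eta_ratio p)) (((real p)\<^sup>2 - 1) / (24 * real p)) c"
    using C(1) by blast
qed

section \<open>Logarithmic derivatives and auxiliary forms of weights 4 and 2\<close>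

lemma mob_has_derivative:
  fixes a b c d :: int
  assumes "a * d - b * c = 1" "Im z > 0"
  shows "((\<lambda>z. mob a b c d z) has_field_derivative 1 / (aff c d z)\<^sup>2) (at z)"
proof -
  have nz: "aff c d z \<noteq> 0" using aff_nonzero[OF assms] .
  have "of_int (a * d - b * c) = (1 :: complex)" unfolding assms(1) by simp
  then have "of_int a * aff c d z - (aff a b z) * of_int c = 1"
    by (simp add: algebra_simps)
  moreover have "((\<lambda>z. mob a b c d z) has_field_derivative
      (of_int a * aff c d z - (aff a b z) * of_int c) / (aff c d z * aff c d z)) (at z)"
    using nz by (auto intro!: derivative_eq_intros)
  ultimately show ?thesis by (simp add: power2_eq_square)
qed

lemma has_deriv_upper_half_plane:
  assumes "f holomorphic_on upper_half_plane" "Im z > 0"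
  shows "(f has_field_derivative deriv f z) (at z)"
  using assms holomorphic_derivI[of f upper_half_plane z] by simp

lemma deriv_eq_on_upper_half_plane:
  assumes "\<And>z. Im z > 0 \<Longrightarrow> f z = g z" "Im z > 0" "(f has_field_derivative x) (at z)" "(g has_field_derivative y) (at z)"
  shows "x = y"
proof -
  have "eventually (\<lambda>w. w \<in> upper_half_plane) (nhds z)" using assms(2) by (intro eventually_nhds_in_open) auto
  then have "eventually (\<lambda>w. f w = g w) (nhds z)" by eventually_elim (simp add: assms(1))
  then have "(f has_field_derivative y) (at z)" using assms(4) DERIV_cong_ev by blast
  then show ?thesis using assms(3) DERIV_unique by blast
qed

definition log_deriv :: "(complex \<Rightarrow> complex) \<Rightarrow> complex \<Rightarrow> complex" where
  "log_deriv f z = deriv f z / f z"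

lemma log_deriv_holomorphic:
  assumes "f holomorphic_on upper_half_plane" "\<And>z. Im z > 0 \<Longrightarrow> f z \<noteq> 0"
  shows "log_deriv f holomorphic_on upper_half_plane"
  unfolding log_deriv_def[abs_def] using assms by (intro holomorphic_intros holomorphic_deriv) auto

text \<open>Obtained by differentiating the transformation law. The inhomogeneous term vanishes for
  k = 0, which is used for the weight 2 form; for k = 12 it is cancelled in
  \<open>eisenstein4\<close>.\<close>

lemma log_deriv_mob:
  fixes a b c d :: int
  assumes f: "f holomorphic_on upper_half_plane" "\<And>z. Im z > 0 \<Longrightarrow> f z \<noteq> 0"
    and det: "a * d - b * c = 1"
    and tr: "\<And>z. Im z > 0 \<Longrightarrow> f (mob a b c d z) = aff c d z ^ k * f z"
    and z: "Im z > 0"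
  shows "log_deriv f (mob a b c d z) =
    (aff c d z)\<^sup>2 * log_deriv f z + of_nat k * of_int c * aff c d z"
proof -
  define g where "g = mob a b c d z"
  define j where "j = aff c d z"
  have j: "j \<noteq> 0" and g: "Im g > 0"
    using aff_nonzero[OF det z] Im_mob_pos[OF det z] by (simp_all add: j_def g_def)
  have "((\<lambda>z. f (mob a b c d z)) has_field_derivative deriv f g * (1 / j\<^sup>2)) (at z)"
    using DERIV_chain2[OF has_deriv_upper_half_plane[OF f(1) g, unfolded g_def] mob_has_derivative[OF det z]]
    by (simp add: g_def j_def)
  moreover have "((\<lambda>z. (aff c d z) ^ k * f z) has_field_derivative
      (of_nat k * j ^ (k - 1) * of_int c) * f z + deriv f z * j ^ k) (at z)"
    unfolding j_def by (rule DERIV_mult) (auto intro!: derivative_eq_intros has_deriv_upper_half_plane[OF f(1) z])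
  ultimately have eq: "deriv f g * (1 / j\<^sup>2) = (of_nat k * j ^ (k - 1) * of_int c) * f z + deriv f z * j ^ k"
    by (rule deriv_eq_on_upper_half_plane[OF _ z, rotated]) (rule tr)
  have fg: "f g = j ^ k * f z" using tr[OF z] by (simp add: g_def j_def)
  have jk: "of_nat k * j ^ (k - 1) * j = of_nat k * j ^ k" by (cases k) simp_all
  have "deriv f g = j\<^sup>2 * ((of_nat k * j ^ (k - 1) * of_int c) * f z + deriv f z * j ^ k)"
    using eq j by (simp add: field_simps)
  also have "\<dots> = (of_nat k * j ^ (k - 1) * j) * of_int c * j * f z + j\<^sup>2 * deriv f z * j ^ k"
    by (simp add: algebra_simps power2_eq_square)
  also have "\<dots> = (j\<^sup>2 * log_deriv f z + of_nat k * of_int c * j) * f g"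
    unfolding jk fg log_deriv_def using f(2)[OF z] by (simp add: algebra_simps)
  finally have "log_deriv f g = j\<^sup>2 * log_deriv f z + of_nat k * of_int c * j"
    using f(2)[OF g] by (simp add: log_deriv_def)
  then show ?thesis by (simp add: g_def j_def)
qed

text \<open>Writing f = g q^m with g tending to c, the derivative of g tends to 0 and only the
  factor q^m contributes.\<close>

lemma lead_log_deriv:
  assumes f: "f holomorphic_on upper_half_plane" and l: "lead f m c" "c \<noteq> 0"
  shows "lead (log_deriv f) 0 (2 * of_real pi * \<i> * of_real m)"
proof -
  define g where "g z = f z * nome (- of_real m * z)" for z
  have ghol: "g holomorphic_on upper_half_plane" unfolding g_def[abs_def] by (intro holomorphic_intros f)
  have glim: "(g \<longlongrightarrow> c) at_inf" using l(1) by (simp add: lead_def g_def[abs_def])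
  from deriv_tendsto_0[OF ghol glim] have "(deriv g \<longlongrightarrow> 0) at_inf" .
  from tendsto_add[OF tendsto_divide[OF this glim l(2)] tendsto_const]
  have lim: "((\<lambda>z. deriv g z / g z + 2 * of_real pi * \<i> * of_real m) \<longlongrightarrow> 2 * of_real pi * \<i> * of_real m) at_inf" by simp
  have "eventually (\<lambda>z. g z \<noteq> 0) at_inf" using tendsto_imp_eventually_ne[OF glim l(2)] .
  then have ev: "eventually (\<lambda>z. deriv g z / g z + 2 * of_real pi * \<i> * of_real m = log_deriv f z) at_inf"
    using eventually_at_inf_gt[of 0]
  proof eventually_elim
    case (elim z)
    have "(g has_field_derivative deriv f z * nome (- of_real m * z) + (nome (- of_real m * z) * (- of_real m * (2 * of_real pi * \<i>))) * f z) (at z)"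
      unfolding g_def[abs_def] nome_def
      by (rule DERIV_mult[OF has_deriv_upper_half_plane[OF f elim(2)]]) (auto intro!: derivative_eq_intros)
    then have "deriv g z = deriv f z * nome (- of_real m * z) + (nome (- of_real m * z) * (- of_real m * (2 * of_real pi * \<i>))) * f z"
      by (rule DERIV_imp_deriv)
    moreover have "f z \<noteq> 0" using elim(1) by (auto simp: g_def)
    ultimately show ?case by (simp add: g_def log_deriv_def field_simps)
  qed
  show ?thesis unfolding lead_0_iff using lim by (rule tendsto_cong[OF ev, THEN iffD1])
qed

text \<open>Ramanujan's formula for the derivative of \<open>E\<^sub>2 = \<Delta>'/(2 \<pi> i \<Delta>)\<close> identifies this with \<open>(2 \<pi> i)\<^sup>2 E\<^sub>4\<close>.\<close>

definition eisenstein4 :: "complex \<Rightarrow> complex" where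
  "eisenstein4 z = (log_deriv Delta z)\<^sup>2 - 12 * deriv (log_deriv Delta) z"

lemma prime_ge_5_odd:
  fixes p :: nat
  assumes "prime p" "p \<ge> 5" obtains m where "p = 2 * m + 1"
proof -
  have "odd p" using assms prime_odd_nat[of p] by simp
  then show thesis using that by (elim oddE)
qed

text \<open>With j = c z + d and L the logarithmic derivative of Delta, the square of L and 12 times
  its derivative both acquire the extra terms 24 c j^3 L + 144 c^2 j^2. This fixes the factor 12 in
  the definition.\<close>

lemma form_eisenstein4: "form p 4 (\<lambda>_. 1) eisenstein4 0 0"
proof -
  have D: "Delta holomorphic_on upper_half_plane" "\<And>z. Im z > 0 \<Longrightarrow> Delta z \<noteq> 0" "lead Delta 1 1"
    using form_Delta[of 1] Delta_nonzero lead_Delta by (simp_all add: form_def)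
  define L where "L = log_deriv Delta"
  have L: "L holomorphic_on upper_half_plane" unfolding L_def using log_deriv_holomorphic[OF D(1,2)] .
  have tr: "eisenstein4 (mob a b c d z) = aff c d z ^ 4 * eisenstein4 z"
    if det: "a * d - b * c = 1" and z: "Im z > 0" for a b c d :: int and z
  proof -
    define g where "g = mob a b c d z"
    define j where "j = aff c d z"
    have j: "j \<noteq> 0" and g: "Im g > 0"
      using aff_nonzero[OF det z] Im_mob_pos[OF det z] by (simp_all add: j_def g_def)
    have Ltr: "L (mob a b c d z) = (aff c d z)\<^sup>2 * L z + 12 * of_int c * aff c d z"
      if "Im z > 0" for z
      using log_deriv_mob[OF D(1,2) det _ that, of 12] Delta_SL2[OF det] by (simp add: L_def)
    have "((\<lambda>z. L (mob a b c d z)) has_field_derivative deriv L g * (1 / j\<^sup>2)) (at z)"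
      using DERIV_chain2[OF has_deriv_upper_half_plane[OF L g, unfolded g_def] mob_has_derivative[OF det z]]
      by (simp add: g_def j_def)
    moreover have "((\<lambda>z. (aff c d z)\<^sup>2 * L z + 12 * of_int c * aff c d z) has_field_derivative
        2 * j * of_int c * L z + deriv L z * j\<^sup>2 + 12 * of_int c * of_int c) (at z)"
      unfolding j_def by (auto intro!: derivative_eq_intros has_deriv_upper_half_plane[OF L z])
    ultimately have "deriv L g * (1 / j\<^sup>2) = 2 * j * of_int c * L z + deriv L z * j\<^sup>2 + 12 * of_int c * of_int c"
      by (rule deriv_eq_on_upper_half_plane[OF _ z, rotated]) (rule Ltr)
    then have "deriv L g = j\<^sup>2 * (2 * j * of_int c * L z + deriv L z * j\<^sup>2 + 12 * of_int c * of_int c)"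
      using j by (simp add: field_simps)
    moreover have "L g = j\<^sup>2 * L z + 12 * of_int c * j" using Ltr[OF z] by (simp add: g_def j_def)
    ultimately have "eisenstein4 g = j ^ 4 * eisenstein4 z"
      by (simp add: eisenstein4_def flip: L_def) (simp add: algebra_simps power2_eq_square power4_eq_xxxx)
    then show ?thesis by (simp add: g_def j_def)
  qed
  have Llim: "(L \<longlongrightarrow> 2 * of_real pi * \<i>) at_inf"
    using lead_log_deriv[OF D(1,3)] by (simp add: lead_0_iff L_def)
  from tendsto_diff[OF tendsto_power[OF this, of 2] tendsto_mult[OF tendsto_const[of 12] deriv_tendsto_0[OF L this]]]
  have l: "lead eisenstein4 0 ((2 * of_real pi * \<i>)\<^sup>2)"
    by (simp add: lead_0_iff eisenstein4_def[abs_def] L_def)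
  have "at_zero 4 eisenstein4 z = eisenstein4 z" if "Im z > 0" for z
    using tr[of 0 0 "- 1" 1 z] that by (cases "z = 0") (auto simp: at_zero_def power_int_minus field_simps)
  then have "lead (at_zero 4 eisenstein4) 0 ((2 * of_real pi * \<i>)\<^sup>2)"
    using l lead_cong[of "at_zero 4 eisenstein4" eisenstein4] by blast
  moreover have "(2 * of_real pi * \<i>)\<^sup>2 \<noteq> (0 :: complex)" by simp
  moreover have "eisenstein4 holomorphic_on upper_half_plane"
    unfolding eisenstein4_def[abs_def] using L by (intro holomorphic_intros holomorphic_deriv) (auto simp: L_def)
  moreover have "weight_on p 4 (\<lambda>_. 1) eisenstein4"
    unfolding weight_on_def using tr by simp
  ultimately show ?thesis using l unfolding form_def by blast
qed

text \<open>Serves to reach all even weights between multiples of 12 without adding zeros at the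
  cusps. The function \<open>u\<close> is E^24 / Delta^(p - 1); its orders 1 - p and 1 - 1/p are
  both nonzero, so its logarithmic derivative has nonzero limits at both cusps.\<close>

lemma form_weight_2:
  assumes p: "prime p" "p \<ge> 5"
  obtains D where "form p 2 (\<lambda>_. 1) D 0 0"
proof
  obtain m where m: "p = 2 * m + 1" by (rule prime_ge_5_odd[OF p])
  define u where "u z = eta_ratio p z ^ 24 * Delta z powi (- (int p - 1))" for z
    \<comment> \<open>of weight \<open>0\<close>, so that its logarithmic derivative has weight \<open>2\<close>\<close>
  have "form p (int 24 * int m + - (int p - 1) * 12) (\<lambda>d. legendre_char p d ^ 24 * 1 powi (- (int p - 1))) u
     (real 24 * 0 + of_int (- (int p - 1)) * 1) (real 24 * (((real p)\<^sup>2 - 1) / (24 * real p)) + of_int (- (int p - 1)) * 1)"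
    unfolding u_def[abs_def]
    by (intro form_mult form_power form_power_int form_Delta form_eta_ratio p m Delta_nonzero)
  moreover have "int 24 * int m + - (int p - 1) * 12 = 0" "real 24 * 0 + of_int (- (int p - 1)) * 1 = 1 - real p"
    "real 24 * (((real p)\<^sup>2 - 1) / (24 * real p)) + of_int (- (int p - 1)) * 1 = 1 - 1 / real p"
    "(\<lambda>d. legendre_char p d ^ 24 * 1 powi (- (int p - 1))) = (\<lambda>d. legendre_char p d ^ 24)"
  proof -
    show "int 24 * int m + - (int p - 1) * 12 = 0" using m by simp
    have "real p \<noteq> 0" using p by simp
    then show "real 24 * (((real p)\<^sup>2 - 1) / (24 * real p)) + of_int (- (int p - 1)) * 1 = 1 - 1 / real p"
      by (simp add: field_simps power2_eq_square)
  qed simp_all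
  ultimately have "form p 0 (\<lambda>d. legendre_char p d ^ 24) u (1 - real p) (1 - 1 / real p)"
    by (simp only:)
  moreover have "legendre_char p d ^ 24 = 1" if "\<not> int p dvd d" for d
    using that by (simp add: legendre_char_def Legendre_def cong_0_iff)
  ultimately have u: "form p 0 (\<lambda>d. 1) u (1 - real p) (1 - 1 / real p)"
    using form_cong_character[where \<phi> = "\<lambda>_. 1"] p by fastforce
  have unz: "u z \<noteq> 0" if "Im z > 0" for z
    using eta_ratio_nonzero[of p z] Delta_nonzero[OF that] that p by (simp add: u_def)
  have uhol: "u holomorphic_on upper_half_plane" using u by (simp add: form_def)
  have utr: "u (mob a b c d z) = aff c d z ^ 0 * u z"
    if "a * d - b * c = 1" "int p dvd c" "Im z > 0" for a b c d :: int and z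
    using u that by (simp add: form_def weight_on_def)
  obtain c c' where c: "c \<noteq> 0" "lead u (1 - real p) c" "c' \<noteq> 0" "lead (at_zero 0 u) (1 - 1 / real p) c'"
    using u by (auto simp: form_def)
  show "form p 2 (\<lambda>_. 1) (log_deriv u) 0 0"
    unfolding form_def
  proof (intro conjI)
    show "log_deriv u holomorphic_on upper_half_plane" using log_deriv_holomorphic[OF uhol unz] .
    show "weight_on p 2 (\<lambda>_. 1) (log_deriv u)"
      unfolding weight_on_def using log_deriv_mob[OF uhol unz _ utr] by simp
    show "\<exists>c. c \<noteq> 0 \<and> lead (log_deriv u) 0 c"
      using lead_log_deriv[OF uhol c(2,1)] p by (intro exI[of _ "2 * of_real pi * \<i> * of_real (1 - real p)"]) (auto simp: complex_eq_iff)
    have ahol: "at_zero 0 u holomorphic_on upper_half_plane"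
    proof -
      have "(u \<circ> (\<lambda>z. - 1 / z)) holomorphic_on upper_half_plane"
        by (intro holomorphic_on_compose_gen[OF _ uhol] holomorphic_intros) (auto simp: Im_divide sum_power2_gt_zero_iff)
      then show ?thesis by (simp add: at_zero_def[abs_def] o_def)
    qed
    have "log_deriv (at_zero 0 u) z = at_zero 2 (log_deriv u) z" if z: "Im z > 0" for z
    proof -
      have "Im (- 1 / z) > 0" using z by (simp add: Im_divide sum_power2_gt_zero_iff)
      moreover have "((\<lambda>z. - 1 / z) has_field_derivative 1 / z\<^sup>2) (at z)"
        using mob_has_derivative[of 0 0 "- 1" 1 z] z by simp
      ultimately have "((\<lambda>z. u (- 1 / z)) has_field_derivative deriv u (- 1 / z) * (1 / z\<^sup>2)) (at z)"
        using DERIV_chain2[OF has_deriv_upper_half_plane[OF uhol]] by blast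
      then have "deriv (\<lambda>z. u (- 1 / z)) z = deriv u (- 1 / z) * (1 / z\<^sup>2)" by (rule DERIV_imp_deriv)
      then show ?thesis by (simp add: log_deriv_def at_zero_def[abs_def] power_int_minus field_simps)
    qed
    moreover have "lead (log_deriv (at_zero 0 u)) 0 (2 * of_real pi * \<i> * of_real (1 - 1 / real p))"
      by (rule lead_log_deriv[OF ahol c(4,3)])
    ultimately have "lead (at_zero 2 (log_deriv u)) 0 (2 * of_real pi * \<i> * of_real (1 - 1 / real p))"
      using lead_cong[of "log_deriv (at_zero 0 u)" "at_zero 2 (log_deriv u)"] by simp
    moreover have "2 * of_real pi * \<i> * of_real (1 - 1 / real p) \<noteq> (0 :: complex)"
      using p by (auto simp: complex_eq_iff)
    ultimately show "\<exists>c. c \<noteq> 0 \<and> lead (at_zero 2 (log_deriv u)) 0 c" by blast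
  qed
qed

subsection \<open>Eta quotients\<close>

lemma sum_fun_apply: "(\<Sum>i\<in>I. F i) z = (\<Sum>i\<in>I. F i z)" for F :: "'i \<Rightarrow> complex \<Rightarrow> complex"
  by (induction I rule: infinite_finite_induct) auto

lemma independent_lead:
  fixes f :: "'i \<Rightarrow> complex \<Rightarrow> complex"
  assumes fin: "finite I" and inj: "inj_on m I" and l: "\<And>i. i \<in> I \<Longrightarrow> \<exists>c. c \<noteq> 0 \<and> lead (f i) (m i) c"
  shows "cfun.independent (f ` I)" and "card (f ` I) = card I"
proof -
  obtain c where c: "\<And>i. i \<in> I \<Longrightarrow> c i \<noteq> 0 \<and> lead (f i) (m i) (c i)" using l by metis
  have injf: "inj_on f I"
  proof (rule inj_onI)
    fix i j assume ij: "i \<in> I" "j \<in> I" "f i = f j"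
    have "m i \<le> m j" "m j \<le> m i"
      using lead_le[of "f i" "m i" "c i" "m j" "c j"] lead_le[of "f i" "m j" "c j" "m i" "c i"] c[OF ij(1)] c[OF ij(2)] ij(3) by auto
    then show "i = j" using inj ij by (simp add: inj_on_def)
  qed
  then show "card (f ` I) = card I" by (rule card_image)
  show "cfun.independent (f ` I)"
  proof
    assume "cfun.dependent (f ` I)"
    then obtain u where u: "\<exists>v\<in>f ` I. u v \<noteq> 0" "(\<Sum>v\<in>f ` I. cfun_scale (u v) v) = 0"
      using cfun.dependent_finite[of "f ` I"] fin by blast
    have "(\<Sum>i\<in>I. u (f i) * f i z) = 0" for z
    proof -
      have "(\<Sum>v\<in>f ` I. cfun_scale (u v) v) z = 0" unfolding u(2) by simp
      then show ?thesis using injf by (simp add: sum_fun_apply sum.reindex)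
    qed
    then have "\<forall>i\<in>I. u (f i) = 0"
      using lead_sum_zero[OF fin inj, of f c "\<lambda>i. u (f i)"] c by blast
    then show False using u(1) by auto
  qed
qed

lemma nome_power_int: "nome z powi n = nome (of_int n * z)"
proof (cases "n \<ge> 0")
  case True
  then show ?thesis by (simp add: power_int_def nome_power)
next
  case False
  then have "nome z powi n = inverse (nome (of_nat (nat (- n)) * z))" by (simp add: power_int_def nome_power power_inverse)
  then show ?thesis using False by (simp flip: nome_minus)
qed

lemma dedekind_eta_eq: "dedekind_eta z = nome (z / 24) * euler_prod z"
  by (simp add: dedekind_eta_def euler_prod_def qpoch_def nome_def)

text \<open>Coordinates adapted to the cusps: \<open>n\<close> is the order at infinity and
  \<open>r\<close> the exponent of eta(p z).\<close>

definition eta_form :: "nat \<Rightarrow> int \<Rightarrow> int \<Rightarrow> complex \<Rightarrow> complex" where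
  "eta_form p r n z = eta_ratio p z powi (- r) * Delta z powi n"

lemma eta_form_nonzero: "p > 0 \<Longrightarrow> Im z > 0 \<Longrightarrow> eta_form p r n z \<noteq> 0"
  using eta_ratio_nonzero[of p z] Delta_nonzero[of z] by (simp add: eta_form_def)

lemma form_eta_form:
  assumes p: "prime p" "p \<ge> 5" "p = 2 * m + 1"
  shows "form p (12 * n - int m * r) (\<lambda>d. legendre_char p d powi (- r)) (eta_form p r n)
    (of_int n) (of_int n - of_int r * ((real p)\<^sup>2 - 1) / (24 * real p))"
proof -
  have "form p (- r * int m + n * 12) (\<lambda>d. legendre_char p d powi (- r) * 1 powi n) (eta_form p r n)
     (of_int (- r) * 0 + of_int n * 1) (of_int (- r) * (((real p)\<^sup>2 - 1) / (24 * real p)) + of_int n * 1)"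
    unfolding eta_form_def[abs_def]
    by (intro form_mult form_power_int form_Delta form_eta_ratio p Delta_nonzero eta_ratio_nonzero) (use p in auto)
  moreover have "- r * int m + n * 12 = 12 * n - int m * r" "of_int (- r) * 0 + of_int n * 1 = real_of_int n"
    "(\<lambda>d. legendre_char p d powi (- r) * 1 powi n) = (\<lambda>d. legendre_char p d powi (- r))"
    "of_int (- r) * (((real p)\<^sup>2 - 1) / (24 * real p)) + of_int n * 1 = of_int n - of_int r * ((real p)\<^sup>2 - 1) / (24 * real p)"
    by simp_all
  ultimately show ?thesis by (simp only:)
qed

lemma eta_quotient_eq:
  assumes p: "p > 0" and r: "r1 + int p * r = 24 * n"
  shows "eta_quotient p r1 r = restrict_hp (eta_form p r n)"
proof
  fix z
  show "eta_quotient p r1 r z = restrict_hp (eta_form p r n) z"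
  proof (cases "Im z > 0")
    case True
    define w where "w = euler_prod z"
    define W where "W = euler_prod (of_nat p * z)"
    have w: "w \<noteq> 0" "W \<noteq> 0" using True p by (simp_all add: w_def W_def euler_prod_nonzero)
    have "dedekind_eta z powi r1 * dedekind_eta (of_nat p * z) powi r =
       (nome (z / 24) powi r1 * nome (of_nat p * z / 24) powi r) * (w powi r1 * W powi r)"
      by (simp add: dedekind_eta_eq power_int_mult_distrib w_def W_def mult_ac)
    also have "nome (z / 24) powi r1 * nome (of_nat p * z / 24) powi r = nome z powi n"
    proof -
      have "of_int r1 * (z / 24) + of_int r * (of_nat p * z / 24) = of_int (r1 + int p * r) * z / 24"
        by (simp add: algebra_simps add_divide_distrib)
      also have "\<dots> = of_int n * z" unfolding r by simp
      finally show ?thesis unfolding nome_power_int nome_add[symmetric] by (rule arg_cong)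
    qed
    also have "w powi r1 = w powi (24 * n) * w powi (int p * (- r))"
    proof -
      have "r1 = 24 * n + int p * (- r)" using r by simp
      moreover have "w powi (24 * n + int p * (- r)) = w powi (24 * n) * w powi (int p * (- r))"
        by (rule power_int_add) (use w in auto)
      ultimately show ?thesis by (simp only:)
    qed
    also have "nome z powi n * (w powi (24 * n) * w powi (int p * (- r)) * W powi r) =
       (w ^ p / W) powi (- r) * (nome z * w ^ 24) powi n"
      by (simp add: power_int_mult_distrib power_int_divide_distrib power_int_mult power_int_minus divide_inverse power_int_inverse)
    finally show ?thesis
      using True by (simp add: eta_quotient_def restrict_hp_def eta_form_def eta_ratio_def Delta_def w_def W_def)
  qed (simp add: eta_quotient_def restrict_hp_def)
qed

lemma eta_quotient_nonzero: "p > 0 \<Longrightarrow> Im z > 0 \<Longrightarrow> eta_quotient p r1 r z \<noteq> 0"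
  by (simp add: eta_quotient_def dedekind_eta_eq euler_prod_nonzero)

lemma eta_quotient_translate:
  assumes "Im z > 0"
  shows "eta_quotient p r1 r (z + 1) = nome ((of_int r1 + of_nat p * of_int r) / 24) * eta_quotient p r1 r z"
proof -
  have 1: "dedekind_eta (z + 1) = nome (1 / 24) * dedekind_eta z"
    by (simp add: dedekind_eta_eq euler_prod_plus_1 add_divide_distrib nome_add)
  have "nome (of_nat p * (z + 1)) = nome (of_nat p * z)"
    by (simp add: ring_distribs nome_add)
  then have 2: "dedekind_eta (of_nat p * (z + 1)) = nome (of_nat p / 24) * dedekind_eta (of_nat p * z)"
    by (simp add: dedekind_eta_eq euler_prod_def) (simp add: ring_distribs add_divide_distrib nome_add)
  have "nome ((of_int r1 + of_nat p * of_int r) / 24) = nome (1 / 24) powi r1 * nome (of_nat p / 24) powi r"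
    unfolding nome_power_int nome_add[symmetric] by (intro arg_cong[of _ _ nome]) (simp add: field_simps)
  then show ?thesis
    using assms unfolding eta_quotient_def 1 2 by (simp add: power_int_mult_distrib)
qed

lemma legendre_char_1: "[d = 1] (mod int p) \<Longrightarrow> p > 1 \<Longrightarrow> legendre_char p d = 1"
proof -
  assume d: "[d = 1] (mod int p)" "p > 1"
  then have "\<not> [d = 0] (mod int p)" by (auto simp: cong_def)
  moreover have "QuadRes (int p) d" unfolding QuadRes_def
    by (rule exI[of _ 1]) (use d in \<open>simp add: cong_sym\<close>)
  ultimately show ?thesis by (simp add: legendre_char_def Legendre_def)
qed

lemma eta_form_modular:
  assumes p: "prime p" "p \<ge> 5" "p = 2 * m + 1"
    and ord: "n \<ge> 0" "of_int r * ((real p)\<^sup>2 - 1) \<le> 24 * real p * of_int n"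
  shows "restrict_hp (eta_form p r n) \<in> modular_forms (12 * n - int m * r) (Gamma1 p)"
proof (rule form_modular(1)[OF p(1) form_eta_form[OF p]])
  show "0 \<le> of_int n - of_int r * ((real p)\<^sup>2 - 1) / (24 * real p)"
    using ord(2) p by (simp add: divide_simps) (simp add: mult_ac)
  show "legendre_char p (A $ 2 $ 2) powi (- r) = 1" if "A \<in> Gamma1 p" for A :: "int^2^2"
  proof -
    have "[A $ 2 $ 2 = 1] (mod int p)" using that by (simp add: Gamma1_def)
    then show ?thesis using legendre_char_1[of "A $ 2 $ 2" p] p by simp
  qed
qed (use ord Gamma1_subset in auto)

lemma power_int_base_gt_1_inject:
  fixes x :: real
  assumes "x > 1" "x powi k = x powi l" shows "k = l"
  using assms by (metis less_irrefl linorder_less_linear power_int_strict_increasing)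

lemma holomorphic_at_infinity_lead:
  assumes "holomorphic_at_infinity g" obtains c where "lead g 0 c"
proof -
  obtain w a where "w > 0" "q_expansion w a g" using assms by (auto simp: holomorphic_at_infinity_def)
  from q_expansion_tendsto[OF this] show thesis using that by (simp add: lead_0_iff)
qed

lemma lead_slash_S:
  "lead (slash k (matS) (restrict_hp f)) n c \<longleftrightarrow> lead (at_zero k f) n c"
  by (rule lead_cong) (simp add: restrict_hp_def slash_mat2 at_zero_def Im_divide sum_power2_gt_zero_iff)

lemma lead_restrict_hp: "lead (restrict_hp f) n c \<longleftrightarrow> lead f n c"
  by (rule lead_cong) (simp add: restrict_hp_def)

text \<open>Invariance under z -> z + 1 makes the exponent of q integral, so the quotient becomes an
  \<open>eta_form\<close> of known weight and orders; holomorphy at the two cusps makes the orders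
  nonnegative.\<close>

lemma eta_quotient_modular_imp:
  assumes p: "prime p" "p \<ge> 5" "p = 2 * m + 1"
    and f: "eta_quotient p r1 r \<in> modular_forms k (Gamma1 p)"
  obtains n where "r1 + int p * r = 24 * n" "k = 12 * n - int m * r" "n \<ge> 0"
    "of_int r * ((real p)\<^sup>2 - 1) \<le> 24 * real p * of_int n"
proof -
  have p0: "p > 0" using p by simp
  have inv: "\<And>A. A \<in> Gamma1 p \<Longrightarrow> slash k A (eta_quotient p r1 r) = eta_quotient p r1 r"
    and hi: "\<And>A. A \<in> SL2Z \<Longrightarrow> holomorphic_at_infinity (slash k A (eta_quotient p r1 r))"
    using f by (auto simp: modular_forms_def)
  have "mat2 1 1 0 1 \<in> Gamma1 p" by (simp add: Gamma1_def)
  from fun_cong[OF inv[OF this], of \<i>] have "eta_quotient p r1 r (\<i> + 1) = eta_quotient p r1 r \<i>"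
    by (simp add: slash_mat2)
  then have "nome ((of_int r1 + of_nat p * of_int r) / 24) = 1"
    using eta_quotient_translate[of \<i> p r1 r] eta_quotient_nonzero[OF p0, of \<i> r1 r] by simp
  then obtain n :: int where "(of_int r1 + of_nat p * of_int r) / 24 = (of_int n :: complex)"
    by (auto simp: nome_eq_1_iff Ints_def)
  then have "of_int (r1 + int p * r) = (of_int (24 * n) :: complex)" by simp
  then have n: "r1 + int p * r = 24 * n" by (simp only: of_int_eq_iff)
  note eq = eta_quotient_eq[OF p0 n]
  note fm = form_eta_form[OF p, of n r]
  define k' where "k' = 12 * n - int m * r"
  \<comment> \<open>One matrix and one point determine the weight: the automorphy factor p i + 1 has
    modulus greater than 1, so its powers are distinct.\<close>
  have "mat2 1 0 (int p) 1 \<in> Gamma1 p" by (simp add: Gamma1_def cong_0_iff)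
  from fun_cong[OF inv[OF this], of \<i>]
  have 1: "(of_nat p * \<i> + 1) powi (- k) * eta_quotient p r1 r (\<i> / (of_nat p * \<i> + 1)) = eta_quotient p r1 r \<i>"
    by (simp add: slash_mat2)
  have "eta_quotient p r1 r (\<i> / (of_nat p * \<i> + 1)) = (of_nat p * \<i> + 1) powi k' * eta_quotient p r1 r \<i>"
  proof -
    have "Im (\<i> / (of_nat p * \<i> + 1)) > 0" using Im_mob_pos[of 1 1 0 "int p" \<i>] by simp
    moreover have "eta_form p r n ((of_int 1 * \<i> + of_int 0) / (of_int (int p) * \<i> + of_int 1)) =
       legendre_char p 1 powi (- r) * (of_int (int p) * \<i> + of_int 1) powi k' * eta_form p r n \<i>"
      using fm[unfolded form_def weight_on_def, THEN conjunct2, THEN conjunct1, rule_format, of 1 1 0 "int p" \<i>]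
      by (simp add: k'_def)
    moreover have "legendre_char p 1 = 1" by (rule legendre_char_1) (use p in auto)
    ultimately show ?thesis by (simp add: eq restrict_hp_def)
  qed
  with 1 have "(of_nat p * \<i> + 1) powi (- k) * (of_nat p * \<i> + 1) powi k' = 1"
    using eta_quotient_nonzero[OF p0, of \<i> r1 r] by simp
  moreover have nz: "of_nat p * \<i> + 1 \<noteq> 0" by (simp add: complex_eq_iff)
  ultimately have "(of_nat p * \<i> + 1) powi k = (of_nat p * \<i> + 1) powi k'"
    by (simp add: power_int_minus field_simps)
  then have "norm (of_nat p * \<i> + 1) powi k = norm (of_nat p * \<i> + 1) powi k'"
    by (metis norm_power_int)
  moreover have "norm (of_nat p * \<i> + 1) > 1"
    using p0 by (simp add: cmod_def)
  ultimately have k: "k = k'" using power_int_base_gt_1_inject by blast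
  obtain c c' where c: "c \<noteq> 0" "lead (eta_form p r n) (of_int n) c"
    "c' \<noteq> 0" "lead (at_zero k' (eta_form p r n)) (of_int n - of_int r * ((real p)\<^sup>2 - 1) / (24 * real p)) c'"
    using fm by (auto simp: form_def k'_def)
  have "slash k (mat2 1 0 0 1) (eta_quotient p r1 r) = eta_quotient p r1 r"
    by (rule inv) (simp add: Gamma1_def)
  then have "holomorphic_at_infinity (eta_quotient p r1 r)" using hi[of "mat2 1 0 0 1"] by simp
  then obtain x where "lead (eta_form p r n) 0 x"
    using holomorphic_at_infinity_lead unfolding eq by (metis lead_restrict_hp)
  then have n0: "0 \<le> real_of_int n" using lead_le[OF c(2,1)] by blast
  have "holomorphic_at_infinity (slash k (matS) (eta_quotient p r1 r))" by (rule hi) simp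
  then obtain x where "lead (at_zero k' (eta_form p r n)) 0 x"
    using holomorphic_at_infinity_lead unfolding eq k by (metis lead_slash_S)
  then have "0 \<le> of_int n - of_int r * ((real p)\<^sup>2 - 1) / (24 * real p)" using lead_le[OF c(4,3)] by blast
  then have "of_int r * ((real p)\<^sup>2 - 1) \<le> 24 * real p * of_int n"
    using p0 by (simp add: divide_simps) (simp add: mult_ac)
  with that[OF n _ _ this] show thesis using k n0 by (simp add: k'_def)
qed

text \<open>The first two conditions are holomorphy at infinity and at 0; the third says that k = 12
  n - r (p - 1)/2 has an integral solution r.\<close>

definition eta_orders :: "int \<Rightarrow> nat \<Rightarrow> int set" where
  "eta_orders k p = {n. 0 \<le> n \<and> 12 * n \<le> k * (int p + 1) \<and> (int p - 1) div 2 dvd 12 * n - k}"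

text \<open>Here r is eliminated through m r = 12 n - k, using p^2 - 1 = 4 m (m + 1).\<close>

lemma eta_order_bound_iff:
  assumes p: "p \<ge> 5" "p = 2 * m + 1" and k: "k = 12 * n - int m * r"
  shows "of_int r * ((real p)\<^sup>2 - 1) \<le> 24 * real p * of_int n \<longleftrightarrow> 12 * n \<le> k * (int p + 1)"
proof -
  have m: "real m > 0" using p by simp
  have "of_int r * ((real p)\<^sup>2 - 1) = 4 * (real m * of_int r) * (real m + 1)"
    using p(2) by (simp add: power2_eq_square algebra_simps)
  also have "real m * of_int r = 12 * of_int n - of_int k" unfolding k by simp
  finally have 1: "of_int r * ((real p)\<^sup>2 - 1) = 4 * (12 * of_int n - of_int k) * (real m + 1)" .
  have "of_int r * ((real p)\<^sup>2 - 1) \<le> 24 * real p * of_int n \<longleftrightarrow>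
      4 * (12 * of_int n - of_int k) * (real m + 1) \<le> 24 * (2 * real m + 1) * of_int n"
  proof -
    have "real p = 2 * real m + 1" using p(2) by simp
    then show ?thesis unfolding 1 by (simp only:)
  qed
  also have "\<dots> \<longleftrightarrow> 12 * of_int n \<le> of_int k * (real p + 1)"
    using p(2) by (auto simp: algebra_simps)
  also have "\<dots> \<longleftrightarrow> real_of_int (12 * n) \<le> real_of_int (k * (int p + 1))" by simp
  finally show ?thesis by (simp only: of_int_le_iff)
qed

text \<open>Weight and order at infinity determine r, so different eta-quotients have different
  orders and are independent.\<close>

lemma dim_eta_space:
  assumes p: "prime p" "p \<ge> 5"
  shows "cfun.dim (eta_space k p) = card (eta_orders k p)"
proof -
  obtain m where m: "p = 2 * m + 1" by (rule prime_ge_5_odd[OF p])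
  have m': "(int p - 1) div 2 = int m" "m > 0" using m p by auto
  define r where "r n = (12 * n - k) div int m" for n
  define F where "F n = restrict_hp (eta_form p (r n) n)" for n
  have r: "k = 12 * n - int m * r n" if "n \<in> eta_orders k p" for n
    using that m' by (simp add: eta_orders_def r_def)
  have "{f \<in> modular_forms k (Gamma1 p). \<exists>r1 rp. f = eta_quotient p r1 rp} = F ` eta_orders k p"
  proof (intro equalityI subsetI)
    fix f assume "f \<in> {f \<in> modular_forms k (Gamma1 p). \<exists>r1 rp. f = eta_quotient p r1 rp}"
    then obtain r1 s where f: "f = eta_quotient p r1 s" "eta_quotient p r1 s \<in> modular_forms k (Gamma1 p)" by blast
    obtain n where n: "r1 + int p * s = 24 * n" "k = 12 * n - int m * s" "n \<ge> 0"
      "of_int s * ((real p)\<^sup>2 - 1) \<le> 24 * real p * of_int n"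
      using eta_quotient_modular_imp[OF p m f(2)] .
    have "n \<in> eta_orders k p"
      using n eta_order_bound_iff[OF p(2) m n(2)] m' by (simp add: eta_orders_def)
    moreover have "r n = s" using n(2) m' by (simp add: r_def)
    then have "f = F n" using f(1) eta_quotient_eq[OF _ n(1)] p by (simp add: F_def)
    ultimately show "f \<in> F ` eta_orders k p" by blast
  next
    fix f assume "f \<in> F ` eta_orders k p"
    then obtain n where n: "n \<in> eta_orders k p" "f = F n" by blast
    have "of_int (r n) * ((real p)\<^sup>2 - 1) \<le> 24 * real p * of_int n"
      using eta_order_bound_iff[OF p(2) m r[OF n(1)]] n(1) by (simp add: eta_orders_def)
    then have "F n \<in> modular_forms k (Gamma1 p)"
      using eta_form_modular[OF p m, of n "r n"] n(1) r[OF n(1)] by (simp add: F_def eta_orders_def)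
    moreover have "F n = eta_quotient p (24 * n - int p * r n) (r n)"
      using eta_quotient_eq[of p "24 * n - int p * r n" "r n" n] p by (simp add: F_def)
    ultimately show "f \<in> {f \<in> modular_forms k (Gamma1 p). \<exists>r1 rp. f = eta_quotient p r1 rp}"
      using n(2) by blast
  qed
  then have es: "eta_space k p = cfun.span (F ` eta_orders k p)" by (simp add: eta_space_def)
  have "eta_orders k p \<subseteq> {0..k * (int p + 1)}" by (auto simp: eta_orders_def)
  then have fin: "finite (eta_orders k p)" using finite_subset by blast
  have "\<exists>c. c \<noteq> 0 \<and> lead (F n) (real_of_int n) c" for n
    using form_eta_form[OF p m, of n "r n"] unfolding form_def F_def lead_restrict_hp by blast
  then show ?thesis
    unfolding es using independent_lead[OF fin, of real_of_int F] by (simp add: cfun.dim_eq_card_independent inj_on_def)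
qed

subsection \<open>Dimension of the spaces of cusp forms\<close>

text \<open>The finite spanning set \<open>W\<close> rules out the default value 0 of
  \<open>cfun.dim\<close> on infinite-dimensional spaces.\<close>

lemma card_le_dim:
  assumes "cfun.independent B" "B \<subseteq> V" "V \<subseteq> cfun.span W" "finite W"
  shows "card B \<le> cfun.dim V"
proof -
  obtain Bs where Bs: "Bs \<subseteq> V" "cfun.independent Bs" "V \<subseteq> cfun.span Bs" "card Bs = cfun.dim V"
    using cfun.basis_exists[of V] .
  have "finite Bs" using cfun.independent_span_bound[OF assms(4) Bs(2)] Bs(1) assms(3) by blast
  then show ?thesis
    using cfun.independent_span_bound[OF _ assms(1), of Bs] assms(2) Bs by auto
qed

text \<open>The exponents are determined by the order \<open>v\<close> at \<open>\<infinity>\<close> and the weight \<open>12 N\<close> up to that of \<open>G\<close>. Taking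
  the exponent of \<open>E\<^sub>4\<^sup>3\<close> to be a remainder modulo \<open>p - 1\<close> leaves an exponent of \<open>E\<close> divisible by \<open>24\<close>,
  so that the character is that of \<open>G\<close>.\<close>

definition cusp_family :: "nat \<Rightarrow> int \<Rightarrow> (complex \<Rightarrow> complex) \<Rightarrow> int \<Rightarrow> complex \<Rightarrow> complex" where
  "cusp_family p N G v = (\<lambda>z. G z * (eisenstein4 z ^ nat (3 * ((N - v) mod (int p - 1))) *
     eta_form p (24 * (- ((N - v) div (int p - 1)))) v z))"

text \<open>For \<open>i\<close> the remainder of N - v modulo p - 1, the order at 0 is positive as
  soon as v < (p + 1) (N - i). Since i < p - 1, the bound with p in place of i ensures this
  uniformly.\<close>

lemma form_cusp_family:
  assumes p: "prime p" "p \<ge> 5" and G: "form p k0 \<psi> G 0 m0" "m0 \<ge> 0"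
    and v: "v \<le> (int p + 1) * (N - int p)" "N \<ge> 0"
  obtains n where "n > 0" "form p (k0 + 12 * N) \<psi> (cusp_family p N G v) (of_int v) n"
proof -
  obtain m where m: "p = 2 * m + 1" by (rule prime_ge_5_odd[OF p])
  define i where "i = (N - v) mod (int p - 1)"
  define y where "y = - ((N - v) div (int p - 1))"
  have i: "0 \<le> i" "i < int p - 1" using p by (simp_all add: i_def)
  have vi: "v = N - i + (int p - 1) * y"
    using mult_div_mod_eq[of "int p - 1" "N - v"] by (simp add: i_def y_def algebra_simps)
  let ?n = "m0 + (0 + (of_int v - of_int (24 * y) * ((real p)\<^sup>2 - 1) / (24 * real p)))"
  have "form p (k0 + (int (nat (3 * i)) * 4 + (12 * v - int m * (24 * y))))
     (\<lambda>d. \<psi> d * (1 ^ nat (3 * i) * legendre_char p d powi (- (24 * y))))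
     (cusp_family p N G v) (0 + (real (nat (3 * i)) * 0 + of_int v))
     (m0 + (real (nat (3 * i)) * 0 + (of_int v - of_int (24 * y) * ((real p)\<^sup>2 - 1) / (24 * real p))))"
    unfolding cusp_family_def i_def[symmetric] y_def[symmetric]
    by (intro form_mult form_power form_eisenstein4 form_eta_form G p m)
  moreover have "int (nat (3 * i)) * 4 + (12 * v - int m * (24 * y)) = 12 * N"
    using i(1) m by (simp add: vi algebra_simps)
  ultimately have f: "form p (k0 + 12 * N) (\<lambda>d. \<psi> d * legendre_char p d powi (- (24 * y)))
     (cusp_family p N G v) (of_int v) ?n" by simp
  have "legendre_char p d powi (- (24 * y)) = 1" if "\<not> int p dvd d" for d
  proof -
    have "legendre_char p d = 1 \<or> legendre_char p d = - 1"
      using that by (auto simp: legendre_char_def Legendre_def cong_0_iff)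
    then show ?thesis by (auto simp: power_int_minus_left)
  qed
  then have f': "form p (k0 + 12 * N) \<psi> (cusp_family p N G v) (of_int v) ?n"
    using form_cong_character[OF f, of \<psi>] p by simp
  have "of_int (24 * y) * ((real p)\<^sup>2 - 1) / (24 * real p) = of_int ((int p - 1) * y) * (real p + 1) / real p"
    using p by (simp add: field_simps power2_eq_square)
  also have "(int p - 1) * y = v - N + i" using vi by simp
  finally have "?n = m0 + (of_int v - of_int (v - N + i) * (real p + 1) / real p)" by simp
  moreover have "of_int (v - N + i) * (real p + 1) < of_int v * real p"
  proof -
    have "v < (int p + 1) * (N - i)"
    proof -
      have "(int p + 1) * (N - int p) < (int p + 1) * (N - i)" using i by simp
      then show ?thesis using v by linarith
    qed
    then have "(v - N + i) * (int p + 1) < v * int p" by (simp add: algebra_simps)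
    then have "real_of_int ((v - N + i) * (int p + 1)) < real_of_int (v * int p)" by (simp only: of_int_less_iff)
    then show ?thesis by simp
  qed
  then have "of_int (v - N + i) * (real p + 1) / real p < of_int v"
    using p by (simp add: divide_less_eq)
  ultimately have "?n > 0" using G(2) by linarith
  with f' that show thesis by blast
qed

lemma cusp_dim_lower_bound:
  fixes V :: "(complex \<Rightarrow> complex) set"
  assumes p: "prime p" "p \<ge> 5" and G: "form p k0 \<psi> G 0 m0" "m0 \<ge> 0" and N: "N \<ge> 0" "k = k0 + 12 * N"
    and V: "\<And>f a b. form p k \<psi> f a b \<Longrightarrow> a > 0 \<Longrightarrow> b > 0 \<Longrightarrow> restrict_hp f \<in> V"
    and W: "V \<subseteq> cfun.span W" "finite W"
  shows "(int p + 1) * (N - int p) \<le> int (cfun.dim V)"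
proof -
  define I where "I = {1..(int p + 1) * (N - int p)}"
  define F where "F v = restrict_hp (cusp_family p N G v)" for v
  have form: "\<exists>n>0. form p k \<psi> (cusp_family p N G v) (of_int v) n" if "v \<in> I" for v
    using form_cusp_family[OF p G _ N(1), of v] that unfolding I_def N(2) by (metis atLeastAtMost_iff)
  have "F ` I \<subseteq> V"
    unfolding F_def using form V by (fastforce simp: I_def)
  moreover have "\<exists>c. c \<noteq> 0 \<and> lead (F v) (real_of_int v) c" if "v \<in> I" for v
    using form[OF that] unfolding form_def F_def lead_restrict_hp by blast
  then have "cfun.independent (F ` I)" "card (F ` I) = card I"
    using independent_lead[of I real_of_int F] by (simp_all add: I_def inj_on_def)
  ultimately have "card I \<le> cfun.dim V" using card_le_dim[OF _ _ W] by metis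
  then show ?thesis by (simp add: I_def)
qed

section \<open>The upper bound: reduction theory and the maximum principle\<close>

lemma SL2_reduction:
  assumes z: "Im z > 0"
  obtains a b c d :: int where "a * d - b * c = 1"
    "\<bar>Re (mob a b c d z)\<bar> \<le> 1 / 2"
    "Im (mob a b c d z) \<ge> 1 / 2"
proof -
  define nr where "nr = (\<lambda>(c, d). norm (aff c d z) :: real)"
  \<comment> \<open>Bottom rows with |c z + d| <= 1: they are finite in number and include (0, 1),
    and minimising |c z + d| maximises the imaginary part of the image.\<close>
  define S where "S = {(c :: int, d :: int). nr (c, d) \<le> 1 \<and> (\<exists>a b. a * d - b * c = 1)}"
  have "S \<subseteq> {(- \<lceil>1 / Im z\<rceil>)..\<lceil>1 / Im z\<rceil>} \<times> {(- \<lceil>1 + norm z / Im z\<rceil>)..\<lceil>1 + norm z / Im z\<rceil>}"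
  proof (clarsimp simp: S_def nr_def)
    fix a b c d :: int
    assume le: "norm (aff c d z) \<le> 1"
    have "\<bar>Im (aff c d z)\<bar> \<le> 1" using le abs_Im_le_cmod order_trans by blast
    then have "\<bar>of_int c\<bar> * Im z \<le> 1" using z by (simp add: abs_mult)
    then have c: "\<bar>real_of_int c\<bar> \<le> 1 / Im z" using z by (simp add: field_simps)
    have "\<bar>real_of_int d\<bar> = norm (of_int d :: complex)" by simp
    also have "\<dots> = norm ((aff c d z) - of_int c * z)" by simp
    also have "\<dots> \<le> norm (aff c d z) + norm (of_int c * z)" by (rule norm_triangle_ineq4)
    also have "\<dots> \<le> 1 + \<bar>real_of_int c\<bar> * norm z" using le by (simp add: norm_mult)
    also have "\<dots> \<le> 1 + norm z / Im z" using mult_right_mono[OF c norm_ge_zero[of z]] by simp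
    finally have d: "\<bar>real_of_int d\<bar> \<le> 1 + norm z / Im z" .
    show "- \<lceil>1 / Im z\<rceil> \<le> c \<and> c \<le> \<lceil>1 / Im z\<rceil> \<and> - \<lceil>1 + norm z / Im z\<rceil> \<le> d \<and> d \<le> \<lceil>1 + norm z / Im z\<rceil>"
      using c d by linarith
  qed
  then have fin: "finite S" by (rule finite_subset) simp
  have "(0, 1) \<in> S" by (auto simp: S_def nr_def intro!: exI[of _ 1])
  then obtain s where s: "s \<in> S" "\<And>x. x \<in> S \<Longrightarrow> nr s \<le> nr x"
    using arg_min_if_finite[of S nr] fin by (metis emptyE not_le)
  obtain c d where sd: "s = (c, d)" by (cases s)
  obtain a b where det: "a * d - b * c = 1" using s(1) sd by (auto simp: S_def)
  define w where "w = mob a b c d z"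
  define n where "n = round (Re w)"
  define v where "v = mob (a - n * c) (b - n * d) c d z"
  have nz: "aff c d z \<noteq> 0" using aff_nonzero[OF det z] .
  have det': "(a - n * c) * d - (b - n * d) * c = 1" using det by (simp add: algebra_simps)
  have "v = w - of_int n" using nz by (simp add: v_def w_def field_simps)
  then have Re: "\<bar>Re v\<bar> \<le> 1 / 2" using of_int_round_abs_le[of "Re w"] by (simp add: n_def abs_minus_commute)
  have Im: "Im v > 0" unfolding v_def by (rule Im_mob_pos[OF det' z])
  have "norm v \<ge> 1"
  proof (rule ccontr)
    assume "\<not> norm v \<ge> 1"
    then have v: "norm v < 1" by simp
    have "aff (a - n * c) (b - n * d) z = v * aff c d z"
      using nz by (simp add: v_def)
    then have eq: "nr (a - n * c, b - n * d) = norm v * nr s" by (simp add: nr_def sd norm_mult)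
    have "nr s > 0" using nz by (simp add: nr_def sd)
    then have lt: "nr (a - n * c, b - n * d) < nr s" using v by (simp add: eq)
    moreover have "nr s \<le> 1" using s(1) sd by (simp add: S_def)
    \<comment> \<open>With top row (- c, - d), this row is the bottom row of S times the translated
      matrix, so it competes in the minimum.\<close>
    moreover have "(- c) * (b - n * d) - (- d) * (a - n * c) = 1" using det' by (simp add: algebra_simps)
    then have "\<exists>a' b'. a' * (b - n * d) - b' * (a - n * c) = 1" by blast
    ultimately have "(a - n * c, b - n * d) \<in> S" by (simp add: S_def)
    from s(2)[OF this] lt show False by simp
  qed
  then have "1 \<le> (Re v)\<^sup>2 + (Im v)\<^sup>2" using power_mono[of 1 "norm v" 2] by (simp add: cmod_power2)
  moreover have "(Re v)\<^sup>2 \<le> (1/2)\<^sup>2" using Re by (simp only: power2_le_iff_abs_le)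
  \<comment> \<open>A crude form of the usual bound sqrt 3 / 2; any positive lower bound keeps the
    truncated region compact.\<close>
  ultimately have "(1/2)\<^sup>2 \<le> (Im v)\<^sup>2" by (simp add: power2_eq_square)
  then have "1 / 2 \<le> Im v" using Im power2_le_imp_le[of "1 / 2" "Im v"] by simp
  with Re det' that show thesis by (simp add: v_def)
qed

text \<open>The shift j is reduced modulo p so that finitely many representatives, hence a compact
  set, account for all values of |h|.\<close>

lemma norm_mob_coset:
  fixes a b c d :: int
  assumes p: "prime p"
    and inv: "\<And>a b c d z. a * d - b * c = 1 \<Longrightarrow> int p dvd c \<Longrightarrow> Im z > 0 \<Longrightarrow>
      norm (h (mob a b c d z)) = norm (h z :: complex)"
    and det: "a * d - b * c = 1" and w: "Im w > 0"
  shows "norm (h (mob a b c d w)) = norm (h w) \<or>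
    (\<exists>j\<in>{0..<int p}. norm (h (mob a b c d w)) = norm (h (- 1 / (w + of_int j))))"
proof (cases "int p dvd c")
  case False
  moreover have "prime (int p)" using p by simp
  ultimately have "coprime c (int p)" using prime_imp_coprime coprime_commute by blast
  then obtain x where x: "[c * x = 1] (mod int p)" using cong_solve_coprime_int by blast
  define j where "j = (d * x) mod int p"
  have "[c * (d * x) - d = 0] (mod int p)"
    using cong_diff[OF cong_mult[OF cong_refl[of d] x] cong_refl[of d]] by (simp add: mult_ac)
  moreover have "[c * j - d = c * (d * x) - d] (mod int p)"
    unfolding j_def by (intro cong_diff cong_mult cong_refl) (simp add: cong_def)
  ultimately have dvd: "int p dvd c * j - d" using cong_trans cong_0_iff by blast
  have j: "j \<in> {0..<int p}" using p by (simp add: j_def prime_gt_0_nat)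
  have det': "(a * j - b) * c - a * (c * j - d) = 1" using det by (simp add: algebra_simps)
  have wj: "w + of_int j \<noteq> 0" using w by (auto simp: complex_eq_iff)
  have "Im (- 1 / (w + of_int j)) > 0" using w by (simp add: Im_divide sum_power2_gt_zero_iff)
  from inv[OF det' dvd this]
  have "norm (h ((of_int (a * j - b) * (- 1 / (w + of_int j)) + of_int a) / (of_int (c * j - d) * (- 1 / (w + of_int j)) + of_int c)))
    = norm (h (- 1 / (w + of_int j)))" .
  moreover have "(of_int (a * j - b) * (- 1 / (w + of_int j)) + of_int a) = aff a b w / (w + of_int j)"
    "(of_int (c * j - d) * (- 1 / (w + of_int j)) + of_int c) = aff c d w / (w + of_int j)"
  proof -
    have aux: "A * (- 1 / y) + B = (B * y - A) / y" if "y \<noteq> 0" for A B y :: complex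
      using that by (simp add: field_simps)
    show "(of_int (a * j - b) * (- 1 / (w + of_int j)) + of_int a) = aff a b w / (w + of_int j)"
      "(of_int (c * j - d) * (- 1 / (w + of_int j)) + of_int c) = aff c d w / (w + of_int j)"
      unfolding aux[OF wj] by (simp_all add: algebra_simps)
  qed
  ultimately have "norm (h (mob a b c d w)) = norm (h (- 1 / (w + of_int j)))"
    using wj by simp
  then show ?thesis using j by blast
next
  case True
  from inv[OF det True w] show ?thesis ..
qed

text \<open>Invariance is asked of the modulus, which absorbs any unitary character. Every value of
  |h| is either below |h z|, near a cusp, or attained on a compact set, so |h| has a maximum; h is
  then constant and equal to its limit 0.\<close>

lemma Gamma0_invariant_vanishes:
  assumes p: "prime p" and h: "h holomorphic_on upper_half_plane"
    and inv: "\<And>a b c d z. a * d - b * c = 1 \<Longrightarrow> int p dvd c \<Longrightarrow> Im z > 0 \<Longrightarrow>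
      norm (h (mob a b c d z)) = norm (h z)"
    and lim: "(h \<longlongrightarrow> 0) at_inf" "((\<lambda>z. h (- 1 / z)) \<longlongrightarrow> 0) at_inf" and z: "Im z > 0"
  shows "h z = 0"
proof (rule ccontr)
  assume "h z \<noteq> 0"
  then have pos: "norm (h z) > 0" by simp
  from tendstoD[OF lim(1) pos] obtain Y1 where Y1: "\<And>w. Im w > Y1 \<Longrightarrow> norm (h w) < norm (h z)"
    by (auto simp: eventually_at_inf)
  from tendstoD[OF lim(2) pos] obtain Y2 where Y2: "\<And>w. Im w > Y2 \<Longrightarrow> norm (h (- 1 / w)) < norm (h z)"
    by (auto simp: eventually_at_inf)
  define Y where "Y = max Y1 Y2"
  define K where "K = cbox (Complex (- 1 / 2) (1 / 2)) (Complex (1 / 2) Y)"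
  have K: "w \<in> K \<longleftrightarrow> \<bar>Re w\<bar> \<le> 1 / 2 \<and> 1 / 2 \<le> Im w \<and> Im w \<le> Y" for w
    by (auto simp: K_def in_cbox_complex_iff abs_le_iff)
  \<comment> \<open>\<open>K\<close> contains the part below height \<open>Y\<close> of the standard
    fundamental domain; its images under S T^j account for the other cosets of Gamma_0(p).\<close>
  define Z where "Z = K \<union> (\<Union>j\<in>{0..<int p}. (\<lambda>w. - 1 / (w + of_int j)) ` K)"
  have wj: "w + of_int j \<noteq> 0" if "w \<in> K" for w and j :: int using that by (auto simp: K complex_eq_iff)
  have "compact Z"
    unfolding Z_def using wj
    by (intro compact_Un compact_UN compact_continuous_image continuous_intros) (auto simp: K_def)
  have ZH: "Z \<subseteq> upper_half_plane"
    unfolding Z_def by (auto simp: K Im_divide sum_power2_gt_zero_iff)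
  have "continuous_on Z (\<lambda>w. norm (h w))"
    using h ZH by (intro continuous_on_norm holomorphic_on_imp_continuous_on) (rule holomorphic_on_subset)
  have red: "norm (h x) < norm (h z) \<or> (\<exists>y\<in>Z. norm (h x) = norm (h y))" if x: "Im x > 0" for x
  proof -
    obtain a b c d :: int where det: "a * d - b * c = 1"
      and fd: "\<bar>Re (mob a b c d x)\<bar> \<le> 1 / 2"
        "Im (mob a b c d x) \<ge> 1 / 2"
      by (rule SL2_reduction[OF x])
    define w where "w = mob a b c d x"
    have wH: "Im w > 0" using fd(2) by (simp add: w_def)
    have det': "d * a - (- b) * (- c) = 1" using det by (simp add: mult.commute)
    have nz: "aff c d x \<noteq> 0" using aff_nonzero[OF det x] .
    have xeq: "x = mob d (- b) (- c) a w"
    proof -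
      define N where "N = aff a b x"
      define J where "J = aff c d x"
      have "of_int (a * d - b * c) = (1 :: complex)" unfolding det by simp
      then have one: "of_int a * of_int d - of_int b * of_int c = (1 :: complex)" by simp
      have "of_int d * N - of_int b * J = (of_int a * of_int d - of_int b * of_int c) * x"
        "of_int a * J - of_int c * N = of_int a * of_int d - of_int b * of_int c"
        by (simp_all add: N_def J_def algebra_simps)
      then have 1: "of_int d * N - of_int b * J = x" "of_int a * J - of_int c * N = 1" unfolding one by simp_all
      have w: "w = N / J" "J \<noteq> 0" using nz by (simp_all add: w_def N_def J_def)
      have "aff d (- b) w = (of_int d * N - of_int b * J) / J"
        "aff (- c) a w = (of_int a * J - of_int c * N) / J"
        using w(2) by (simp_all add: w(1) field_simps)
      then show ?thesis unfolding 1 using w(2) by simp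
    qed
    have "norm (h (mob d (- b) (- c) a w)) = norm (h w) \<or>
      (\<exists>j\<in>{0..<int p}. norm (h (mob d (- b) (- c) a w)) = norm (h (- 1 / (w + of_int j))))"
      by (rule norm_mob_coset[OF p _ det' wH]) (rule inv)
    then have alt: "norm (h x) = norm (h w) \<or> (\<exists>j\<in>{0..<int p}. norm (h x) = norm (h (- 1 / (w + of_int j))))"
      unfolding xeq[symmetric] .
    show ?thesis
    proof (cases "w \<in> K")
      case True
      then show ?thesis using alt unfolding Z_def by blast
    next
      case False
      then have "Im w > Y" using fd by (simp add: K w_def[symmetric])
      then have "norm (h w) < norm (h z)" "norm (h (- 1 / (w + of_int j))) < norm (h z)" for j :: int
        using Y1[of w] Y2[of "w + of_int j"] by (simp_all add: Y_def)
      then show ?thesis using alt by auto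
    qed
  qed
  \<comment> \<open>The first alternative fails for z itself, so the maximum over \<open>Z\<close>
    is at least |h z| and hence bounds |h| on the whole upper half plane.\<close>
  then obtain y0 where "y0 \<in> Z" "norm (h z) = norm (h y0)" using z by blast
  then obtain u where u: "u \<in> Z" "\<And>y. y \<in> Z \<Longrightarrow> norm (h y) \<le> norm (h u)"
    using continuous_attains_sup[OF \<open>compact Z\<close> _ \<open>continuous_on Z (\<lambda>w. norm (h w))\<close>] by blast
  have max: "norm (h x) \<le> norm (h u)" if "Im x > 0" for x
    using red[OF that] u(2) u(2)[OF \<open>y0 \<in> Z\<close>] \<open>norm (h z) = norm (h y0)\<close> by fastforce
  have "h constant_on upper_half_plane"
    using maximum_modulus_principle[OF h open_upper_half_plane connected_upper_half_plane open_upper_half_plane order_refl, of u]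
      max u(1) ZH by auto
  then obtain x where x: "\<And>w. Im w > 0 \<Longrightarrow> h w = x" by (auto simp: constant_on_def)
  have "eventually (\<lambda>w. h w = x) at_inf" using eventually_at_inf_gt[of 0] by eventually_elim (rule x)
  then have "(h \<longlongrightarrow> x) at_inf" by (rule tendsto_eventually)
  then have "x = 0" using lim(1) tendsto_unique[OF at_inf_neq_bot] by blast
  then show False using x[OF z] \<open>h z \<noteq> 0\<close> by simp
qed

text \<open>A common setting for both spaces of cusp forms, so that one argument bounds both
  dimensions; the cusp condition is reduced to limits at infinity and 0.\<close>

definition cuspidal_space :: "nat \<Rightarrow> int \<Rightarrow> (int \<Rightarrow> complex) \<Rightarrow> (complex \<Rightarrow> complex) set" where
  "cuspidal_space p k \<psi> = {f. f holomorphic_on upper_half_plane \<and> (\<forall>z. Im z \<le> 0 \<longrightarrow> f z = 0) \<and>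
     (\<forall>A\<in>Gamma0 p. slash k A f = (\<lambda>z. \<psi> (A $ 2 $ 2) * f z)) \<and>
     (f \<longlongrightarrow> 0) at_inf \<and> (slash k (matS) f \<longlongrightarrow> 0) at_inf}"

lemma slash_add: "slash k A (\<lambda>z. f z + g z) = (\<lambda>z. slash k A f z + slash k A g z)"
  by (auto simp: slash_def algebra_simps)

lemma cuspidal_space_lincomb:
  assumes "f \<in> cuspidal_space p k \<psi>" "g \<in> cuspidal_space p k \<psi>"
  shows "(\<lambda>z. f z + x * g z) \<in> cuspidal_space p k \<psi>"
  using assms unfolding cuspidal_space_def
  by (auto simp: slash_add slash_const_mult algebra_simps intro!: holomorphic_intros tendsto_add_zero tendsto_mult_right_zero)

lemma cuspidal_space_translate:
  assumes "f \<in> cuspidal_space p k \<psi>" "\<psi> 1 = 1"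
  shows "f (z + 1) = f z"
proof (cases "Im z > 0")
  case True
  have "mat2 1 1 0 1 \<in> Gamma0 p" by (simp add: Gamma0_def)
  with assms have "slash k (mat2 1 1 0 1) f = (\<lambda>z. 1 * f z)" by (fastforce simp: cuspidal_space_def)
  from fun_cong[OF this, of z] True show ?thesis by (simp add: slash_mat2)
qed (use assms in \<open>simp add: cuspidal_space_def\<close>)

text \<open>The power 24 m makes the exponents integral. Then \<open>r\<close> and \<open>n\<close>
  are determined by cancelling the weight of f^(24 m) and having order 0 at the cusp 0. The
  resulting order 24 m M + n = (p - 1) (12 M - k (p + 1)) at infinity is positive.\<close>

lemma cuspidal_space_high_order:
  assumes p: "prime p" "p \<ge> 5" and norm: "\<And>d. \<not> int p dvd d \<Longrightarrow> norm (\<psi> d) = 1"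
    and f: "f \<in> cuspidal_space p k \<psi>" and l: "lead f M c" "12 * M > of_int k * (real p + 1)"
  shows "f = (\<lambda>_. 0)"
proof -
  obtain m where m: "p = 2 * m + 1" by (rule prime_ge_5_odd[OF p])
  define r where "r = - 24 * int p * k"
  define n where "n = k * (1 - (int p)\<^sup>2)"
  define g where "g = eta_form p r n"
    \<comment> \<open>without zero or pole at the cusp \<open>0\<close>\<close>
  define h where "h z = f z ^ (24 * m) * g z" for z
  have fhol: "f holomorphic_on upper_half_plane" and off: "\<And>z. Im z \<le> 0 \<Longrightarrow> f z = 0"
    and flim: "(slash k (matS) f \<longlongrightarrow> 0) at_inf"
    using f by (auto simp: cuspidal_space_def)
  have wt: "12 * n - int m * r = - int (24 * m) * k"
    using m by (simp add: n_def r_def power2_eq_square algebra_simps)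
  have ord0: "of_int n - of_int r * ((real p)\<^sup>2 - 1) / (24 * real p) = 0"
    using p by (simp add: n_def r_def field_simps)
  have g: "form p (- int (24 * m) * k) (\<lambda>d. legendre_char p d powi (- r)) g (of_int n) 0"
    using form_eta_form[OF p m, of n r] unfolding wt ord0 g_def .
  then have ghol: "g holomorphic_on upper_half_plane" by (simp add: form_def)
  obtain cg cg' where cg: "lead g (of_int n) cg" "lead (at_zero (- int (24 * m) * k) g) 0 cg'"
    using g by (auto simp: form_def)
  have inv: "norm (h (mob a b c d z)) = norm (h z)"
    if det: "a * d - b * c = 1" and c: "int p dvd c" and z: "Im z > 0" for a b c d :: int and z
  proof -
    define j where "j = aff c d z"
    define w where "w = mob a b c d z"
    have j: "j \<noteq> 0" using aff_nonzero[OF det z] by (simp add: j_def)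
    have d: "\<not> int p dvd d" using weight_on_coprime[OF det c] p by simp
    have "mat2 a b c d \<in> Gamma0 p" using det c by (simp add: Gamma0_def cong_0_iff)
    then have "slash k (mat2 a b c d) f = (\<lambda>z. \<psi> d * f z)" using f by (fastforce simp: cuspidal_space_def)
    from fun_cong[OF this, of z] z have "j powi (- k) * f w = \<psi> d * f z" by (simp add: slash_mat2 j_def w_def)
    then have "f w = j powi k * (\<psi> d * f z)" using j by (simp add: power_int_minus field_simps)
    then have nf: "norm (f w) = norm j powi k * norm (f z)" by (simp add: norm_mult norm d norm_power_int)
    have "g w = legendre_char p d powi (- r) * j powi (- int (24 * m) * k) * g z"
      using g det c z unfolding form_def weight_on_def j_def w_def by blast
    moreover have "norm (legendre_char p d) = 1"
      using d by (auto simp: legendre_char_def Legendre_def cong_0_iff)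
    ultimately have ng: "norm (g w) = norm j powi (- int (24 * m) * k) * norm (g z)"
      by (simp add: norm_mult norm_power_int)
    have "norm (h w) = (norm j powi k) ^ (24 * m) * norm j powi (- int (24 * m) * k) * norm (h z)"
      by (simp add: h_def norm_mult norm_power nf ng power_mult_distrib)
    also have "(norm j powi k) ^ (24 * m) = norm j powi (k * int (24 * m))"
      unfolding power_int_mult by (simp only: power_int_of_nat)
    also have "norm j powi (k * int (24 * m)) * norm j powi (- int (24 * m) * k) = norm j powi (k * int (24 * m) + - int (24 * m) * k)"
      using j by (subst power_int_add) auto
    also have "k * int (24 * m) + - int (24 * m) * k = 0" by simp
    finally show ?thesis by (simp add: w_def)
  qed
  have hhol: "h holomorphic_on upper_half_plane"
    unfolding h_def[abs_def] by (intro holomorphic_intros fhol ghol)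
  have hlim: "(h \<longlongrightarrow> 0) at_inf"
  proof (rule lead_tendsto_0)
    show "lead h (real (24 * m) * M + of_int n) (c ^ (24 * m) * cg)"
      unfolding h_def[abs_def] by (intro lead_mult lead_power l cg)
    have "real (24 * m) * M + of_int n = (real p - 1) * (12 * M - of_int k * (real p + 1))"
      using m by (simp add: n_def power2_eq_square algebra_simps)
    then show "real (24 * m) * M + of_int n > 0" using l(2) p by simp
  qed
  have hlim0: "((\<lambda>z. h (- 1 / z)) \<longlongrightarrow> 0) at_inf"
  proof -
    have m0: "24 * m > 0" using m p by simp
    have A: "((\<lambda>z. slash k (matS) f z ^ (24 * m) * at_zero (- int (24 * m) * k) g z) \<longlongrightarrow> 0 ^ (24 * m) * cg') at_inf"
      using cg(2) unfolding lead_0_iff by (intro tendsto_mult tendsto_power flim)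
    have B: "eventually (\<lambda>z. slash k (matS) f z ^ (24 * m) * at_zero (- int (24 * m) * k) g z = h (- 1 / z)) at_inf"
      using eventually_at_inf_gt[of 0]
    proof eventually_elim
      case (elim z)
      then have z0: "z \<noteq> 0" by auto
      have "slash k (matS) f z ^ (24 * m) = z powi (- k * int (24 * m)) * f (- 1 / z) ^ (24 * m)"
        using elim unfolding power_int_mult by (simp only: power_int_of_nat) (simp add: slash_mat2 power_mult_distrib)
      moreover have "at_zero (- int (24 * m) * k) g z = z powi (k * int (24 * m)) * g (- 1 / z)"
        by (simp add: at_zero_def mult.commute)
      moreover have "z powi (- k * int (24 * m)) * z powi (k * int (24 * m)) = 1"
        using z0 by (subst power_int_add[symmetric]) auto
      ultimately show ?case by (simp add: h_def)
    qed
    have Z: "(0 :: complex) ^ (24 * m) = 0" using m0 by (rule zero_power)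
    show ?thesis using Lim_transform_eventually[OF A B] unfolding Z mult_zero_left .
  qed
  have "f z = 0" if "Im z > 0" for z
    using Gamma0_invariant_vanishes[OF p(1) hhol inv hlim hlim0 that] eta_form_nonzero[of p z r n] p that
    by (simp add: h_def g_def)
  then show ?thesis using off by (metis not_le)
qed

text \<open>Filtration by the order at infinity: each of the M steps has codimension at most one,
  since a single coefficient decides whether the order rises, and order M forces f = 0.\<close>

lemma cuspidal_space_finite_span:
  assumes p: "prime p" "p \<ge> 5" and norm: "\<And>d. \<not> int p dvd d \<Longrightarrow> norm (\<psi> d) = 1" and one: "\<psi> 1 = 1"
    and M: "12 * real M > of_int k * (real p + 1)"
  obtains W where "finite W" "card W \<le> M" "cuspidal_space p k \<psi> \<subseteq> cfun.span W"
proof -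
  define V where "V n = {f \<in> cuspidal_space p k \<psi>. \<exists>c. lead f (real n) c}" for n
  have "\<exists>W. finite W \<and> card W \<le> i \<and> V (M - i) \<subseteq> cfun.span W" if "i \<le> M" for i
    using that
  proof (induction i)
    case 0
    have "f = 0" if "f \<in> V M" for f
    proof -
      obtain c where "f \<in> cuspidal_space p k \<psi>" "lead f (real M) c" using \<open>f \<in> V M\<close> by (auto simp: V_def)
      from cuspidal_space_high_order[where \<psi> = \<psi>, OF p norm this M] show ?thesis by (simp add: zero_fun_def)
    qed
    then show ?case by (intro exI[of _ "{}"]) auto
  next
    case (Suc i)
    define n where "n = M - Suc i"
    have n: "Suc n = M - i" using Suc.prems by (simp add: n_def)
    obtain W where W: "finite W" "card W \<le> i" "V (Suc n) \<subseteq> cfun.span W"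
      using Suc n by auto
    have up: "f \<in> V (Suc n)" if f: "f \<in> cuspidal_space p k \<psi>" "lead f (real n) 0" for f
    proof -
      have "f holomorphic_on upper_half_plane" using f(1) by (simp add: cuspidal_space_def)
      from lead_step[OF this cuspidal_space_translate[OF f(1) one] f(2)] f(1) show ?thesis
        by (auto simp: V_def)
    qed
    show ?case
    proof (cases "\<forall>f\<in>V n. lead f (real n) 0")
      case True
      then have "V n \<subseteq> V (Suc n)" using up by (auto simp: V_def)
      then show ?thesis using W by (auto simp: n_def[symmetric] intro!: exI[of _ W])
    next
      case False
      then obtain v c where v: "v \<in> cuspidal_space p k \<psi>" "lead v (real n) c" "\<not> lead v (real n) 0"
        by (auto simp: V_def)
      then have c: "c \<noteq> 0" by auto
      have "V n \<subseteq> cfun.span (insert v W)"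
      proof
        fix f assume "f \<in> V n"
        then obtain x where f: "f \<in> cuspidal_space p k \<psi>" "lead f (real n) x" by (auto simp: V_def)
        \<comment> \<open>Subtracting a multiple of \<open>v\<close> cancels the coefficient of q^n;
          by \<open>lead_step\<close> the order then rises by one.\<close>
        define u where "u z = f z + (- x / c) * v z" for z
        have "lead u (real n) 0"
        proof -
          have "((\<lambda>z. f z * nome (- of_real (real n) * z) + (- x / c) * (v z * nome (- of_real (real n) * z))) \<longlongrightarrow> x + (- x / c) * c) at_inf"
            using f(2) v(2) unfolding lead_def by (intro tendsto_intros)
          then show ?thesis using c by (simp add: lead_def u_def algebra_simps)
        qed
        moreover have "u \<in> cuspidal_space p k \<psi>"
          unfolding u_def[abs_def] by (rule cuspidal_space_lincomb[OF f(1) v(1)])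
        ultimately have "u \<in> cfun.span W" using up W(3) by blast
        then have "u \<in> cfun.span (insert v W)" using cfun.span_mono[of W "insert v W"] by blast
        moreover have "cfun_scale (x / c) v \<in> cfun.span (insert v W)"
          by (intro cfun.span_scale cfun.span_base) simp
        ultimately have "u + (\<lambda>z. x / c * v z) \<in> cfun.span (insert v W)" by (rule cfun.span_add)
        also have "u + (\<lambda>z. x / c * v z) = f" by (simp add: u_def fun_eq_iff)
        finally show "f \<in> cfun.span (insert v W)" .
      qed
      moreover have "card (insert v W) \<le> Suc i" using W by (simp add: card_insert_if)
      ultimately show ?thesis using W(1) by (auto simp: n_def[symmetric] intro!: exI[of _ "insert v W"])
    qed
  qed
  from this[of M] obtain W where W: "finite W" "card W \<le> M" "V 0 \<subseteq> cfun.span W" by auto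
  have "cuspidal_space p k \<psi> \<subseteq> V 0"
    by (auto simp: V_def lead_0_iff cuspidal_space_def)
  with W that show thesis by blast
qed

section \<open>Two-sided estimates for the dimensions of both spaces of cusp forms\<close>

lemma vanishes_at_infinity_tendsto:
  assumes "vanishes_at_infinity g" shows "(g \<longlongrightarrow> 0) at_inf"
proof -
  obtain w a where "w > 0" "q_expansion w a g" "a 0 = 0" using assms by (auto simp: vanishes_at_infinity_def)
  from q_expansion_tendsto[OF this(1,2)] this(3) show ?thesis by simp
qed

lemma slash_one: "(\<And>z. Im z \<le> 0 \<Longrightarrow> f z = 0) \<Longrightarrow> slash k (mat2 1 0 0 1) f = f"
  by (auto simp: slash_def fun_eq_iff not_less)

lemma cusp_forms_subset_cuspidal_space:
  assumes "f \<in> cusp_forms k G" "\<And>A. A \<in> Gamma0 p \<Longrightarrow> slash k A f = (\<lambda>z. \<psi> (A $ 2 $ 2) * f z)"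
  shows "f \<in> cuspidal_space p k \<psi>"
proof -
  have f: "f holomorphic_on upper_half_plane" "\<And>z. Im z \<le> 0 \<Longrightarrow> f z = 0"
    "\<And>A. A \<in> SL2Z \<Longrightarrow> vanishes_at_infinity (slash k A f)"
    using assms(1) by (auto simp: cusp_forms_def modular_forms_def)
  have "(slash k (mat2 1 0 0 1) f \<longlongrightarrow> 0) at_inf" "(slash k (matS) f \<longlongrightarrow> 0) at_inf"
    by (intro vanishes_at_infinity_tendsto f(3); simp)+
  then show ?thesis using assms(2) f(1,2) by (simp add: cuspidal_space_def slash_one)
qed

lemma cusp_forms_Gamma0_subset: "cusp_forms k (Gamma0 p) \<subseteq> cuspidal_space p k (\<lambda>_. 1)"
proof
  fix f assume f: "f \<in> cusp_forms k (Gamma0 p)"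
  then have "slash k A f = f" if "A \<in> Gamma0 p" for A
    using that by (auto simp: cusp_forms_def modular_forms_def)
  then show "f \<in> cuspidal_space p k (\<lambda>_. 1)"
    using cusp_forms_subset_cuspidal_space[OF f, where \<psi> = "\<lambda>_. 1"] by simp
qed

lemma cusp_forms_char_subset: "cusp_forms_char k p \<psi> \<subseteq> cuspidal_space p k \<psi>"
  using cusp_forms_subset_cuspidal_space by (fastforce simp: cusp_forms_char_def)

lemma norm_legendre_char: "\<not> int p dvd d \<Longrightarrow> norm (legendre_char p d) = 1"
  by (auto simp: legendre_char_def Legendre_def cong_0_iff)

text \<open>\<open>B\<close> carries the character at a starting weight \<open>k1\<close>; powers of
  the weight 2 form and the family of weight 12 N supply the remaining even weight. The gap between
  the two bounds is independent of \<open>k\<close>.\<close>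

lemma cusp_dim_estimate:
  fixes V :: "(complex \<Rightarrow> complex) set" and k :: nat
  assumes p: "prime p" "p \<ge> 5" and norm: "\<And>d. \<not> int p dvd d \<Longrightarrow> norm (\<psi> d) = 1" and one: "\<psi> 1 = 1"
    and V: "V \<subseteq> cuspidal_space p (int k) \<psi>" "\<And>f a b. form p (int k) \<psi> f a b \<Longrightarrow> a > 0 \<Longrightarrow> b > 0 \<Longrightarrow> restrict_hp f \<in> V"
    and B: "form p k1 \<psi> B 0 m1" "m1 \<ge> 0" and k1: "k1 \<ge> 0" "even (int k - k1)"
  shows "\<bar>real (cfun.dim V) - real k * (real p + 1) / 12\<bar> \<le> (real p + 1) * (real p + 2 + of_int k1)"
proof -
  obtain D where D: "form p 2 (\<lambda>_. 1) D 0 0" using form_weight_2[OF p] .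
  define M where "M = k * (p + 1) div 12 + 1"
  have "k * (p + 1) < 12 * M" by (simp add: M_def) 
  then have "real (k * (p + 1)) < real (12 * M)" by (simp only: of_nat_less_iff)
  then have M: "12 * real M > of_int (int k) * (real p + 1)" by (simp add: algebra_simps)
  obtain W where W: "finite W" "card W \<le> M" "cuspidal_space p (int k) \<psi> \<subseteq> cfun.span W"
    by (rule cuspidal_space_finite_span[where \<psi> = \<psi>, OF p norm one M])
  have "cfun.dim V \<le> M" using cfun.dim_le_card[OF order_trans[OF V(1) W(3)] W(1)] W(2) by simp
  moreover have "12 * (k * (p + 1) div 12) \<le> k * (p + 1)" by simp
  ultimately have "12 * cfun.dim V \<le> k * (p + 1) + 12" by (simp add: M_def)
  then have "real (12 * cfun.dim V) \<le> real (k * (p + 1) + 12)" by (simp only: of_nat_le_iff)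
  then have upper: "real (cfun.dim V) \<le> real k * (real p + 1) / 12 + 1" by (simp add: field_simps)
  \<comment> \<open>The decomposition k = k1 + 2 j + 12 N with j at most 5, so that replacing k by
    12 N costs a bounded amount.\<close>
  define l where "l = (int k - k1) div 2"
  define j where "j = nat (l mod 6)"
  define N where "N = l div 6"
  have kl: "int k = k1 + 2 * int j + 12 * N"
  proof -
    have "2 * l = int k - k1" using k1(2) by (simp add: l_def)
    moreover have "l = 6 * N + l mod 6" by (simp add: N_def)
    moreover have "int j = l mod 6" by (simp add: j_def)
    ultimately show ?thesis by linarith
  qed
  have j: "int j \<le> 5" by (simp add: j_def)
  have lower: "(int p + 1) * (N - int p) \<le> int (cfun.dim V)"
  proof (cases "N \<ge> 0")
    case True
    have "form p (int j * 2 + k1) (\<lambda>d. 1 ^ j * \<psi> d) (\<lambda>z. D z ^ j * B z) (real j * 0 + 0) (real j * 0 + m1)"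
      by (intro form_mult form_power D B)
    then have "form p (int j * 2 + k1) \<psi> (\<lambda>z. D z ^ j * B z) 0 m1" by simp
    from cusp_dim_lower_bound[OF p this B(2) True _ V(2) order_trans[OF V(1) W(3)] W(1)] show ?thesis
      using kl by (simp add: add_ac mult.commute)
  next
    case False
    \<comment> \<open>For small k no forms are constructed and the lower bound is not
      positive.\<close>
    then have "(int p + 1) * (N - int p) \<le> 0" by (intro mult_nonneg_nonpos) auto
    then show ?thesis by linarith
  qed
  have "12 * (N - int p) \<ge> int k - (k1 + 10 + 12 * int p)" using kl j by simp
  then have "(int p + 1) * (int k - (k1 + 10 + 12 * int p)) \<le> (int p + 1) * (12 * (N - int p))"
    by (intro mult_left_mono) auto
  also have "\<dots> = 12 * ((int p + 1) * (N - int p))" by (rule mult.left_commute)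
  also have "\<dots> \<le> 12 * int (cfun.dim V)" using lower by (intro mult_left_mono) auto
  finally have "real_of_int ((int p + 1) * (int k - (k1 + 10 + 12 * int p))) \<le> real_of_int (12 * int (cfun.dim V))"
    by (simp only: of_int_le_iff)
  then have "(real p + 1) * (real k - (of_int k1 + 10 + 12 * real p)) \<le> 12 * real (cfun.dim V)" by simp
  then have "real k * (real p + 1) - (real p + 1) * (of_int k1 + 10 + 12 * real p) \<le> 12 * real (cfun.dim V)"
    by (simp add: algebra_simps)
  moreover have "(real p + 1) * (of_int k1 + 10 + 12 * real p) \<le> (real p + 1) * (12 * (real p + 2 + of_int k1))"
    using k1 by (intro mult_left_mono) auto
  ultimately have "real k * (real p + 1) / 12 - (real p + 1) * (real p + 2 + of_int k1) \<le> real (cfun.dim V)"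
    by (simp add: field_simps)
  moreover have "1 * 1 \<le> (real p + 1) * (real p + 2 + of_int k1)" using k1 by (intro mult_mono) auto
  ultimately show ?thesis using upper by linarith
qed

lemma dim_cusp_forms_Gamma0_estimate:
  assumes p: "prime p" "p \<ge> 5"
  obtains C where "\<And>k. even k \<Longrightarrow> \<bar>real (cfun.dim (cusp_forms (int k) (Gamma0 p))) - real k * (real p + 1) / 12\<bar> \<le> C"
proof
  fix k :: nat assume k: "even k"
  show "\<bar>real (cfun.dim (cusp_forms (int k) (Gamma0 p))) - real k * (real p + 1) / 12\<bar> \<le> (real p + 1) * (real p + 2 + of_int 0)"
  proof (rule cusp_dim_estimate[OF p, where \<psi> = "\<lambda>_. 1"])
    show "restrict_hp f \<in> cusp_forms (int k) (Gamma0 p)" if "form p (int k) (\<lambda>_. 1) f a b" "a > 0" "b > 0" for f a b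
      using form_modular(2)[OF p(1) that(1), of "Gamma0 p"] that Gamma1_subset by simp
  qed (use form_one cusp_forms_Gamma0_subset k in auto)
qed

text \<open>The starting form is E, of weight (p - 1)/2 and order 0 at infinity; the parity
  condition is the one forced by the action of -1.\<close>

lemma dim_cusp_forms_char_estimate:
  assumes p: "prime p" "p \<ge> 5"
  obtains C where "\<And>k. even (int k - (int p - 1) div 2) \<Longrightarrow>
    \<bar>real (cfun.dim (cusp_forms_char (int k) p (legendre_char p))) - real k * (real p + 1) / 12\<bar> \<le> C"
proof
  fix k :: nat assume k: "even (int k - (int p - 1) div 2)"
  obtain m where m: "p = 2 * m + 1" by (rule prime_ge_5_odd[OF p])
  have m': "(int p - 1) div 2 = int m" using m by simp
  show "\<bar>real (cfun.dim (cusp_forms_char (int k) p (legendre_char p))) - real k * (real p + 1) / 12\<bar>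
     \<le> (real p + 1) * (real p + 2 + of_int ((int p - 1) div 2))"
  proof (rule cusp_dim_estimate[OF p, where \<psi> = "legendre_char p"])
    show "form p ((int p - 1) div 2) (legendre_char p) (eta_ratio p) 0 (((real p)\<^sup>2 - 1) / (24 * real p))"
      unfolding m' by (rule form_eta_ratio[OF p m])
    show "0 \<le> ((real p)\<^sup>2 - 1) / (24 * real p)" using p by (simp add: power2_eq_square mult_ge1_I)
    show "restrict_hp f \<in> cusp_forms_char (int k) p (legendre_char p)"
      if f: "form p (int k) (legendre_char p) f a b" "a > 0" "b > 0" for f a b
    proof -
      have "legendre_char p (A $ 2 $ 2) = 1" if "A \<in> Gamma1 p" for A :: "int^2^2"
        using that p by (intro legendre_char_1) (auto simp: Gamma1_def)
      then have "restrict_hp f \<in> cusp_forms (int k) (Gamma1 p)"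
        using form_modular(2)[OF p(1) f(1), of "Gamma1 p"] f Gamma1_subset by auto
      then show ?thesis using form_slash[OF f(1)] by (simp add: cusp_forms_char_def)
    qed
    show "legendre_char p 1 = 1" using p by (intro legendre_char_1) auto
  qed (use cusp_forms_char_subset norm_legendre_char k m' in auto)
qed

subsection \<open>Asymptotics\<close>

lemma card_residue_class_estimate:
  fixes M X a :: int
  assumes M: "M > 0" and X: "X \<ge> 0"
  shows "\<bar>real (card {n. 0 \<le> n \<and> n \<le> X \<and> M dvd n - a}) - of_int X / of_int M\<bar> \<le> 1"
proof -
  define r where "r = a mod M"
  have r: "0 \<le> r" "r < M" using M by (simp_all add: r_def)
  have "{n. 0 \<le> n \<and> n \<le> X \<and> M dvd n - a} = (\<lambda>t. r + M * t) ` {0..(X - r) div M}"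
  proof (intro equalityI subsetI)
    fix n assume "n \<in> {n. 0 \<le> n \<and> n \<le> X \<and> M dvd n - a}"
    then have n: "0 \<le> n" "n \<le> X" "n mod M = r" by (simp_all add: r_def mod_eq_dvd_iff)
    have "n = r + M * (n div M)" using n(3) mult_div_mod_eq[of M n] by linarith
    moreover have "n div M \<ge> 0" using n M by (simp add: pos_imp_zdiv_nonneg_iff)
    moreover have "n div M \<le> (X - r) div M"
    proof -
      have "M * (n div M) \<le> X - r" using n(2) \<open>n = r + M * (n div M)\<close> by linarith
      then have "(M * (n div M)) div M \<le> (X - r) div M" using M by (intro zdiv_mono1) auto
      then show ?thesis using M by simp
    qed
    ultimately show "n \<in> (\<lambda>t. r + M * t) ` {0..(X - r) div M}" by auto
  next
    fix n assume "n \<in> (\<lambda>t. r + M * t) ` {0..(X - r) div M}"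
    then obtain t where "n = r + M * t" "t \<in> {0..(X - r) div M}" by (elim imageE)
    then have t: "n = r + M * t" "0 \<le> t" "t \<le> (X - r) div M" by simp_all
    have "M * t \<le> M * ((X - r) div M)" using t M by simp
    also have "\<dots> \<le> X - r" using mult_div_mod_eq[of M "X - r"] pos_mod_sign[OF M, of "X - r"] by linarith
    finally have "n \<le> X" using t by simp
    moreover have "M dvd n - a" unfolding t(1) by (simp add: r_def mod_eq_dvd_iff[symmetric])
    ultimately show "n \<in> {n. 0 \<le> n \<and> n \<le> X \<and> M dvd n - a}" using t r M by simp
  qed
  moreover have "inj_on (\<lambda>t. r + M * t) A" for A using M by (simp add: inj_on_def)
  ultimately have card: "card {n. 0 \<le> n \<and> n \<le> X \<and> M dvd n - a} = nat ((X - r) div M + 1)"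
    by (simp add: card_image)
  \<comment> \<open>If X < r, the class has no member up to X and the quotient is -1; it is never
    smaller, so \<open>nat\<close> loses nothing.\<close>
  have "(- 1) * M \<le> X - r" using X r by simp
  then have "((- 1) * M) div M \<le> (X - r) div M" using M by (intro zdiv_mono1)
  moreover have "((- 1) * M) div M = - 1" using M by (intro nonzero_mult_div_cancel_right) simp
  ultimately have "- 1 \<le> (X - r) div M" by simp
  with card have "real (card {n. 0 \<le> n \<and> n \<le> X \<and> M dvd n - a}) = of_int ((X - r) div M) + 1" by simp
  moreover have "real_of_int ((X - r) div M) = of_int \<lfloor>(of_int (X - r) :: real) / of_int M\<rfloor>"
    by (simp only: floor_divide_of_int_eq)
  moreover have "(of_int (X - r) :: real) / of_int M = of_int X / of_int M - of_int r / of_int M"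
    by (simp add: diff_divide_distrib)
  moreover have "0 \<le> (of_int r :: real) / of_int M" "(of_int r :: real) / of_int M < 1" using r M by simp_all
  ultimately show ?thesis by linarith
qed

text \<open>The origin of h: this gcd decides whether 12 n = k is solvable modulo (p - 1)/2. It
  depends only on p modulo 24.\<close>

lemma eta_h_gcd:
  assumes p: "prime p" "p \<ge> 5"
  shows "eta_h p = gcd ((p - 1) div 2) 12"
proof -
  define s where "s = p mod 24"
  have p24: "p = 24 * (p div 24) + s" by (simp add: s_def)
  have "\<not> 2 dvd p" "\<not> 3 dvd p" using p unfolding prime_nat_iff by fastforce+
  then have "\<not> 2 dvd s" "\<not> 3 dvd s" unfolding s_def by (simp_all add: dvd_mod_iff)
  moreover have "\<forall>s\<in>{..<24::nat}. \<not> 2 dvd s \<longrightarrow> \<not> 3 dvd s \<longrightarrow> s \<in> {1, 5, 7, 11, 13, 17, 19, 23}"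
    by code_simp
  ultimately have cases: "s \<in> {1, 5, 7, 11, 13, 17, 19, 23}" by (simp add: s_def)
  have "odd s" using \<open>\<not> 2 dvd s\<close> .
  then obtain t where t: "s = 2 * t + 1" by (elim oddE)
  have "(p - 1) div 2 = 12 * (p div 24) + t"
    by (subst p24) (simp add: t)
  then have "gcd ((p - 1) div 2) 12 = gcd t 12"
    using gcd_red_nat[of "12 * (p div 24) + t" 12] gcd_red_nat[of t 12] by simp
  moreover have "gcd 0 12 = (12::nat)" "gcd 2 12 = (2::nat)" "gcd 3 12 = (3::nat)" "gcd 5 12 = (1::nat)"
    "gcd 6 12 = (6::nat)" "gcd 8 12 = (4::nat)" "gcd 9 12 = (3::nat)" "gcd 11 12 = (1::nat)"
    by code_simp+
  moreover have "t \<in> {0, 2, 3, 5, 6, 8, 9, 11}" using cases t by auto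
  ultimately show ?thesis unfolding eta_h_def s_def[symmetric] t by auto
qed

text \<open>After division by h = gcd(m, 12), the coefficient 12/h is invertible modulo M = m/h, so
  n runs through one residue class modulo M. The error 2 is 1 from counting the class and 1 from
  rounding the bound X down.\<close>

lemma dim_eta_space_estimate:
  assumes p: "prime p" "p \<ge> 5" and k: "eta_h p dvd k"
  shows "\<bar>real (cfun.dim (eta_space (int k) p)) - real k * ((real p + 1) * real (eta_h p) / (6 * (real p - 1)))\<bar> \<le> 2"
proof -
  obtain m where m: "p = 2 * m + 1" by (rule prime_ge_5_odd[OF p])
  define h where "h = eta_h p"
  have h: "h = gcd m 12" using eta_h_gcd[OF p] m by (simp add: h_def)
  have m0: "m > 0" using m p by simp
  define M where "M = m div h"
  define L where "L = 12 div h"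
  have hM: "m = h * M" "12 = h * L" by (simp_all add: M_def L_def h)
  have h0: "h > 0" using m0 by (simp add: h)
  have M0: "M > 0" using hM(1) m0 by (cases M) auto
  have "coprime M L" unfolding M_def L_def h using m0 by (intro div_gcd_coprime) auto
  then have "coprime (int L) (int M)" by (simp add: coprime_commute)
  then obtain x where x: "[int L * x = 1] (mod int M)" using cong_solve_coprime_int by blast
  obtain k' where k': "k = h * k'" using k unfolding h_def by blast
  have iff: "int m dvd 12 * n - int k \<longleftrightarrow> int M dvd n - x * int k'" for n
  proof -
    have "12 * n - int k = int h * (int L * n - int k')"
    proof -
      have "12 = int h * int L" using arg_cong[OF hM(2), of int] by simp
      then show ?thesis by (simp add: k' algebra_simps)
    qed
    moreover have "int m = int h * int M" by (subst hM(1)) simp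
    ultimately have "int m dvd 12 * n - int k \<longleftrightarrow> int M dvd int L * n - int k'" using h0 by simp
    also have "\<dots> \<longleftrightarrow> [int L * n = int k'] (mod int M)" by (simp add: cong_iff_dvd_diff)
    also have "\<dots> \<longleftrightarrow> [n = x * int k'] (mod int M)"
    proof
      assume "[int L * n = int k'] (mod int M)"
      then have "[x * (int L * n) = x * int k'] (mod int M)" by (intro cong_mult cong_refl)
      moreover have "[x * (int L * n) = n] (mod int M)"
        using cong_mult[OF x cong_refl[of n]] by (simp add: mult_ac)
      ultimately show "[n = x * int k'] (mod int M)" using cong_sym cong_trans by blast
    next
      assume "[n = x * int k'] (mod int M)"
      then have "[int L * n = int L * (x * int k')] (mod int M)" by (intro cong_mult cong_refl)
      moreover have "[int L * (x * int k') = int k'] (mod int M)"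
        using cong_mult[OF x cong_refl[of "int k'"]] by (simp add: mult_ac)
      ultimately show "[int L * n = int k'] (mod int M)" using cong_trans by blast
    qed
    finally show ?thesis by (simp add: cong_iff_dvd_diff)
  qed
  define X where "X = int k * (int p + 1) div 12"
  have "12 * n \<le> int k * (int p + 1) \<longleftrightarrow> n \<le> X" for n by (auto simp: X_def)
  moreover have "(int p - 1) div 2 = int m" using m by simp
  ultimately have orders: "eta_orders (int k) p = {n. 0 \<le> n \<and> n \<le> X \<and> int M dvd n - x * int k'}"
    unfolding eta_orders_def by (simp add: iff)
  then have card: "\<bar>real (cfun.dim (eta_space (int k) p)) - of_int X / real M\<bar> \<le> 1"
  proof -
    have "X \<ge> 0" by (simp add: X_def pos_imp_zdiv_nonneg_iff)
    then show ?thesis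
      using card_residue_class_estimate[of "int M" X "x * int k'"] M0
      unfolding dim_eta_space[OF p] orders by simp
  qed
  define Y where "Y = real k * (real p + 1) / 12"
  have "of_int X = (of_int \<lfloor>Y\<rfloor> :: real)"
    using floor_divide_of_int_eq[of "int k * (int p + 1)" 12, where 'a = real] by (simp add: X_def Y_def)
  then have "\<bar>of_int X - Y\<bar> \<le> 1" by linarith
  moreover have "1 \<le> real M" using M0 by simp
  ultimately have "\<bar>of_int X - Y\<bar> / real M \<le> 1" by (simp add: divide_le_eq)
  then have "\<bar>of_int X / real M - Y / real M\<bar> \<le> 1" by (simp add: abs_divide flip: diff_divide_distrib)
  moreover have "Y / real M = real k * ((real p + 1) * real h / (6 * (real p - 1)))"
  proof -
    have "real p - 1 = 2 * (real h * real M)" using m hM(1) by (metis add_diff_cancel_right' of_nat_1 of_nat_add of_nat_mult of_nat_numeral)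
    then show ?thesis using h0 M0 by (simp add: Y_def field_simps)
  qed
  ultimately show ?thesis using card unfolding h_def by linarith
qed

lemma linear_growth_tendsto:
  fixes A :: "nat \<Rightarrow> real"
  assumes "\<And>k. P k \<Longrightarrow> \<bar>A k - real k * \<alpha>\<bar> \<le> C"
  shows "((\<lambda>k. A k / real k) \<longlongrightarrow> \<alpha>) (at_infinity_along P)"
proof -
  have "((\<lambda>k. A k / real k - \<alpha>) \<longlongrightarrow> 0) (at_infinity_along P)"
  proof (rule Lim_null_comparison)
    have "eventually (\<lambda>k. k > 0) (at_infinity_along P)"
      by (rule filter_leD[OF inf_le1]) (rule eventually_gt_at_top)
    moreover have "eventually P (at_infinity_along P)"
      by (rule filter_leD[OF inf_le2]) (simp add: eventually_principal)
    ultimately show "eventually (\<lambda>k. norm (A k / real k - \<alpha>) \<le> C / real k) (at_infinity_along P)"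
    proof eventually_elim
      case (elim k)
      then have "A k / real k - \<alpha> = (A k - real k * \<alpha>) / real k" by (simp add: field_simps)
      then show ?case using assms[OF elim(2)] elim(1) by (simp add: abs_divide divide_right_mono)
    qed
    show "((\<lambda>k. C / real k) \<longlongrightarrow> 0) (at_infinity_along P)"
      by (rule tendsto_mono[OF inf_le1]) real_asymp
  qed
  then show ?thesis by (simp add: LIM_zero_iff)
qed

lemma linear_growth_ratio_tendsto:
  fixes A B :: "nat \<Rightarrow> real"
  assumes "\<And>k. P k \<Longrightarrow> \<bar>A k - real k * \<alpha>\<bar> \<le> C" "\<And>k. P k \<Longrightarrow> \<bar>B k - real k * \<beta>\<bar> \<le> D" "\<beta> \<noteq> 0"
  shows "((\<lambda>k. A k / B k) \<longlongrightarrow> \<alpha> / \<beta>) (at_infinity_along P)"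
proof -
  have "((\<lambda>k. (A k / real k) / (B k / real k)) \<longlongrightarrow> \<alpha> / \<beta>) (at_infinity_along P)"
    by (intro tendsto_divide linear_growth_tendsto[OF assms(1)] linear_growth_tendsto[OF assms(2)] assms(3))
  moreover have "eventually (\<lambda>k. k > 0) (at_infinity_along P)"
    by (rule filter_leD[OF inf_le1]) (rule eventually_gt_at_top)
  then have "eventually (\<lambda>k. (A k / real k) / (B k / real k) = A k / B k) (at_infinity_along P)"
    by eventually_elim simp
  ultimately show ?thesis by (rule Lim_transform_eventually)
qed

theorem corollary5p6:
  fixes p :: nat
  assumes "prime p" and "p \<ge> 5"
  shows
    "([p = 3] (mod 4) \<longrightarrow>
       ((\<lambda>k. real (cfun.dim (eta_space (int k) p)) /
              real (cfun.dim (cusp_forms_char (int k) p (legendre_char p))))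
         \<longlongrightarrow> 2 * real (eta_h p) / (real p - 1))
        (at_infinity_along (\<lambda>k. odd k \<and> eta_h p dvd k))) \<and>
     ([p = 3] (mod 4) \<longrightarrow>
       ((\<lambda>k. real (cfun.dim (eta_space (int k) p)) /
              real (cfun.dim (cusp_forms (int k) (Gamma0 p))))
         \<longlongrightarrow> 2 * real (eta_h p) / (real p - 1))
        (at_infinity_along (\<lambda>k. even k \<and> eta_h p dvd k))) \<and>
     ([p = 1] (mod 4) \<longrightarrow>
       ((\<lambda>k. real (cfun.dim (eta_space (int k) p)) /
              (real (cfun.dim (cusp_forms (int k) (Gamma0 p))) +
               real (cfun.dim (cusp_forms_char (int k) p (legendre_char p)))))
         \<longlongrightarrow> real (eta_h p) / (real p - 1))
        (at_infinity_along (\<lambda>k. eta_h p dvd k)))"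
proof -
  define h where "h = real (eta_h p)"
  define \<alpha> where "\<alpha> = (real p + 1) * h / (6 * (real p - 1))"
  define \<beta> where "\<beta> = (real p + 1) / 12"
  have p1: "real p + 1 > 0" "real p - 1 > 0" using assms(2) by simp_all
  then have \<beta>: "\<beta> \<noteq> 0" "2 * \<beta> \<noteq> 0" by (simp_all add: \<beta>_def)
  have ratio: "\<alpha> / \<beta> = 2 * h / (real p - 1)" "\<alpha> / (2 * \<beta>) = h / (real p - 1)"
  proof -
    have "real p + 1 \<noteq> 0" "real p - 1 \<noteq> 0" using p1 by auto
    then show "\<alpha> / \<beta> = 2 * h / (real p - 1)" by (simp add: \<alpha>_def \<beta>_def divide_simps)
    moreover have "\<alpha> / (2 * \<beta>) = \<alpha> / \<beta> / 2" using \<beta>(1) by (simp add: field_simps)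
    ultimately show "\<alpha> / (2 * \<beta>) = h / (real p - 1)" by (simp only:) simp
  qed
  have eta: "\<bar>real (cfun.dim (eta_space (int k) p)) - real k * \<alpha>\<bar> \<le> 2" if "eta_h p dvd k" for k
    using dim_eta_space_estimate[OF assms that] by (simp add: \<alpha>_def h_def)
  obtain C0 where C0: "\<And>k. even k \<Longrightarrow> \<bar>real (cfun.dim (cusp_forms (int k) (Gamma0 p))) - real k * \<beta>\<bar> \<le> C0"
    using dim_cusp_forms_Gamma0_estimate[OF assms] by (metis \<beta>_def times_divide_eq_right)
  obtain C1 where C1: "\<And>k. even (int k - (int p - 1) div 2) \<Longrightarrow>
      \<bar>real (cfun.dim (cusp_forms_char (int k) p (legendre_char p))) - real k * \<beta>\<bar> \<le> C1"
    using dim_cusp_forms_char_estimate[OF assms] by (metis \<beta>_def times_divide_eq_right)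
  have "even (int k - (int p - 1) div 2)" if "[p = 3] (mod 4)" "odd k" for k
  proof -
    have "p mod 4 = 3" using that(1) by (simp add: cong_def)
    then have "odd ((int p - 1) div 2)" by presburger
    then show ?thesis using that(2) by simp
  qed
  then have 1: "((\<lambda>k. real (cfun.dim (eta_space (int k) p)) / real (cfun.dim (cusp_forms_char (int k) p (legendre_char p))))
      \<longlongrightarrow> \<alpha> / \<beta>) (at_infinity_along (\<lambda>k. odd k \<and> eta_h p dvd k))" if "[p = 3] (mod 4)"
    by (intro linear_growth_ratio_tendsto[OF eta C1 \<beta>(1)]) (use that in auto)
  have 2: "((\<lambda>k. real (cfun.dim (eta_space (int k) p)) / real (cfun.dim (cusp_forms (int k) (Gamma0 p))))
      \<longlongrightarrow> \<alpha> / \<beta>) (at_infinity_along (\<lambda>k. even k \<and> eta_h p dvd k))"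
    by (intro linear_growth_ratio_tendsto[OF eta C0 \<beta>(1)]) auto
  have 3: "((\<lambda>k. real (cfun.dim (eta_space (int k) p)) / (real (cfun.dim (cusp_forms (int k) (Gamma0 p))) +
               real (cfun.dim (cusp_forms_char (int k) p (legendre_char p)))))
      \<longlongrightarrow> \<alpha> / (2 * \<beta>)) (at_infinity_along (\<lambda>k. eta_h p dvd k))" if p4: "[p = 1] (mod 4)"
  proof (rule linear_growth_ratio_tendsto[OF eta _ \<beta>(2)])
    fix k assume k: "eta_h p dvd k"
    have "p mod 4 = 1" using p4 by (simp add: cong_def)
    then have m: "even ((p - 1) div 2)" "even ((int p - 1) div 2)" by presburger+
    \<comment> \<open>Since h is even here, every k divisible by h meets the parity conditions of
      both estimates.\<close>
    have "2 dvd gcd ((p - 1) div 2) 12" by (intro gcd_greatest m) simp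
    then have "even k" using k unfolding eta_h_gcd[OF assms] using dvd_trans by blast
    moreover from this have "even (int k - (int p - 1) div 2)" using m(2) by simp
    ultimately have "\<bar>real (cfun.dim (cusp_forms (int k) (Gamma0 p))) - real k * \<beta>\<bar> \<le> C0"
      "\<bar>real (cfun.dim (cusp_forms_char (int k) p (legendre_char p))) - real k * \<beta>\<bar> \<le> C1"
      using C0 C1 by auto
    then show "\<bar>real (cfun.dim (cusp_forms (int k) (Gamma0 p))) +
               real (cfun.dim (cusp_forms_char (int k) p (legendre_char p))) - real k * (2 * \<beta>)\<bar> \<le> C0 + C1"
      by linarith
  qed
  show ?thesis using 1 2 3 unfolding ratio h_def by blast
qed

end
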